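(* Let $(S,\psi)$ be an embedded Poisson submanifold of a Poisson manifold $(M,\pi)$, with infinitesimal Poisson algebra $\mathcal P$. Then $\mathrm H^1(\mathcal P)=\{0\}$ if the following cohomologies in degree one are trivial: (a) the Poisson cohomology of $(S,\psi)$, i.e. $\mathrm H^1(S,\psi)=\{0\}$; (b) the Lie algebra cohomology of $\mathcal G=(\Gamma E^*,[\cdot,\cdot]_1)$ with coefficients in the adjoint representation, i.e. $\mathrm H^1(\mathcal G,\mathcal G)=\{0\}$; (c) the cohomology of the cochain complex $(\mathfrak Z^\bullet,\partial_{\mathcal D})$, i.e. $\mathrm H^1_{\partial_{\mathcal D}}=\{0\}$.
   Context: Infinitesimal Poisson algebra. Everything is smooth; $C^\infty_S$ is the algebra of smooth functions on $S$. On a Poisson manifold $(M,\pi)$ put $\pi^\sharp\alpha=\pi(\alpha,\cdot)$, $\{f,g\}_\pi=\pi(df,dg)$, $[\alpha,\beta]_\pi=L_{\pi^\sharp\alpha}\beta-L_{\pi^\sharp\beta}\alpha-d(\pi(\alpha,\beta))$. Let $(S,\psi)\hookrightarrow(M,\pi)$ be an embedded Poisson submanifold, $E=T_SM/TS$ its normal bundle, $E^*\simeq TS^\circ\subset T^*_SM$ the conormal bundle. The cotangent Lie algebroid of $M$ restricts to a Lie algebroid $T^*_SM$ over $S$ with anchor $\pi^\sharp|_S$ and bracket $[\alpha|_S,\beta|_S]_S=[\alpha,\beta]_\pi|_S$; the restriction map $r:T^*_SM\to T^*S$ has kernel $E^*$. The induced bracket $[\cdot,\cdot]_1$ on $\Gamma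 E^*$ is $C^\infty_S$-bilinear, giving a $C^\infty_S$-Lie algebra $\mathcal G=(\Gamma E^*,[\cdot,\cdot]_1)$. Fix an exponential map (tubular neighborhood map) $\mathbf e:E\to M$ of $S$; it induces a splitting $T_SM=TS\oplus E$ and hence a vector bundle map $h:T^*S\to T^*_SM$ with $r\circ h=\mathrm{Id}$. Put $\mathcal D_\alpha\xi=[h(\alpha),\xi]_S$ and $\mathcal K(\alpha,\beta)=[h(\alpha),h(\beta)]_S-h[\alpha,\beta]_\psi\in\Gamma E^*$ for $\alpha,\beta\in\Gamma T^*S$, $\xi\in\Gamma E^*$. The commutative algebra of fiberwise affine functions on $E$ is $C^\infty_{\mathrm{aff}}(E)=C^\infty_S\oplus\Gamma E^*$ with product $(f\oplus\eta)(g\oplus\xi)=fg\oplus(f\xi+g\eta)$. The infinitesimal Poisson algebra of $S$ is $\mathcal P=(C^\infty_{\mathrm{aff}}(E),\{\cdot,\cdot\}^{\mathrm{aff}})$ with $$\{f\oplus\eta,g\oplus\xi\}^{\mathrm{aff}}=\psi(df,dg)\oplus\big(\mathcal D_{df}\xi-\mathcal D_{dg}\eta+[\eta,\xi]_1+\mathcal K(df,dg)\big).$$ It is a Poisson algebra; different choices of $\mathbf e$ give isomorphic Poisson algebras. Cohomologies. $\mathrm H^1(\mathcal P)=\mathrm{Poiss}(\mathcal P)/\mathrm{Ham}(\mathcal P)$: $\mathbb R$-linear derivations of the commutative algebra that are also derivations of the bracket, modulo the derivations $\{p,\cdot\}^{\mathrm{aff}}$. $\mathrm H^1(S,\psi)$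 is the space of vector fields $v$ on $S$ with $L_v\psi=0$ modulo the Hamiltonian vector fields $\psi^\sharp dh$, $h\in C^\infty_S$. $\mathrm H^1(\mathcal G,\mathcal G)$ is taken for $\mathcal G$ as a $C^\infty_S$-Lie algebra: $C^\infty_S$-linear derivations of $[\cdot,\cdot]_1$ modulo inner derivations $[\xi,\cdot]_1$. For $Q\in\Gamma(\wedge^kTS\otimes E^* )$ put $$(d_{\mathcal D}Q)(df_0,\dots,df_k)=\sum_i(-1)^i\mathcal D_{df_i}\big(Q(df_0,\dots,\widehat{df_i},\dots,df_k)\big)+\sum_{i<j}(-1)^{i+j}Q\big(d\psi(df_i,df_j),df_0,\dots,\widehat{df_i},\dots,\widehat{df_j},\dots,df_k\big).$$ Let $Z_{\mathcal G}$ be the center of $\mathcal G$ and $\mathfrak Z^k=\Gamma(\wedge^kTS\otimes Z_{\mathcal G})$ the $k$-vector fields on $S$ with values in $Z_{\mathcal G}$. $d_{\mathcal D}$ restricts to $\partial_{\mathcal D}$ on $\mathfrak Z^\bullet$ with $\partial_{\mathcal D}^2=0$; $\mathrm H^1_{\partial_{\mathcal D}}$ is the first cohomology of $(\mathfrak Z^\bullet,\partial_{\mathcal D})$. *)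

theory Defs
  imports "HOL-Analysis.Analysis" "HOL-Library.Function_Algebras"
begin

text \<open>
  Addition, subtraction, zero and multiplication of functions are pointwise
  (Function_Algebras); sums of pairs are componentwise.
\<close>

section \<open>Smooth manifolds\<close>

fun Ck_on :: "nat \<Rightarrow> 'a::real_normed_vector set \<Rightarrow> ('a \<Rightarrow> 'b::real_normed_vector) \<Rightarrow> bool" where
  "Ck_on 0 U f \<longleftrightarrow> continuous_on U f"
| "Ck_on (Suc k) U f \<longleftrightarrow>
     (\<forall>x\<in>U. f differentiable (at x)) \<and> (\<forall>v. Ck_on k U (\<lambda>x. frechet_derivative f (at x) v))"

text \<open>Smoothness on an arbitrary subset of a Euclidean space: locally the restriction of a
  smooth function defined on an open set. On a relatively open subset of a linear subspace
  this is ordinary smoothness.\<close>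

definition smooth_on :: "'a::real_normed_vector set \<Rightarrow> ('a \<Rightarrow> 'b::real_normed_vector) \<Rightarrow> bool" where
  "smooth_on X f \<longleftrightarrow>
     (\<forall>x\<in>X. \<exists>W F. open W \<and> x \<in> W \<and> (\<forall>k. Ck_on k W F) \<and> (\<forall>y\<in>W \<inter> X. F y = f y))"

text \<open>Charts take values in a linear subspace \<open>model M\<close> of a Euclidean space (instead of the
  whole space), so that every dimension, including 0, occurs and so that a submanifold can be
  modelled on a smaller subspace of the same space.\<close>

type_synonym ('m, 'e) chart = "'m set \<times> ('m \<Rightarrow> 'e)"

record ('m, 'e) mfd =
  pts :: "'m set"
  model :: "'e set"
  atlas :: "('m, 'e) chart set"

definition is_chart ::
  "('m::topological_space, 'e::euclidean_space) mfd \<Rightarrow> ('m, 'e) chart \<Rightarrow> bool" where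
  "is_chart M = (\<lambda>(U, \<phi>).
     openin (top_of_set (pts M)) U \<and> openin (top_of_set (model M)) (\<phi> ` U) \<and>
     homeomorphism U (\<phi> ` U) \<phi> (inv_into U \<phi>))"

definition smooth_transition ::
  "('m, 'e::euclidean_space) chart \<Rightarrow> ('m, 'e) chart \<Rightarrow> bool" where
  "smooth_transition = (\<lambda>(U, \<phi>) (W, \<kappa>). smooth_on (\<phi> ` (U \<inter> W)) (\<kappa> \<circ> inv_into U \<phi>))"

text \<open>The maximal atlas.\<close>

definition smooth_charts ::
  "('m::topological_space, 'e::euclidean_space) mfd \<Rightarrow> ('m, 'e) chart set" where
  "smooth_charts M =
     {c. is_chart M c \<and> (\<forall>c'\<in>atlas M. smooth_transition c c' \<and> smooth_transition c' c)}"

definition smooth_manifold ::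
  "('m::{t2_space,second_countable_topology}, 'e::euclidean_space) mfd \<Rightarrow> bool" where
  "smooth_manifold M \<longleftrightarrow>
     subspace (model M) \<and> \<Union>(fst ` atlas M) = pts M \<and> atlas M \<subseteq> smooth_charts M"

text \<open>Smooth functions, (co)vectors and fields are extended by 0 outside their domain, so that
  equality of the HOL functions is equality of the geometric objects.\<close>

definition Cinf :: "('m, 'e::euclidean_space) mfd \<Rightarrow> ('m \<Rightarrow> real) set" where
  "Cinf M = {f. (\<forall>p. p \<notin> pts M \<longrightarrow> f p = 0) \<and>
                (\<forall>(U, \<phi>)\<in>atlas M. smooth_on (\<phi> ` U) (f \<circ> inv_into U \<phi>))}"

section \<open>Tangent and cotangent vectors, fields\<close>

type_synonym 'm tvec = "('m \<Rightarrow> real) \<Rightarrow> real"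
type_synonym 'm covec = "'m tvec \<Rightarrow> real"
type_synonym 'm vfield = "'m \<Rightarrow> 'm tvec"
type_synonym 'm cofield = "'m \<Rightarrow> 'm covec"
type_synonym 'm bivec = "'m \<Rightarrow> 'm covec \<Rightarrow> 'm covec \<Rightarrow> real"

definition tangent :: "('m, 'e::euclidean_space) mfd \<Rightarrow> 'm \<Rightarrow> 'm tvec set" where
  "tangent M p = {v.
     (\<forall>f. f \<notin> Cinf M \<longrightarrow> v f = 0) \<and>
     (\<forall>f\<in>Cinf M. \<forall>g\<in>Cinf M. v (f + g) = v f + v g) \<and>
     (\<forall>c. \<forall>f\<in>Cinf M. v (\<lambda>x. c * f x) = c * v f) \<and>
     (\<forall>f\<in>Cinf M. \<forall>g\<in>Cinf M. v (f * g) = f p * v g + g p * v f)}"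

definition cotangent :: "('m, 'e::euclidean_space) mfd \<Rightarrow> 'm \<Rightarrow> 'm covec set" where
  "cotangent M p = {a.
     (\<forall>v. v \<notin> tangent M p \<longrightarrow> a v = 0) \<and>
     (\<forall>v\<in>tangent M p. \<forall>w\<in>tangent M p. a (v + w) = a v + a w) \<and>
     (\<forall>c. \<forall>v\<in>tangent M p. a (\<lambda>f. c * v f) = c * a v)}"

definition act :: "'m vfield \<Rightarrow> ('m \<Rightarrow> real) \<Rightarrow> ('m \<Rightarrow> real)" where
  "act X f = (\<lambda>p. X p f)"

definition ev :: "'m cofield \<Rightarrow> 'm vfield \<Rightarrow> ('m \<Rightarrow> real)" where
  "ev \<alpha> X = (\<lambda>p. \<alpha> p (X p))"

definition ev2 :: "'m bivec \<Rightarrow> 'm cofield \<Rightarrow> 'm cofield \<Rightarrow> ('m \<Rightarrow> real)" where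
  "ev2 \<pi> \<alpha> \<beta> = (\<lambda>p. \<pi> p (\<alpha> p) (\<beta> p))"

definition fscale :: "('m \<Rightarrow> real) \<Rightarrow> 'm cofield \<Rightarrow> 'm cofield" where
  "fscale f \<alpha> = (\<lambda>p v. f p * \<alpha> p v)"

definition vector_fields :: "('m, 'e::euclidean_space) mfd \<Rightarrow> 'm vfield set" where
  "vector_fields M = {X.
     (\<forall>p\<in>pts M. X p \<in> tangent M p) \<and> (\<forall>p. p \<notin> pts M \<longrightarrow> X p = 0) \<and>
     (\<forall>f\<in>Cinf M. act X f \<in> Cinf M)}"

text \<open>\<open>cosections M N\<close> is the space of smooth sections over \<open>N\<close> of the bundle \<open>T\<^sup>*M\<close> restricted
  to a submanifold \<open>N\<close> of \<open>M\<close>; smoothness is tested against the vector fields of \<open>M\<close>, which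
  locally contain frames.\<close>

definition cosections ::
  "('m, 'e::euclidean_space) mfd \<Rightarrow> ('m, 'e) mfd \<Rightarrow> 'm cofield set" where
  "cosections M N = {\<alpha>.
     (\<forall>p\<in>pts N. \<alpha> p \<in> cotangent M p) \<and> (\<forall>p. p \<notin> pts N \<longrightarrow> \<alpha> p = 0) \<and>
     (\<forall>X\<in>vector_fields M. ev \<alpha> X \<in> Cinf N)}"

definition one_forms :: "('m, 'e::euclidean_space) mfd \<Rightarrow> 'm cofield set" where
  "one_forms M = cosections M M"

definition dff :: "('m, 'e::euclidean_space) mfd \<Rightarrow> ('m \<Rightarrow> real) \<Rightarrow> 'm cofield" where
  "dff M f = (\<lambda>p v. if p \<in> pts M \<and> v \<in> tangent M p then v f else 0)"

definition lie_bracket :: "'m vfield \<Rightarrow> 'm vfield \<Rightarrow> 'm vfield" where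
  "lie_bracket X Y = (\<lambda>p f. X p (act Y f) - Y p (act X f))"

definition lie_form ::
  "('m, 'e::euclidean_space) mfd \<Rightarrow> 'm vfield \<Rightarrow> 'm cofield \<Rightarrow> 'm cofield" where
  "lie_form M X \<beta> = (THE \<gamma>. \<gamma> \<in> one_forms M \<and>
     (\<forall>Y\<in>vector_fields M. ev \<gamma> Y = act X (ev \<beta> Y) - ev \<beta> (lie_bracket X Y)))"

section \<open>Poisson manifolds\<close>

definition bivector_fields :: "('m, 'e::euclidean_space) mfd \<Rightarrow> 'm bivec set" where
  "bivector_fields M = {\<pi>.
     (\<forall>p a b. p \<notin> pts M \<longrightarrow> \<pi> p a b = 0) \<and>
     (\<forall>p\<in>pts M. \<forall>a\<in>cotangent M p. \<forall>b\<in>cotangent M p.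
        \<pi> p a a = 0 \<and> \<pi> p a b = - \<pi> p b a \<and>
        (\<forall>c. \<pi> p (\<lambda>v. c * a v) b = c * \<pi> p a b) \<and>
        (\<forall>a'\<in>cotangent M p. \<pi> p (a + a') b = \<pi> p a b + \<pi> p a' b)) \<and>
     (\<forall>\<alpha>\<in>one_forms M. \<forall>\<beta>\<in>one_forms M. ev2 \<pi> \<alpha> \<beta> \<in> Cinf M)}"

definition pbracket ::
  "('m, 'e::euclidean_space) mfd \<Rightarrow> 'm bivec \<Rightarrow> ('m \<Rightarrow> real) \<Rightarrow> ('m \<Rightarrow> real) \<Rightarrow> ('m \<Rightarrow> real)" where
  "pbracket M \<pi> f g = ev2 \<pi> (dff M f) (dff M g)"

definition poisson_manifold ::
  "('m::{t2_space,second_countable_topology}, 'e::euclidean_space) mfd \<Rightarrow> 'm bivec \<Rightarrow> bool" where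
  "poisson_manifold M \<pi> \<longleftrightarrow> smooth_manifold M \<and> \<pi> \<in> bivector_fields M \<and>
     (\<forall>f\<in>Cinf M. \<forall>g\<in>Cinf M. \<forall>h\<in>Cinf M.
        pbracket M \<pi> f (pbracket M \<pi> g h) + pbracket M \<pi> g (pbracket M \<pi> h f)
          + pbracket M \<pi> h (pbracket M \<pi> f g) = 0)"

text \<open>The vector field \<open>\<pi>(\<alpha>, -)\<close>, viewed as a derivation.\<close>

definition sharp ::
  "('m, 'e::euclidean_space) mfd \<Rightarrow> 'm bivec \<Rightarrow> 'm cofield \<Rightarrow> 'm vfield" where
  "sharp M \<pi> \<alpha> = (\<lambda>p f. if f \<in> Cinf M then \<pi> p (\<alpha> p) (dff M f p) else 0)"

definition koszul ::
  "('m, 'e::euclidean_space) mfd \<Rightarrow> 'm bivec \<Rightarrow> 'm cofield \<Rightarrow> 'm cofield \<Rightarrow> 'm cofield" where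
  "koszul M \<pi> \<alpha> \<beta> =
     lie_form M (sharp M \<pi> \<alpha>) \<beta> - lie_form M (sharp M \<pi> \<beta>) \<alpha> - dff M (ev2 \<pi> \<alpha> \<beta>)"

definition lie_bivector ::
  "('m, 'e::euclidean_space) mfd \<Rightarrow> 'm vfield \<Rightarrow> 'm bivec \<Rightarrow> 'm cofield \<Rightarrow> 'm cofield \<Rightarrow> ('m \<Rightarrow> real)"
  where
  "lie_bivector M X \<pi> \<alpha> \<beta> =
     act X (ev2 \<pi> \<alpha> \<beta>) - ev2 \<pi> (lie_form M X \<alpha>) \<beta> - ev2 \<pi> \<alpha> (lie_form M X \<beta>)"

section \<open>Embedded Poisson submanifolds\<close>

definition slice_charts ::
  "('m::topological_space, 'e::euclidean_space) mfd \<Rightarrow> ('m, 'e) mfd \<Rightarrow> ('m, 'e) chart set" where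
  "slice_charts N M =
     {(U, \<phi>). (U, \<phi>) \<in> smooth_charts M \<and> \<phi> ` (U \<inter> pts N) = \<phi> ` U \<inter> model N}"

definition embedded_submanifold ::
  "('m::{t2_space,second_countable_topology}, 'e::euclidean_space) mfd \<Rightarrow> ('m, 'e) mfd \<Rightarrow> bool" where
  "embedded_submanifold N M \<longleftrightarrow>
     smooth_manifold N \<and> smooth_manifold M \<and> pts N \<subseteq> pts M \<and> model N \<subseteq> model M \<and>
     (\<forall>p\<in>pts N. \<exists>(U, \<phi>)\<in>slice_charts N M. p \<in> U \<and> (U \<inter> pts N, \<phi>) \<in> smooth_charts N)"

definition restr :: "('m, 'e) mfd \<Rightarrow> ('m \<Rightarrow> real) \<Rightarrow> ('m \<Rightarrow> real)" where
  "restr N f = (\<lambda>p. if p \<in> pts N then f p else 0)"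

text \<open>The last clause says that the inclusion is a Poisson map.\<close>

definition poisson_submanifold ::
  "('m::{t2_space,second_countable_topology}, 'e::euclidean_space) mfd \<Rightarrow> 'm bivec \<Rightarrow>
   ('m, 'e) mfd \<Rightarrow> 'm bivec \<Rightarrow> bool" where
  "poisson_submanifold N \<psi> M \<pi> \<longleftrightarrow>
     poisson_manifold M \<pi> \<and> poisson_manifold N \<psi> \<and> embedded_submanifold N M \<and>
     (\<forall>f\<in>Cinf M. \<forall>g\<in>Cinf M.
        pbracket N \<psi> (restr N f) (restr N g) = restr N (pbracket M \<pi> f g))"

text \<open>The differential \<open>T\<^sub>pN \<rightarrow> T\<^sub>pM\<close> of the inclusion.\<close>

definition push ::
  "('m, 'e::euclidean_space) mfd \<Rightarrow> ('m, 'e) mfd \<Rightarrow> 'm tvec \<Rightarrow> 'm tvec" where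
  "push M N w = (\<lambda>f. if f \<in> Cinf M then w (restr N f) else 0)"

definition restr_form ::
  "('m, 'e::euclidean_space) mfd \<Rightarrow> ('m, 'e) mfd \<Rightarrow> 'm cofield \<Rightarrow> 'm cofield" where
  "restr_form M N a = (\<lambda>p w. if w \<in> tangent N p then a p (push M N w) else 0)"

definition conormal_sections ::
  "('m, 'e::euclidean_space) mfd \<Rightarrow> ('m, 'e) mfd \<Rightarrow> 'm cofield set" where
  "conormal_sections M N =
     {\<xi>\<in>cosections M N. \<forall>p\<in>pts N. \<forall>w\<in>tangent N p. \<xi> p (push M N w) = 0}"

text \<open>The bracket of the restricted cotangent Lie algebroid. As \<open>N\<close> need not be closed, a section
  over \<open>N\<close> is only locally (near each point of \<open>N\<close>) the restriction of a 1-form of \<open>M\<close>.\<close>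

definition extends_near ::
  "('m::topological_space, 'e) mfd \<Rightarrow> 'm \<Rightarrow> 'm cofield \<Rightarrow> 'm cofield \<Rightarrow> bool" where
  "extends_near N p \<alpha> a \<longleftrightarrow>
     (\<exists>W. openin (top_of_set (pts N)) W \<and> p \<in> W \<and> (\<forall>q\<in>W. \<alpha> q = a q))"

definition bracketS ::
  "('m::topological_space, 'e::euclidean_space) mfd \<Rightarrow> 'm bivec \<Rightarrow> ('m, 'e) mfd \<Rightarrow>
   'm cofield \<Rightarrow> 'm cofield \<Rightarrow> 'm cofield" where
  "bracketS M \<pi> N a b = (THE c. c \<in> cosections M N \<and>
     (\<forall>p\<in>pts N. \<forall>\<alpha>\<in>one_forms M. \<forall>\<beta>\<in>one_forms M.
        extends_near N p \<alpha> a \<and> extends_near N p \<beta> b \<longrightarrow> c p = koszul M \<pi> \<alpha> \<beta> p))"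

section \<open>The normal bundle and tubular neighbourhood maps\<close>

text \<open>Elements of the normal space \<open>E\<^sub>p = T\<^sub>pM / T\<^sub>pN\<close> are cosets.\<close>

definition normal_space ::
  "('m, 'e::euclidean_space) mfd \<Rightarrow> ('m, 'e) mfd \<Rightarrow> 'm \<Rightarrow> 'm tvec set set" where
  "normal_space M N p = {{v + push M N w | w. w \<in> tangent N p} | v. v \<in> tangent M p}"

definition nscale ::
  "('m, 'e::euclidean_space) mfd \<Rightarrow> ('m, 'e) mfd \<Rightarrow> 'm \<Rightarrow> real \<Rightarrow> 'm tvec set \<Rightarrow> 'm tvec set" where
  "nscale M N p t c = {(\<lambda>f. t * v f) + push M N w | v w. v \<in> c \<and> w \<in> tangent N p}"

definition normal_bundle ::
  "('m, 'e::euclidean_space) mfd \<Rightarrow> ('m, 'e) mfd \<Rightarrow> ('m \<times> 'm tvec set) set" where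
  "normal_bundle M N = {(p, c). p \<in> pts N \<and> c \<in> normal_space M N p}"

text \<open>The tangent vector at \<open>p\<close> with coordinates \<open>w\<close> in the chart \<open>(U, \<phi>)\<close>.\<close>

definition coord_vec ::
  "('m, 'e::euclidean_space) mfd \<Rightarrow> ('m, 'e) chart \<Rightarrow> 'm \<Rightarrow> 'e \<Rightarrow> 'm tvec" where
  "coord_vec M = (\<lambda>(U, \<phi>) p w f.
     if f \<in> Cinf M then deriv (\<lambda>t. f (inv_into U \<phi> (\<phi> p + t *\<^sub>R w))) 0 else 0)"

text \<open>A slice chart \<open>(U, \<phi>)\<close> of \<open>M\<close> gives the vector bundle chart of the normal bundle over
  \<open>U \<inter> N\<close> that sends \<open>(p, c)\<close> to \<open>\<phi> p + w\<close>, where \<open>w\<close> is the coordinate vector of the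
  representative of \<open>c\<close> whose coordinates are orthogonal to \<open>model N\<close>. These charts form the
  atlas of the manifold \<open>E\<close>.\<close>

definition normal_chart ::
  "('m, 'e::euclidean_space) mfd \<Rightarrow> ('m, 'e) mfd \<Rightarrow> ('m, 'e) chart \<Rightarrow> 'm \<times> 'm tvec set \<Rightarrow> 'e" where
  "normal_chart M N c = (\<lambda>(p, n). snd c p +
     (THE w. w \<in> model M \<and> (\<forall>u\<in>model N. orthogonal w u) \<and> coord_vec M c p w \<in> n))"

text \<open>The velocity at \<open>t = 0\<close> of the curve \<open>t \<mapsto> e (p, t c)\<close>.\<close>

definition tub_velocity ::
  "('m, 'e::euclidean_space) mfd \<Rightarrow> ('m, 'e) mfd \<Rightarrow> ('m \<times> 'm tvec set \<Rightarrow> 'm) \<Rightarrow>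
   'm \<Rightarrow> 'm tvec set \<Rightarrow> 'm tvec" where
  "tub_velocity M N e p c =
     (\<lambda>f. if f \<in> Cinf M then deriv (\<lambda>t. f (e (p, nscale M N p t c))) 0 else 0)"

text \<open>A tubular neighbourhood map: a diffeomorphism from the total space of the normal bundle onto
  an open subset of \<open>M\<close>, equal to the identity on the zero section, whose differential there
  induces the identity of the normal bundle. Being a diffeomorphism onto an open subset is
  expressed by injectivity together with the requirement that \<open>e\<close> transports the charts of the
  normal bundle to smooth charts of \<open>M\<close>.\<close>

definition tubular_map ::
  "('m::topological_space, 'e::euclidean_space) mfd \<Rightarrow> ('m, 'e) mfd \<Rightarrow>
   ('m \<times> 'm tvec set \<Rightarrow> 'm) \<Rightarrow> bool" where
  "tubular_map M N e \<longleftrightarrow>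
     inj_on e (normal_bundle M N) \<and>
     (\<forall>(U, \<phi>)\<in>slice_charts N M.
        (e ` {x\<in>normal_bundle M N. fst x \<in> U},
         normal_chart M N (U, \<phi>) \<circ> inv_into (normal_bundle M N) e) \<in> smooth_charts M) \<and>
     (\<forall>p\<in>pts N. e (p, push M N ` tangent N p) = p) \<and>
     (\<forall>(p, c)\<in>normal_bundle M N. tub_velocity M N e p c \<in> c)"

text \<open>The map \<open>h\<close>: the covector extending \<open>\<alpha>\<close> that vanishes on the complement of \<open>TN\<close> tangent to
  the \<open>e\<close>-images of the fibres of the normal bundle.\<close>

definition hlift ::
  "('m, 'e::euclidean_space) mfd \<Rightarrow> ('m, 'e) mfd \<Rightarrow> ('m \<times> 'm tvec set \<Rightarrow> 'm) \<Rightarrow>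
   'm cofield \<Rightarrow> 'm cofield" where
  "hlift M N e \<alpha> = (THE a. a \<in> cosections M N \<and> restr_form M N a = \<alpha> \<and>
     (\<forall>(p, c)\<in>normal_bundle M N. a p (tub_velocity M N e p c) = 0))"

section \<open>The infinitesimal Poisson algebra\<close>

text \<open>From here on, \<open>(N, \<psi>)\<close> is the Poisson submanifold of \<open>(M, \<pi>)\<close>, and \<open>[-,-]\<^sub>1\<close> is
  \<open>bracketS\<close> on conormal sections.\<close>

definition Dconn where
  "Dconn M \<pi> N e \<alpha> \<xi> = bracketS M \<pi> N (hlift M N e \<alpha>) \<xi>"

definition Kcurv where
  "Kcurv M \<pi> N \<psi> e \<alpha> \<beta> =
     bracketS M \<pi> N (hlift M N e \<alpha>) (hlift M N e \<beta>) - hlift M N e (koszul N \<psi> \<alpha> \<beta>)"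

type_synonym 'm aff = "('m \<Rightarrow> real) \<times> 'm cofield"

definition Caff :: "('m, 'e::euclidean_space) mfd \<Rightarrow> ('m, 'e) mfd \<Rightarrow> 'm aff set" where
  "Caff M N = Cinf N \<times> conormal_sections M N"

definition aff_mult :: "'m aff \<Rightarrow> 'm aff \<Rightarrow> 'm aff" where
  "aff_mult = (\<lambda>(f, \<eta>) (g, \<xi>). (f * g, fscale f \<xi> + fscale g \<eta>))"

definition aff_scale :: "real \<Rightarrow> 'm aff \<Rightarrow> 'm aff" where
  "aff_scale c = (\<lambda>(f, \<eta>). (\<lambda>p. c * f p, fscale (\<lambda>_. c) \<eta>))"

definition aff_bracket ::
  "('m::topological_space, 'e::euclidean_space) mfd \<Rightarrow> 'm bivec \<Rightarrow> ('m, 'e) mfd \<Rightarrow> 'm bivec \<Rightarrow>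
   ('m \<times> 'm tvec set \<Rightarrow> 'm) \<Rightarrow> 'm aff \<Rightarrow> 'm aff \<Rightarrow> 'm aff" where
  "aff_bracket M \<pi> N \<psi> e = (\<lambda>(f, \<eta>) (g, \<xi>).
     (ev2 \<psi> (dff N f) (dff N g),
      Dconn M \<pi> N e (dff N f) \<xi> - Dconn M \<pi> N e (dff N g) \<eta> + bracketS M \<pi> N \<eta> \<xi>
        + Kcurv M \<pi> N \<psi> e (dff N f) (dff N g)))"

section \<open>Cohomologies in degree one\<close>

text \<open>The set of cosets \<open>x + B\<close>, \<open>x \<in> A\<close>. Its zero element is the coset \<open>B\<close>, so the quotient is
  the zero space iff it equals \<open>{B}\<close>.\<close>

definition quot_space :: "'a::plus set \<Rightarrow> 'a set \<Rightarrow> 'a set set" where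
  "quot_space A B = (\<lambda>x. (\<lambda>b. x + b) ` B) ` A"

definition Poiss_P where
  "Poiss_P M \<pi> N \<psi> e = {X.
     (\<forall>a. a \<notin> Caff M N \<longrightarrow> X a = 0) \<and>
     (\<forall>a\<in>Caff M N. X a \<in> Caff M N) \<and>
     (\<forall>a\<in>Caff M N. \<forall>b\<in>Caff M N. X (a + b) = X a + X b) \<and>
     (\<forall>c. \<forall>a\<in>Caff M N. X (aff_scale c a) = aff_scale c (X a)) \<and>
     (\<forall>a\<in>Caff M N. \<forall>b\<in>Caff M N.
        X (aff_mult a b) = aff_mult (X a) b + aff_mult a (X b)) \<and>
     (\<forall>a\<in>Caff M N. \<forall>b\<in>Caff M N.
        X (aff_bracket M \<pi> N \<psi> e a b) =
          aff_bracket M \<pi> N \<psi> e (X a) b + aff_bracket M \<pi> N \<psi> e a (X b))}"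

definition Ham_P where
  "Ham_P M \<pi> N \<psi> e =
     (\<lambda>a. (\<lambda>b. if b \<in> Caff M N then aff_bracket M \<pi> N \<psi> e a b else 0)) ` Caff M N"

definition H1_P where
  "H1_P M \<pi> N \<psi> e = quot_space (Poiss_P M \<pi> N \<psi> e) (Ham_P M \<pi> N \<psi> e)"

definition Poiss_S where
  "Poiss_S N \<psi> = {v\<in>vector_fields N.
     \<forall>\<alpha>\<in>one_forms N. \<forall>\<beta>\<in>one_forms N. lie_bivector N v \<psi> \<alpha> \<beta> = 0}"

definition Ham_S where
  "Ham_S N \<psi> = (\<lambda>f. sharp N \<psi> (dff N f)) ` Cinf N"

definition H1_S where
  "H1_S N \<psi> = quot_space (Poiss_S N \<psi>) (Ham_S N \<psi>)"

definition Der_G where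
  "Der_G M \<pi> N = {\<Delta>.
     (\<forall>\<xi>. \<xi> \<notin> conormal_sections M N \<longrightarrow> \<Delta> \<xi> = 0) \<and>
     (\<forall>\<xi>\<in>conormal_sections M N. \<Delta> \<xi> \<in> conormal_sections M N) \<and>
     (\<forall>\<xi>\<in>conormal_sections M N. \<forall>\<eta>\<in>conormal_sections M N. \<Delta> (\<xi> + \<eta>) = \<Delta> \<xi> + \<Delta> \<eta>) \<and>
     (\<forall>f\<in>Cinf N. \<forall>\<xi>\<in>conormal_sections M N. \<Delta> (fscale f \<xi>) = fscale f (\<Delta> \<xi>)) \<and>
     (\<forall>\<xi>\<in>conormal_sections M N. \<forall>\<eta>\<in>conormal_sections M N.
        \<Delta> (bracketS M \<pi> N \<xi> \<eta>) = bracketS M \<pi> N (\<Delta> \<xi>) \<eta> + bracketS M \<pi> N \<xi> (\<Delta> \<eta>))}"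

definition Inn_G where
  "Inn_G M \<pi> N =
     (\<lambda>\<xi>. (\<lambda>\<eta>. if \<eta> \<in> conormal_sections M N then bracketS M \<pi> N \<xi> \<eta> else 0))
       ` conormal_sections M N"

definition H1_G where
  "H1_G M \<pi> N = quot_space (Der_G M \<pi> N) (Inn_G M \<pi> N)"

definition center_G where
  "center_G M \<pi> N =
     {\<xi>\<in>conormal_sections M N. \<forall>\<eta>\<in>conormal_sections M N. bracketS M \<pi> N \<xi> \<eta> = 0}"

text \<open>\<open>k\<close>-vector fields on \<open>N\<close> with values in a module \<open>Z\<close> of sections, as alternating
  function-multilinear maps from lists of \<open>k\<close> 1-forms of \<open>N\<close> to \<open>Z\<close>.\<close>

definition k_vectors ::
  "('m, 'e::euclidean_space) mfd \<Rightarrow> 'm cofield set \<Rightarrow> nat \<Rightarrow> ('m cofield list \<Rightarrow> 'm cofield) set" where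
  "k_vectors N Z k = {Q.
     (\<forall>as. \<not> (length as = k \<and> set as \<subseteq> one_forms N) \<longrightarrow> Q as = 0) \<and>
     (\<forall>as. length as = k \<and> set as \<subseteq> one_forms N \<longrightarrow>
        Q as \<in> Z \<and>
        (\<forall>i<k. \<forall>f\<in>Cinf N. \<forall>\<alpha>\<in>one_forms N. \<forall>\<beta>\<in>one_forms N.
           Q (as[i := fscale f \<alpha> + \<beta>]) = fscale f (Q (as[i := \<alpha>])) + Q (as[i := \<beta>])) \<and>
        (\<forall>i<k. \<forall>j<k. i \<noteq> j \<and> as ! i = as ! j \<longrightarrow> Q as = 0))}"

definition omit :: "nat \<Rightarrow> 'a list \<Rightarrow> 'a list" where
  "omit i xs = take i xs @ drop (Suc i) xs"

text \<open>The value of \<open>d\<^sub>D Q\<close> on the differentials of \<open>fs = [f\<^sub>0, \<dots>, f\<^sub>k]\<close>.\<close>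

definition dD where
  "dD M \<pi> N \<psi> e k Q fs =
     (\<Sum>i\<le>k. fscale (\<lambda>_. (-1) ^ i)
        (Dconn M \<pi> N e (dff N (fs ! i)) (Q (map (dff N) (omit i fs))))) +
     (\<Sum>j\<le>k. \<Sum>i<j. fscale (\<lambda>_. (-1) ^ (i + j))
        (Q (map (dff N) (pbracket N \<psi> (fs ! i) (fs ! j) # omit i (omit j fs)))))"

definition Zcochains where
  "Zcochains M \<pi> N k = k_vectors N (center_G M \<pi> N) k"

text \<open>A \<open>k\<close>-vector field is determined by its values on exact 1-forms.\<close>

definition partialD where
  "partialD M \<pi> N \<psi> e k Q = (THE R. R \<in> Zcochains M \<pi> N (Suc k) \<and>
     (\<forall>fs. length fs = Suc k \<and> set fs \<subseteq> Cinf N \<longrightarrow>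
        R (map (dff N) fs) = dD M \<pi> N \<psi> e k Q fs))"

definition Z1_D where
  "Z1_D M \<pi> N \<psi> e = {Q\<in>Zcochains M \<pi> N 1. partialD M \<pi> N \<psi> e 1 Q = 0}"

definition B1_D where
  "B1_D M \<pi> N \<psi> e = partialD M \<pi> N \<psi> e 0 ` Zcochains M \<pi> N 0"

definition H1_D where
  "H1_D M \<pi> N \<psi> e = quot_space (Z1_D M \<pi> N \<psi> e) (B1_D M \<pi> N \<psi> e)"

end

theory Submission
  imports Defs
begin

text \<open>
  Write a Poisson derivation of \<open>\<P>\<close> as \<open>(f, \<eta>) \<mapsto> (v f + u \<eta>, Q f + T \<eta>)\<close>. Since the product of two conormal
  sections vanishes, \<open>u = 0\<close>. Then \<open>v\<close> is a Poisson vector field on the submanifold, so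
  \<open>v = {h, -}\<close> by (a); now \<open>T - \<D>\<^bsub>dh\<^esub>\<close> is a function-linear derivation of the conormal
  Lie algebra, so it equals \<open>[\<xi>\<^sub>0, -]\<^sub>1\<close> by (b); finally \<open>Q f - \<K>(dh, df) + \<D>\<^bsub>df\<^esub> \<xi>\<^sub>0\<close> is a
  central cocycle, so it equals \<open>\<D>\<^bsub>df\<^esub> z\<close> by (c), and the derivation is the Hamiltonian one of
  \<open>(h, \<xi>\<^sub>0 - z)\<close>. The identities used all follow from the Jacobi identity of the Koszul bracket,
  which is a tensorial statement and hence reduces to exact forms, where it is the Jacobi identity
  of the Poisson bracket.
\<close>

section \<open>Smooth functions on Euclidean spaces\<close>

text \<open>Three obstacles shape the work. (i) Vectors are derivations of globally defined
  functions, so every local argument has to be globalised by a bump function; and since N need not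
  be closed, functions and sections on N extend to M only near a point, and identities over N are
  checked point by point on such extensions. (ii) \<open>lie_form\<close>, \<open>bracketS\<close>,
  \<open>hlift\<close> and \<open>partialD\<close> are definite descriptions, so nothing can be
  computed before existence and uniqueness are proved. For \<open>hlift\<close> the hard part is
  smoothness: it comes from extending functions of N so that they are constant along the fibres of
  the tubular map. (iii) The vanishing of u is not purely algebraic: 2 u(\<eta>) \<eta> = 0 says
  nothing where \<eta> is zero, and there one needs either a conormal section that does not vanish
  or codimension zero near the point. Moreover, (c) concerns tensors on all 1-forms, while the
  central cocycle is at first only a map on functions; it is spread to 1-forms by reading f |-> (q
  f)(x) as a tangent vector.\<close>

abbreviation Cinfty_on :: "'a::real_normed_vector set \<Rightarrow> ('a \<Rightarrow> 'b::real_normed_vector) \<Rightarrow> bool" where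
  "Cinfty_on W F \<equiv> \<forall>k. Ck_on k W F"

lemma Ck_on_subset: "Ck_on k U f \<Longrightarrow> V \<subseteq> U \<Longrightarrow> Ck_on k V f"
  by (induction k arbitrary: f) (auto intro: continuous_on_subset)

text \<open>On an open set equality holds near every point, so the Frechet derivatives coincide as
  well; this lets the induction on k pass to them.\<close>

lemma Ck_on_cong:
  assumes "open U" "\<And>x. x \<in> U \<Longrightarrow> f x = g x" "Ck_on k U f"
  shows "Ck_on k U g"
  using assms(2,3)
proof (induction k arbitrary: f g)
  case 0 then show ?case by (auto cong: continuous_on_cong)
next
  case (Suc k)
  have d: "frechet_derivative g (at x) = frechet_derivative f (at x)" if "x \<in> U" for x
    using frechet_derivative_transform_within_open[of f x U g] that assms(1) Suc.prems by auto
  have "g differentiable (at x)" if "x \<in> U" for x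
  proof -
    have "(f has_derivative frechet_derivative f (at x)) (at x)"
      using Suc.prems that frechet_derivative_works by auto
    then have "(g has_derivative frechet_derivative f (at x)) (at x)"
      using has_derivative_transform_within_open assms(1) that Suc.prems(1) by metis
    then show ?thesis by (auto simp: differentiable_def)
  qed
  moreover have "Ck_on k U (\<lambda>x. frechet_derivative g (at x) v)" for v
    by (rule Suc.IH[of "\<lambda>x. frechet_derivative f (at x) v"]) (use Suc.prems d in auto)
  ultimately show ?case by simp
qed

text \<open>Takes the derivative as an arbitrary family f', so that inductions on k can work with
  the usual differentiation rules instead of \<open>frechet_derivative\<close>.\<close>

lemma Ck_on_SucI:
  assumes "open U" "\<And>x. x \<in> U \<Longrightarrow> (f has_derivative f' x) (at x)" "\<And>v. Ck_on k U (\<lambda>x. f' x v)"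
  shows "Ck_on (Suc k) U f"
proof -
  have "frechet_derivative f (at x) = f' x" if "x \<in> U" for x
    using frechet_derivative_at assms(2)[OF that] by metis
  then have "Ck_on k U (\<lambda>x. frechet_derivative f (at x) v)" for v
    by (intro Ck_on_cong[OF assms(1) _ assms(3)[of v]]) auto
  then show ?thesis using assms(2) by (auto simp: differentiable_def)
qed

lemma Ck_on_SucD:
  assumes "Ck_on (Suc k) U f"
  shows "x \<in> U \<Longrightarrow> (f has_derivative frechet_derivative f (at x)) (at x)"
    and "Ck_on k U (\<lambda>x. frechet_derivative f (at x) v)"
  using assms frechet_derivative_works by auto

lemma Ck_on_lower: "Ck_on (Suc k) U f \<Longrightarrow> Ck_on k U f"
proof (induction k arbitrary: f)
  case 0
  then show ?case
    by (auto intro!: continuous_at_imp_continuous_on differentiable_imp_continuous_within)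
qed auto

lemma Ck_on_const: "Ck_on k U (\<lambda>x. c)"
  by (induction k arbitrary: c) auto

lemma Ck_on_bounded_linear:
  assumes "open U" "bounded_linear L" "Ck_on k U f"
  shows "Ck_on k U (\<lambda>x. L (f x))"
  using assms(3)
proof (induction k arbitrary: f)
  case 0 then show ?case by (auto intro: bounded_linear.continuous_on[OF assms(2)])
next
  case (Suc k)
  show ?case
  proof (rule Ck_on_SucI[OF assms(1)])
    show "((\<lambda>x. L (f x)) has_derivative (\<lambda>v. L (frechet_derivative f (at x) v))) (at x)"
      if "x \<in> U" for x
      using bounded_linear.has_derivative[OF assms(2) Ck_on_SucD(1)[OF Suc.prems that]] .
  qed (use Suc.IH Ck_on_SucD(2)[OF Suc.prems] in auto)
qed

lemma Ck_on_ident: 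
  assumes "open U" shows "Ck_on k U (\<lambda>x. x)"
proof (cases k)
  case (Suc n)
  show ?thesis unfolding Suc
    by (rule Ck_on_SucI[OF assms, of _ "\<lambda>x v. v"]) (auto simp: Ck_on_const)
qed auto

lemma Ck_on_add:
  assumes "open U" "Ck_on k U f" "Ck_on k U g"
  shows "Ck_on k U (\<lambda>x. f x + g x)"
  using assms(2,3)
proof (induction k arbitrary: f g)
  case 0 then show ?case by (auto intro: continuous_intros)
next
  case (Suc k)
  show ?case
    by (rule Ck_on_SucI[OF assms(1) has_derivative_add[OF
            Ck_on_SucD(1)[OF Suc.prems(1)] Ck_on_SucD(1)[OF Suc.prems(2)]]], assumption, assumption)
       (intro Suc.IH Ck_on_SucD(2)[OF Suc.prems(1)] Ck_on_SucD(2)[OF Suc.prems(2)])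
qed

lemma Ck_on_sum:
  assumes "open U" "\<And>i. i \<in> I \<Longrightarrow> Ck_on k U (f i)"
  shows "Ck_on k U (\<lambda>x. \<Sum>i\<in>I. f i x)"
  using assms(2) by (induction I rule: infinite_finite_induct) (auto simp: Ck_on_const Ck_on_add assms(1))

text \<open>The product rule gives two terms of the same shape in which one factor is left
  undifferentiated; \<open>Ck_on_lower\<close> brings that factor down to order k so that the
  induction hypothesis applies. Products, scalings and inner products are instances.\<close>

lemma Ck_on_bilinear:
  assumes "open U" "bounded_bilinear B" "Ck_on k U f" "Ck_on k U g"
  shows "Ck_on k U (\<lambda>x. B (f x) (g x))"
  using assms(3,4)
proof (induction k arbitrary: f g)
  case 0 then show ?case by (auto intro: bounded_bilinear.continuous_on[OF assms(2)])
next
  case (Suc k)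
  show ?case
    by (rule Ck_on_SucI[OF assms(1) bounded_bilinear.FDERIV[OF assms(2)
            Ck_on_SucD(1)[OF Suc.prems(1)] Ck_on_SucD(1)[OF Suc.prems(2)]]], assumption, assumption)
       (intro Ck_on_add[OF assms(1)] Suc.IH Ck_on_lower[OF Suc.prems(1)] Ck_on_lower[OF Suc.prems(2)]
          Ck_on_SucD(2)[OF Suc.prems(1)] Ck_on_SucD(2)[OF Suc.prems(2)])
qed

lemmas Ck_on_mult = Ck_on_bilinear[OF _ bounded_bilinear_mult]
lemmas Ck_on_scaleR = Ck_on_bilinear[OF _ bounded_bilinear_scaleR]
lemmas Ck_on_inner = Ck_on_bilinear[OF _ bounded_bilinear_inner]

lemma Ck_on_diff:
  assumes "open U" "Ck_on k U f" "Ck_on k U g"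
  shows "Ck_on k U (\<lambda>x. f x - g x)"
  using Ck_on_add[OF assms(1,2) Ck_on_bounded_linear[OF assms(1) bounded_linear_minus[OF bounded_linear_ident] assms(3)]]
  by simp

lemma linear_Basis_expansion:
  fixes v :: "'a::euclidean_space"
  assumes "linear f" shows "f v = (\<Sum>b\<in>Basis. (v \<bullet> b) *\<^sub>R f b)"
  by (subst euclidean_representation[symmetric, of v])
     (simp only: linear_sum[OF assms] linear_cmul[OF assms])

text \<open>\<open>Ck_on\<close> speaks of derivatives in fixed directions, while the chain rule
  yields g'(f x) in the moving direction f'(x) v. Expanding that direction in the basis gives
  products of functions covered by the induction hypothesis; hence the Euclidean middle
  space.\<close>

lemma Ck_on_compose:
  fixes f :: "'a::real_normed_vector \<Rightarrow> 'b::euclidean_space"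
  assumes "open U" "Ck_on k U f" "Ck_on k W g" "f ` U \<subseteq> W"
  shows "Ck_on k U (\<lambda>x. g (f x))"
  using assms(2,3)
proof (induction k arbitrary: g)
  case 0 then show ?case using assms(4) continuous_on_compose2 by auto
next
  case (Suc k)
  show ?case
  proof (rule Ck_on_SucI[OF assms(1)])
    fix x assume x: "x \<in> U"
    let ?g = "frechet_derivative g (at (f x))" and ?f = "frechet_derivative f (at x)"
    have fd: "(f has_derivative ?f) (at x)" and gd: "(g has_derivative ?g) (at (f x))"
      using Suc.prems x assms(4) Ck_on_SucD(1) by blast+
    have lin: "linear ?g" using gd has_derivative_linear by blast
    show "((\<lambda>x. g (f x)) has_derivative
        (\<lambda>v. \<Sum>b\<in>Basis. (?f v \<bullet> b) *\<^sub>R ?g b)) (at x)"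
      using has_derivative_compose[OF fd gd] by (simp add: linear_Basis_expansion[OF lin, of "?f _"])
  next
    fix v
    show "Ck_on k U (\<lambda>x. \<Sum>b\<in>Basis. (frechet_derivative f (at x) v \<bullet> b) *\<^sub>R
        frechet_derivative g (at (f x)) b)"
      using Suc.prems Ck_on_SucD(2)
      by (intro Ck_on_sum assms(1) Ck_on_scaleR Ck_on_inner Ck_on_const Suc.IH) (auto intro: Ck_on_lower)
  qed
qed

lemma Ck_on_frechet:
  assumes "Cinfty_on U f"
  shows "Cinfty_on U (\<lambda>x. frechet_derivative f (at x) v)"
  using assms Ck_on_SucD(2) by blast

lemma Cinfty_on_diff:
  assumes "Cinfty_on U f" "x \<in> U"
  shows "(f has_derivative frechet_derivative f (at x)) (at x)"
  using assms Ck_on_SucD(1) by blast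

lemma Cinfty_on_continuous:
  assumes "Cinfty_on U f"
  shows "continuous_on U f"
  using assms Ck_on.simps(1) by blast

lemma Ck_on_local:
  assumes "\<And>x. x \<in> U \<Longrightarrow> \<exists>V. open V \<and> x \<in> V \<and> Ck_on k V f"
  shows "Ck_on k U f"
  using assms
proof (induction k arbitrary: f)
  case 0
  have "continuous (at x) f" if x: "x \<in> U" for x
  proof -
    obtain V where V: "open V" "x \<in> V" "Ck_on 0 V f" using 0[OF x] by blast
    show ?thesis using V continuous_on_eq_continuous_at by auto
  qed
  then show ?case by (simp add: continuous_at_imp_continuous_on)
next
  case (Suc k)
  have 1: "f differentiable at x" if "x \<in> U" for x
    using Suc.prems[OF that] by auto
  have 2: "Ck_on k U (\<lambda>x. frechet_derivative f (at x) v)" for v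
    by (rule Suc.IH) (use Suc.prems in force)
  show ?case using 1 2 by simp
qed

lemma Ck_on_inverse: "Ck_on k (- {0::real}) inverse"
proof (induction k)
  case 0 then show ?case by (auto intro!: continuous_intros)
next
  case (Suc k)
  show ?case
  proof (rule Ck_on_SucI)
    show "(inverse has_derivative (\<lambda>v. - (inverse x * v * inverse x))) (at x)"
      if "x \<in> - {0}" for x :: real
      using has_derivative_inverse'[of x UNIV] that by simp
    show "Ck_on k (- {0}) (\<lambda>x. - (inverse x * v * inverse x))" for v :: real
    proof (rule Ck_on_cong)
      show "Ck_on k (- {0}) (\<lambda>x. inverse x * ((- v) * inverse x))"
        by (intro Ck_on_mult Ck_on_const Suc.IH) auto
    qed auto
  qed auto
qed

subsection \<open>Bump functions\<close>

text \<open>The function exp(-1/x) continued by 0, together with its multiples by powers of 1/x: up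
  to linear combinations this family is closed under differentiation, so one induction makes all
  members smooth at 0.\<close>

definition flat :: "nat \<Rightarrow> real \<Rightarrow> real" where
  "flat n x = (if x > 0 then inverse x ^ n * exp (- inverse x) else 0)"

text \<open>Comes from the single term of index n+1 in the exponential series of 1/x; the linear
  bound forces the difference quotients at 0 to tend to 0.\<close>

lemma flat_le: 
  assumes "x > 0" shows "flat n x \<le> fact (Suc n) * x"
proof -
  have "inverse x ^ Suc n / fact (Suc n) \<le> exp (inverse x)"
  proof -
    have "(\<Sum>i\<in>{Suc n}. inverse x ^ i /\<^sub>R fact i) \<le> exp (inverse x)"
      unfolding exp_def
      by (rule sum_le_suminf) (use assms summable_exp_generic[of "inverse x"] in \<open>auto simp: divide_inverse\<close>)
    then show ?thesis by (simp add: divide_inverse mult.commute)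
  qed
  then have "inverse x ^ Suc n \<le> fact (Suc n) * exp (inverse x)"
    by (metis divide_le_eq fact_gt_zero mult.commute)
  then have "inverse x ^ n \<le> fact (Suc n) * exp (inverse x) * x"
    using assms by (simp add: field_simps)
  then show ?thesis using assms
    by (simp add: flat_def exp_minus field_simps)
qed

lemma flat_nonneg: "flat n x \<ge> 0"
  by (auto simp: flat_def)

lemma flat_deriv: "(flat n has_real_derivative (flat (n + 2) x - n * flat (n + 1) x)) (at x)"
proof -
  consider "x > 0" | "x < 0" | "x = 0" by linarith
  then show ?thesis
  proof cases
    case 1
    have *: "((\<lambda>x. inverse x ^ n * exp (- inverse x)) has_real_derivative
        (flat (n + 2) x - n * flat (n + 1) x)) (at x)"
    proof -
      have i: "(inverse has_real_derivative - (inverse x ^ 2)) (at x)"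
        using DERIV_inverse[of x UNIV] 1 by (simp add: numeral_2_eq_2)
      have "(inverse x ^ n * (exp (- inverse x) * - (- (inverse x ^ 2))) +
          real n * inverse x ^ (n - 1) * (- (inverse x ^ 2)) * exp (- inverse x)) = 
          flat (n + 2) x - n * flat (n + 1) x"
        using 1 by (cases n) (simp_all add: flat_def power2_eq_square algebra_simps)
      moreover have "((\<lambda>x. inverse x ^ n * exp (- inverse x)) has_real_derivative
          inverse x ^ n * (exp (- inverse x) * - (- (inverse x ^ 2))) +
          real n * inverse x ^ (n - 1) * (- (inverse x ^ 2)) * exp (- inverse x)) (at x)"
        by (rule derivative_eq_intros i refl)+ (simp add: algebra_simps)
      ultimately show ?thesis by metis
    qed
    show ?thesis
      by (rule has_field_derivative_transform_within_open[OF *, of "{0<..}"]) (use 1 in \<open>auto simp: flat_def\<close>)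
  next
    case 2
    have *: "((\<lambda>x. 0) has_real_derivative (flat (n + 2) x - n * flat (n + 1) x)) (at x)"
      using 2 by (simp add: flat_def)
    show ?thesis
      by (rule has_field_derivative_transform_within_open[OF *, of "{..<0}"]) (use 2 in \<open>auto simp: flat_def\<close>)
  next
    case 3
    \<comment> \<open>For h > 0 the quotient is \<open>flat (Suc n) h\<close>, so the linear bound
      at index n+1 yields the constant (n+2)!.\<close>
    have b: "\<bar>flat n h / h\<bar> \<le> fact (Suc (Suc n)) * \<bar>h\<bar>" for h :: real
    proof (cases "h > 0")
      case True
      then have "flat n h / h = flat (Suc n) h" by (simp add: flat_def field_simps)
      then show ?thesis using flat_le[OF True, of "Suc n"] flat_nonneg[of "Suc n" h] True by simp
    next
      case False
      then have "flat n h / h = 0" by (simp add: flat_def)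
      then show ?thesis by (simp only: abs_zero) (intro mult_nonneg_nonneg, auto)
    qed
    have "((\<lambda>h::real. fact (Suc (Suc n)) * \<bar>h\<bar>) \<longlongrightarrow> fact (Suc (Suc n)) * \<bar>0\<bar>) (at 0)"
      by (intro tendsto_intros)
    then have "((\<lambda>h::real. fact (Suc (Suc n)) * \<bar>h\<bar>) \<longlongrightarrow> 0) (at 0)"
      by (simp only: abs_zero mult_zero_right)
    then have "(\<lambda>h. flat n h / h) \<midarrow>0\<rightarrow> 0"
      by (rule Lim_null_comparison[rotated])
         (rule always_eventually, rule allI, unfold real_norm_def, rule b)
    then show ?thesis using 3 by (simp add: DERIV_def flat_def)
  qed
qed

lemma Ck_on_flat: "Ck_on k UNIV (flat n)"
proof (induction k arbitrary: n)
  case 0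
  show ?case using DERIV_isCont[OF flat_deriv] by (simp add: continuous_at_imp_continuous_on)
next
  case (Suc k)
  show ?case
    by (rule Ck_on_SucI[where f' = "\<lambda>x v. (flat (n + 2) x - n * flat (n + 1) x) * v"])
       (use flat_deriv in \<open>auto simp: has_field_derivative_def
          intro!: Ck_on_mult Ck_on_diff Ck_on_const Suc.IH\<close>)
qed

text \<open>The standard quotient that is 1 up to t = 1 and 0 from t = 2 on; its denominator is
  positive because 2 - t and t - 1 are never both nonpositive.\<close>

definition smooth_step :: "real \<Rightarrow> real" where
  "smooth_step t = flat 0 (2 - t) * inverse (flat 0 (2 - t) + flat 0 (t - 1))"

lemma smooth_step_denom: "flat 0 (2 - t) + flat 0 (t - 1) > 0"
  using flat_nonneg[of 0 "2 - t"] flat_nonneg[of 0 "t - 1"]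
  by (cases "t > 1") (auto simp: flat_def add_nonneg_pos add_pos_nonneg)

lemma smooth_step_1: "t \<le> 1 \<Longrightarrow> smooth_step t = 1"
  using smooth_step_denom[of t] by (auto simp: smooth_step_def flat_def)

lemma smooth_step_0: "t \<ge> 2 \<Longrightarrow> smooth_step t = 0"
  by (auto simp: smooth_step_def flat_def)

lemma Ck_on_smooth_step: "Ck_on k UNIV smooth_step"
proof -
  have 1: "Ck_on k UNIV (\<lambda>t::real. flat 0 (2 - t))" "Ck_on k UNIV (\<lambda>t::real. flat 0 (t - 1))"
    by (rule Ck_on_compose[of UNIV k _ UNIV "flat 0"];
        auto intro!: Ck_on_diff Ck_on_const Ck_on_ident Ck_on_flat)+
  have "Ck_on k UNIV (\<lambda>t::real. inverse (flat 0 (2 - t) + flat 0 (t - 1)))"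
    by (rule Ck_on_compose[OF _ _ Ck_on_inverse]) 
       (use smooth_step_denom less_irrefl in \<open>auto intro!: Ck_on_add 1 simp del: open_UNIV intro: open_UNIV, metis less_irrefl\<close>)
  then show ?thesis
    unfolding smooth_step_def[abs_def] by (intro Ck_on_mult 1) auto
qed

lemma Cinfty_bump:
  fixes x0 :: "'a::euclidean_space"
  assumes "r > 0"
  obtains b :: "'a \<Rightarrow> real" where "Cinfty_on UNIV b" "\<And>x. x \<in> ball x0 (r/2) \<Longrightarrow> b x = 1"
    "\<And>x. x \<notin> ball x0 r \<Longrightarrow> b x = 0"
proof
  \<comment> \<open>The squared norm is polynomial, hence smooth at the centre as well. The factor 2
    / r^2 gives the value 2 at distance r and 1/2 at distance r/2, which suits the thresholds 2 and
    1 of \<open>smooth_step\<close>.\<close>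
  let ?n = "\<lambda>x. (2 / r^2) * ((x - x0) \<bullet> (x - x0))"
  let ?b = "\<lambda>x. smooth_step (?n x)"
  have "Ck_on k UNIV ?b" for k
    by (rule Ck_on_compose[OF open_UNIV _ Ck_on_smooth_step])
       (intro Ck_on_mult Ck_on_inner Ck_on_diff Ck_on_const Ck_on_ident open_UNIV, simp)
  then show "Cinfty_on UNIV ?b" by blast
  have n: "?n x = 2 * (dist x0 x / r)^2" for x
    by (simp add: dot_square_norm dist_norm norm_minus_commute power_divide)
  show "?b x = 1" if "x \<in> ball x0 (r/2)" for x
  proof (rule smooth_step_1)
    have "dist x0 x / r \<le> 1/2" using that assms by (simp add: divide_simps)
    then have "(dist x0 x / r)^2 \<le> (1/2)^2" using assms by (intro power_mono) auto
    then have "(dist x0 x / r)^2 \<le> 1/4" by (simp add: power2_eq_square)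
    moreover have "(dist x0 x / r)^2 \<ge> 0" by simp
    ultimately show "?n x \<le> 1" unfolding n by linarith
  qed
  show "?b x = 0" if "x \<notin> ball x0 r" for x
  proof (rule smooth_step_0)
    have "dist x0 x / r \<ge> 1" using that assms by (simp add: divide_simps)
    then have "(dist x0 x / r)^2 \<ge> 1^2" by (intro power_mono) auto
    then show "?n x \<ge> 2" unfolding n by simp
  qed
qed

subsection \<open>Hadamard's lemma\<close>

lemma ball_segment:
  fixes x0 :: "'a::real_normed_vector"
  assumes "x \<in> ball x0 r" "t \<in> cbox 0 (1::real)" shows "x0 + t *\<^sub>R (x - x0) \<in> ball x0 r"
proof -
  have "dist x0 (x0 + t *\<^sub>R (x - x0)) = t * dist x0 x"
    using assms(2) by (simp add: dist_norm norm_minus_commute)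
  also have "\<dots> \<le> dist x0 x" using assms(2) by (simp add: mult_left_le_one_le)
  finally show ?thesis using assms(1) by simp
qed

text \<open>Differentiating under the integral replaces F by its directional derivatives and raises
  the power of t by one; the weight t^j is carried along to make the statement inductive. Hadamard's
  lemma takes j = 0.\<close>

lemma Hadamard_integral:
  fixes F :: "'a::euclidean_space \<Rightarrow> real"
  assumes "Cinfty_on (ball x0 r) F"
  shows "Ck_on k (ball x0 r) (\<lambda>x. integral (cbox 0 1) (\<lambda>t. t^j * F (x0 + t *\<^sub>R (x - x0))))"
proof -
  let ?B = "ball x0 r"
  let ?I = "\<lambda>j F x. integral (cbox 0 1) (\<lambda>t::real. t^j * F (x0 + t *\<^sub>R (x - x0)) :: real)"
  note inB = ball_segment
  have contF: "continuous_on (?B \<times> cbox 0 1) (\<lambda>(x,t). F (x0 + t *\<^sub>R (x - x0)))"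
    if F: "continuous_on ?B F" for F :: "'a \<Rightarrow> real"
    unfolding split_beta
    by (rule continuous_on_compose2[OF F]) (use inB in \<open>force intro!: continuous_intros\<close>)+
  have contx: "continuous_on (cbox 0 1) (\<lambda>t. F (x0 + t *\<^sub>R (x - x0)))"
    if F: "continuous_on ?B F" and x: "x \<in> ?B" for x and F :: "'a \<Rightarrow> real"
    by (rule continuous_on_compose2[OF F]) (use inB x in \<open>force intro!: continuous_intros\<close>)+
  have deriv: "(?I j F has_derivative (\<lambda>v. \<Sum>b\<in>Basis. (v \<bullet> b) *
      ?I (Suc j) (\<lambda>y. frechet_derivative F (at y) b) x)) (at x)"
    if F: "Cinfty_on ?B F" and x: "x \<in> ?B" for F j x
  proof -
    let ?D = "\<lambda>b y. frechet_derivative F (at y) b"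
    have cD: "continuous_on ?B (?D b)" for b
      using Ck_on_frechet[OF F] Cinfty_on_continuous by blast
    \<comment> \<open>The Leibniz rule wants the derivative as a bounded linear operator depending
      continuously on (x, t); the basis expansion writes it as fixed operators with continuous
      coefficients.\<close>
    define fx where "fx x t = (\<Sum>b\<in>Basis. (t ^ Suc j * ?D b (x0 + t *\<^sub>R (x - x0))) *\<^sub>R blinfun_inner_left b)" for x t
    have "(?I j F has_derivative integral (cbox 0 1) (fx x)) (at x within ?B)"
    proof (rule leibniz_rule)
      fix y t assume y: "y \<in> ?B" and t: "t \<in> cbox 0 (1::real)"
      let ?z = "x0 + t *\<^sub>R (y - x0)"
      have z: "(F has_derivative frechet_derivative F (at ?z)) (at ?z)"
        using Cinfty_on_diff[OF F inB[OF y t]] .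
      have lin: "linear (frechet_derivative F (at ?z))" using z has_derivative_linear by blast
      have "((\<lambda>y. x0 + t *\<^sub>R (y - x0)) has_derivative (\<lambda>v. t *\<^sub>R v)) (at y)"
        by (auto intro!: derivative_eq_intros simp: scaleR_diff_right)
      from has_derivative_compose[OF this z]
      have "((\<lambda>y. t^j * F (x0 + t *\<^sub>R (y - x0))) has_derivative
          (\<lambda>v. t^j * frechet_derivative F (at ?z) (t *\<^sub>R v))) (at y)"
        by (rule has_derivative_mult_right)
      note D = this
      have e: "t^j * frechet_derivative F (at ?z) (t *\<^sub>R v) = fx y t v" for v
      proof -
        have "frechet_derivative F (at ?z) (t *\<^sub>R v) = t * frechet_derivative F (at ?z) v"
          by (simp add: linear_cmul[OF lin])
        also have "frechet_derivative F (at ?z) v = (\<Sum>b\<in>Basis. (v \<bullet> b) *\<^sub>R ?D b ?z)"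
          by (rule linear_Basis_expansion[OF lin])
        finally show ?thesis
          by (simp add: fx_def blinfun.sum_left blinfun.scaleR_left sum_distrib_left inner_commute algebra_simps)
      qed
      show "((\<lambda>y. t^j * F (x0 + t *\<^sub>R (y - x0))) has_derivative fx y t) (at y within ?B)"
        using D unfolding e by (rule has_derivative_at_withinI)
    next
      show "(\<lambda>t. t^j * F (x0 + t *\<^sub>R (y - x0))) integrable_on cbox 0 1" if "y \<in> ?B" for y
        by (intro integrable_continuous continuous_intros contx Cinfty_on_continuous F that)
      show "continuous_on (?B \<times> cbox 0 1) (\<lambda>(x, t). fx x t)"
        using contF[OF cD] unfolding fx_def split_beta
        by (auto intro!: continuous_intros)
    qed (use x in auto)
    then have "(?I j F has_derivative integral (cbox 0 1) (fx x)) (at x)"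
      using x at_within_open[of x ?B] by simp
    moreover have "integral (cbox 0 1) (fx x) v = (\<Sum>b\<in>Basis. (v \<bullet> b) * ?I (Suc j) (?D b) x)" for v
    proof -
      have 1: "(\<lambda>t. t ^ Suc j * ?D b (x0 + t *\<^sub>R (x - x0))) integrable_on {0..1}" for b
        unfolding cbox_interval[symmetric]
        by (intro integrable_continuous continuous_intros contx cD x)
      have 2: "fx x integrable_on cbox 0 1"
        unfolding fx_def
        by (intro integrable_continuous continuous_intros contx cD x)
      have "blinfun_apply (integral (cbox 0 1) (fx x)) v = integral (cbox 0 1) (\<lambda>t. fx x t v)"
        using blinfun_apply_integral[OF 2] by simp
      also have "\<dots> = integral (cbox 0 1) (\<lambda>t. \<Sum>b\<in>Basis. (v \<bullet> b) * (t ^ Suc j * ?D b (x0 + t *\<^sub>R (x - x0))))"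
        by (simp add: fx_def blinfun.sum_left blinfun.scaleR_left algebra_simps inner_commute)
      also have "\<dots> = (\<Sum>b\<in>Basis. (v \<bullet> b) * ?I (Suc j) (?D b) x)"
        by (subst integral_sum) (auto intro!: integrable_on_mult_right 1 simp del: power_Suc)
      finally show ?thesis .
    qed
    ultimately show ?thesis by (rule has_derivative_eq_rhs[OF _ ext])
  qed
  show ?thesis using assms
  proof (induction k arbitrary: j F)
    case 0
    then show ?case
      using has_derivative_continuous[OF deriv[OF 0]]
      by (simp add: continuous_at_imp_continuous_on)
  next
    case (Suc k)
    show ?case
      by (rule Ck_on_SucI[OF open_ball deriv[OF Suc.prems]], assumption)
         (intro Ck_on_sum Ck_on_mult Ck_on_const Suc.IH Ck_on_frechet[OF Suc.prems] open_ball)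
  qed
qed

text \<open>The fundamental theorem of calculus along the segment from x0 to x, with G b the mean
  over the segment of the derivative in direction b. It serves to identify derivations at a point
  with coordinate vectors.\<close>

lemma Hadamard:
  fixes F :: "'a::euclidean_space \<Rightarrow> real"
  assumes F: "Cinfty_on (ball x0 r) F" and r: "r > 0"
  obtains G where "\<And>b. Cinfty_on (ball x0 r) (G b)"
    "\<And>x. x \<in> ball x0 r \<Longrightarrow> F x = F x0 + (\<Sum>b\<in>Basis. ((x - x0) \<bullet> b) * G b x)"
    "\<And>b. G b x0 = frechet_derivative F (at x0) b"
proof
  let ?D = "\<lambda>b y. frechet_derivative F (at y) b"
  let ?G = "\<lambda>b x. integral (cbox 0 1) (\<lambda>t. t^0 * ?D b (x0 + t *\<^sub>R (x - x0)))"
  show "Cinfty_on (ball x0 r) (?G b)" for b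
    using Hadamard_integral[OF Ck_on_frechet[OF F]] by blast
  show "?G b x0 = ?D b x0" for b by simp
  fix x assume x: "x \<in> ball x0 r"
  note inB = ball_segment[OF x]
  have cont: "continuous_on (cbox 0 1) (\<lambda>t. ?D b (x0 + t *\<^sub>R (x - x0)))" for b
    by (rule continuous_on_compose2[OF Cinfty_on_continuous[OF Ck_on_frechet[OF F]]])
       (use inB in \<open>force intro!: continuous_intros\<close>)+
  have "((\<lambda>t. F (x0 + t *\<^sub>R (x - x0))) has_vector_derivative
      (\<Sum>b\<in>Basis. ((x - x0) \<bullet> b) * ?D b (x0 + t *\<^sub>R (x - x0)))) (at t within {0..1})"
    if t: "t \<in> {0..1}" for t
  proof -
    let ?z = "x0 + t *\<^sub>R (x - x0)"
    have z: "(F has_derivative frechet_derivative F (at ?z)) (at ?z)"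
      using Cinfty_on_diff[OF F inB] t by simp
    have lin: "linear (frechet_derivative F (at ?z))" using z has_derivative_linear by blast
    have "((\<lambda>t. x0 + t *\<^sub>R (x - x0)) has_derivative (\<lambda>h. h *\<^sub>R (x - x0))) (at t)"
      by (auto intro!: derivative_eq_intros)
    from has_derivative_compose[OF this z]
    have "((\<lambda>t. F (x0 + t *\<^sub>R (x - x0))) has_vector_derivative frechet_derivative F (at ?z) (x - x0)) (at t)"
      by (simp add: has_vector_derivative_def linear_cmul[OF lin])
    moreover have "frechet_derivative F (at ?z) (x - x0) = (\<Sum>b\<in>Basis. ((x - x0) \<bullet> b) * ?D b ?z)"
      using linear_Basis_expansion[OF lin, of "x - x0"] by simp
    ultimately show ?thesis using has_vector_derivative_at_within by fastforce
  qed
  then have "((\<lambda>t. \<Sum>b\<in>Basis. ((x - x0) \<bullet> b) * ?D b (x0 + t *\<^sub>R (x - x0))) has_integral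
      F (x0 + 1 *\<^sub>R (x - x0)) - F (x0 + 0 *\<^sub>R (x - x0))) {0..1}"
    by (intro fundamental_theorem_of_calculus) auto
  then have "F x - F x0 = integral (cbox 0 1) (\<lambda>t. \<Sum>b\<in>Basis. ((x - x0) \<bullet> b) * ?D b (x0 + t *\<^sub>R (x - x0)))"
    by (simp add: integral_unique)
  also have "\<dots> = (\<Sum>b\<in>Basis. ((x - x0) \<bullet> b) * ?G b x)"
    by (subst integral_sum) (auto intro!: integrable_on_mult_right integrable_continuous[OF cont, simplified])
  finally show "F x = F x0 + (\<Sum>b\<in>Basis. ((x - x0) \<bullet> b) * ?G b x)" by simp
qed

subsection \<open>Smoothness on arbitrary subsets\<close>

lemma smooth_onI:
  assumes "\<And>x. x \<in> X \<Longrightarrow> \<exists>W F. open W \<and> x \<in> W \<and> Cinfty_on W F \<and> (\<forall>y\<in>W \<inter> X. F y = f y)"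
  shows "smooth_on X f"
  using assms by (simp add: smooth_on_def)

lemma smooth_onE:
  assumes "smooth_on X f" "x \<in> X"
  obtains W F where "open W" "x \<in> W" "Cinfty_on W F" "\<And>y. y \<in> W \<Longrightarrow> y \<in> X \<Longrightarrow> F y = f y"
proof -
  have "\<exists>W F. open W \<and> x \<in> W \<and> Cinfty_on W F \<and> (\<forall>y\<in>W \<inter> X. F y = f y)"
    using assms by (simp add: smooth_on_def)
  then show ?thesis using that by auto
qed

lemma smooth_on_Cinfty: "open W \<Longrightarrow> Cinfty_on W f \<Longrightarrow> X \<subseteq> W \<Longrightarrow> smooth_on X f"
  by (rule smooth_onI, rule exI[of _ W], rule exI[of _ f]) auto

lemma smooth_on_compose:
  fixes f :: "'a::real_normed_vector \<Rightarrow> 'b::euclidean_space"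
  assumes f: "smooth_on X f" and g: "smooth_on Y g" and "f ` X \<subseteq> Y"
  shows "smooth_on X (g \<circ> f)"
proof (rule smooth_onI)
  fix x assume x: "x \<in> X"
  obtain W F where W: "open W" "x \<in> W" "Cinfty_on W F" "\<And>y. y \<in> W \<Longrightarrow> y \<in> X \<Longrightarrow> F y = f y"
    using smooth_onE[OF f x] by metis
  obtain V G where V: "open V" "f x \<in> V" "Cinfty_on V G" "\<And>y. y \<in> V \<Longrightarrow> y \<in> Y \<Longrightarrow> G y = g y"
    using smooth_onE[OF g, of "f x"] x assms(3) by blast
  \<comment> \<open>The extension F of f need not map into V, the domain of G, so the composite is
    taken on the part of W that does.\<close>
  let ?W = "W \<inter> F -` V"
  have o: "open ?W"
    using continuous_open_preimage[OF Cinfty_on_continuous[OF W(3)] W(1) V(1)] .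
  have "Ck_on k ?W (\<lambda>y. G (F y))" for k
    by (rule Ck_on_compose[OF o Ck_on_subset[OF W(3)[rule_format]] V(3)[rule_format]]) auto
  then show "\<exists>W F. open W \<and> x \<in> W \<and> Cinfty_on W F \<and> (\<forall>y\<in>W \<inter> X. F y = (g \<circ> f) y)"
    using o W V x assms(3) by (intro exI[of _ ?W] exI[of _ "\<lambda>y. G (F y)"]) (auto simp: image_subset_iff)
qed

lemma smooth_on_binary:
  fixes f g :: "'a::real_normed_vector \<Rightarrow> real"
  assumes f: "smooth_on X f" and g: "smooth_on X g"
    and op: "\<And>(W::'a set) F G. open W \<Longrightarrow> Cinfty_on W F \<Longrightarrow> Cinfty_on W G \<Longrightarrow> Cinfty_on W (\<lambda>x. op (F x) (G x))"
  shows "smooth_on X (\<lambda>x. op (f x) (g x))"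
proof (rule smooth_onI)
  fix x assume x: "x \<in> X"
  obtain W F where W: "open W" "x \<in> W" "Cinfty_on W F" "\<And>y. y \<in> W \<Longrightarrow> y \<in> X \<Longrightarrow> F y = f y"
    using smooth_onE[OF f x] by metis
  obtain V G where V: "open V" "x \<in> V" "Cinfty_on V G" "\<And>y. y \<in> V \<Longrightarrow> y \<in> X \<Longrightarrow> G y = g y"
    using smooth_onE[OF g x] by metis
  have "Cinfty_on (W \<inter> V) F" "Cinfty_on (W \<inter> V) G"
    using W V by (auto intro: Ck_on_subset)
  then have "Cinfty_on (W \<inter> V) (\<lambda>y. op (F y) (G y))" by (rule op[OF open_Int[OF W(1) V(1)]])
  then show "\<exists>W F. open W \<and> x \<in> W \<and> Cinfty_on W F \<and> (\<forall>y\<in>W \<inter> X. F y = op (f y) (g y))"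
    using W V by (intro exI[of _ "W \<inter> V"] exI[of _ "\<lambda>y. op (F y) (G y)"]) auto
qed

lemma orthonormal_expansion:
  fixes S :: "'a::euclidean_space set"
  assumes "subspace S"
  obtains B where "finite B" "B \<subseteq> S" "\<And>u. u \<in> S \<Longrightarrow> u = (\<Sum>b\<in>B. (u \<bullet> b) *\<^sub>R b)"
proof -
  obtain B where B: "B \<subseteq> S" "pairwise orthogonal B" "\<And>x. x \<in> B \<Longrightarrow> norm x = 1"
      "independent B" "span B = S"
    using orthonormal_basis_subspace[OF assms] by metis
  have fin: "finite B" using B(4) independent_bound by blast
  have "u = (\<Sum>b\<in>B. (u \<bullet> b) *\<^sub>R b)" if u: "u \<in> S" for u
  proof -
    obtain a where a: "u = (\<Sum>b\<in>B. a b *\<^sub>R b)"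
      using u B(5) span_finite[OF fin] by auto
    have "u \<bullet> b = a b" if b: "b \<in> B" for b
    proof -
      have "u \<bullet> b = (\<Sum>b'\<in>B. if b' = b then a b else 0)"
        unfolding a inner_sum_left
        by (rule sum.cong) (use B(2,3) b in \<open>auto simp: pairwise_def orthogonal_def norm_eq_1\<close>)
      then show ?thesis using fin b by simp
    qed
    then show ?thesis using a by simp
  qed
  then show ?thesis using that fin B(1) by blast
qed

section \<open>Smooth functions and tangent vectors on manifolds\<close>

text \<open>The germ filter of S at p. Unlike \<open>at p within S\<close> it is not punctured, so
  for p in S an eventual equality also holds at p itself.\<close>

abbreviation nb :: "'a::topological_space set \<Rightarrow> 'a \<Rightarrow> 'a filter" where
  "nb S p \<equiv> inf (nhds p) (principal S)"

lemma eventually_nb: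
  "eventually P (nb S p) \<longleftrightarrow> (\<exists>T. open T \<and> p \<in> T \<and> (\<forall>q\<in>T. q \<in> S \<longrightarrow> P q))"
  by (simp add: eventually_inf_principal eventually_nhds)

lemma eventually_nb_self: "eventually P (nb S p) \<Longrightarrow> p \<in> S \<Longrightarrow> P p"
  by (auto simp: eventually_nb)

lemma eventually_nb_in: "\<forall>\<^sub>F q in nb S p. q \<in> S"
  by (auto simp: eventually_nb)

lemma eventually_nb_nb: "eventually P (nb S p) \<Longrightarrow> \<forall>\<^sub>F q in nb S p. eventually P (nb S q)"
  unfolding eventually_nb by blast

lemma eventually_nb_mono: "eventually P (nb S p) \<Longrightarrow> S' \<subseteq> S \<Longrightarrow> eventually P (nb S' p)"
  unfolding eventually_nb by blast

lemma sum_fun_apply: "(\<Sum>i\<in>I. f i) x = (\<Sum>i\<in>I. f i x)"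
  by (induction I rule: infinite_finite_induct) auto

locale manifold =
  fixes M :: "('m::{t2_space,second_countable_topology}, 'e::euclidean_space) mfd"
  assumes smooth: "smooth_manifold M"
begin

abbreviation nbM :: "'m \<Rightarrow> 'm filter" where "nbM p \<equiv> nb (pts M) p"

lemma subspace_model: "subspace (model M)"
  using smooth by (simp add: smooth_manifold_def)

lemma atlas_charts: "c \<in> atlas M \<Longrightarrow> c \<in> smooth_charts M"
  using smooth by (auto simp: smooth_manifold_def)

lemma atlas_cover:
  assumes "p \<in> pts M"
  obtains U \<phi> where "(U, \<phi>) \<in> atlas M" "p \<in> U"
proof -
  have "p \<in> \<Union>(fst ` atlas M)" using assms smooth by (simp add: smooth_manifold_def)
  then show ?thesis using that by auto
qed

lemma chart:
  assumes "(U, \<phi>) \<in> smooth_charts M"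
  shows chart_sub: "U \<subseteq> pts M"
    and chart_model: "\<phi> ` U \<subseteq> model M"

    and chart_inv: "\<And>q. q \<in> U \<Longrightarrow> inv_into U \<phi> (\<phi> q) = q"
    and chart_cont: "continuous_on U \<phi>"
    and chart_cont_inv: "continuous_on (\<phi> ` U) (inv_into U \<phi>)"
    and chart_open: "openin (top_of_set (pts M)) U"
    and chart_open_img: "openin (top_of_set (model M)) (\<phi> ` U)"
    and chart_trans: "\<And>V \<kappa>. (V, \<kappa>) \<in> atlas M \<Longrightarrow> smooth_on (\<phi> ` (U \<inter> V)) (\<kappa> \<circ> inv_into U \<phi>)"
    and chart_trans': "\<And>V \<kappa>. (V, \<kappa>) \<in> atlas M \<Longrightarrow> smooth_on (\<kappa> ` (V \<inter> U)) (\<phi> \<circ> inv_into V \<kappa>)"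
proof -
  have c: "openin (top_of_set (pts M)) U" "openin (top_of_set (model M)) (\<phi> ` U)"
     "homeomorphism U (\<phi> ` U) \<phi> (inv_into U \<phi>)"
    using assms by (auto simp: smooth_charts_def is_chart_def)
  then show "U \<subseteq> pts M" "\<phi> ` U \<subseteq> model M" "continuous_on U \<phi>" "continuous_on (\<phi> ` U) (inv_into U \<phi>)"
    "\<And>q. q \<in> U \<Longrightarrow> inv_into U \<phi> (\<phi> q) = q" "openin (top_of_set (pts M)) U" "openin (top_of_set (model M)) (\<phi> ` U)"
    by (auto simp: homeomorphism_def dest: openin_imp_subset)

  show "\<And>V \<kappa>. (V, \<kappa>) \<in> atlas M \<Longrightarrow> smooth_on (\<phi> ` (U \<inter> V)) (\<kappa> \<circ> inv_into U \<phi>)"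
    "\<And>V \<kappa>. (V, \<kappa>) \<in> atlas M \<Longrightarrow> smooth_on (\<kappa> ` (V \<inter> U)) (\<phi> \<circ> inv_into V \<kappa>)"
    using assms by (auto simp: smooth_charts_def smooth_transition_def)
qed

lemma chart_eventually:
  assumes c: "(U, \<phi>) \<in> smooth_charts M" and p: "p \<in> U" and W: "open W" "\<phi> p \<in> W"
  shows "\<forall>\<^sub>F q in nbM p. q \<in> U \<and> \<phi> q \<in> W"
proof -
  obtain T where T: "open T" "U = pts M \<inter> T" using chart_open[OF c] by (auto simp: openin_open)
  obtain A where A: "open A" "A \<inter> U = \<phi> -` W \<inter> U"
    using chart_cont[OF c] W(1) unfolding continuous_on_open_invariant by blast
  show ?thesis unfolding eventually_nb
    by (rule exI[of _ "A \<inter> T"]) (use A T p W in auto)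
qed

lemma chart_eventually_in:
  assumes "(U, \<phi>) \<in> smooth_charts M" "p \<in> U"
  shows "\<forall>\<^sub>F q in nbM p. q \<in> U"
  using chart_eventually[OF assms open_UNIV] by simp

text \<open>Turns a property of germs at p into one on a coordinate ball. The ball is closed so that
  its preimage is compact, as \<open>chart_supported\<close> requires.\<close>

lemma chart_pull:
  assumes c: "(U, \<phi>) \<in> smooth_charts M" and p: "p \<in> U" and P: "eventually P (nbM p)"
  obtains r where "r > 0" "\<And>y. y \<in> cball (\<phi> p) r \<Longrightarrow> y \<in> model M \<Longrightarrow> y \<in> \<phi> ` U \<and> P (inv_into U \<phi> y)"
proof -
  obtain T where T: "open T" "p \<in> T" "\<And>q. q \<in> T \<Longrightarrow> q \<in> pts M \<Longrightarrow> P q"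
    using P by (auto simp: eventually_nb)
  obtain A where A: "open A" "A \<inter> \<phi> ` U = inv_into U \<phi> -` T \<inter> \<phi> ` U"
    using chart_cont_inv[OF c] T(1) unfolding continuous_on_open_invariant by blast
  obtain B where B: "open B" "\<phi> ` U = model M \<inter> B"
    using chart_open_img[OF c] by (auto simp: openin_open)
  have "\<phi> p \<in> A \<inter> B" using A B p T(2) chart_inv[OF c p] by auto
  then obtain r where r: "r > 0" "cball (\<phi> p) r \<subseteq> A \<inter> B"
    using A(1) B(1) open_contains_cball by (metis open_Int)
  show ?thesis
  proof (rule that[OF r(1)])
    fix y assume y: "y \<in> cball (\<phi> p) r" "y \<in> model M"
    then have yU: "y \<in> \<phi> ` U" using B r by auto
    have "y \<in> A \<inter> \<phi> ` U" using subsetD[OF r(2) y(1)] yU by simp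
    then have "inv_into U \<phi> y \<in> T" unfolding A(2) by simp
    moreover have "inv_into U \<phi> y \<in> pts M" using subsetD[OF chart_sub[OF c] inv_into_into[OF yU]] .
    ultimately show "y \<in> \<phi> ` U \<and> P (inv_into U \<phi> y)" using yU T by auto
  qed
qed

lemma Cinf_outside: "f \<in> Cinf M \<Longrightarrow> p \<notin> pts M \<Longrightarrow> f p = 0"
  by (simp add: Cinf_def)

text \<open>\<open>Cinf\<close> is defined through the atlas alone; composing with a transition map
  gives a Euclidean representative in any chart of the maximal atlas, such as slice charts and
  charts transported by a tubular map.\<close>

lemma Cinf_chart:
  assumes f: "f \<in> Cinf M" and c: "(U, \<phi>) \<in> smooth_charts M" and q: "q \<in> U"
  obtains W G where "open W" "\<phi> q \<in> W" "Cinfty_on W G" "\<forall>\<^sub>F q' in nbM q. f q' = G (\<phi> q')"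
proof -
  obtain V \<kappa> where V: "(V, \<kappa>) \<in> atlas M" "q \<in> V" using atlas_cover chart_sub[OF c] q by blast
  note Vc = atlas_charts[OF V(1)]
  have "smooth_on (\<kappa> ` V) (f \<circ> inv_into V \<kappa>)" using f V(1) by (auto simp: Cinf_def)
  then have "smooth_on (\<phi> ` (U \<inter> V)) ((f \<circ> inv_into V \<kappa>) \<circ> (\<kappa> \<circ> inv_into U \<phi>))"
    by (rule smooth_on_compose[OF chart_trans[OF c V(1)]]) (use chart_inv[OF c] in auto)
  then obtain W F where W: "open W" "\<phi> q \<in> W" "Cinfty_on W F"
    "\<And>y. y \<in> W \<Longrightarrow> y \<in> \<phi> ` (U \<inter> V) \<Longrightarrow> F y = ((f \<circ> inv_into V \<kappa>) \<circ> (\<kappa> \<circ> inv_into U \<phi>)) y"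
    by (rule smooth_onE[where x = "\<phi> q"]) (use q V in auto)
  have "\<forall>\<^sub>F q' in nbM q. f q' = F (\<phi> q')"
    using chart_eventually[OF c q W(1,2)] chart_eventually_in[OF Vc V(2)]
    by eventually_elim (use W(4) chart_inv[OF c] chart_inv[OF Vc] in auto)
  then show ?thesis using that W by blast
qed

lemma CinfI:
  assumes "\<And>p. p \<notin> pts M \<Longrightarrow> f p = 0"
    and "\<And>U \<phi> q. (U, \<phi>) \<in> atlas M \<Longrightarrow> q \<in> U \<Longrightarrow>
      \<exists>W G. open W \<and> \<phi> q \<in> W \<and> Cinfty_on W G \<and> (\<forall>\<^sub>F q' in nbM q. f q' = G (\<phi> q'))"
  shows "f \<in> Cinf M"
proof -
  have "smooth_on (\<phi> ` U) (f \<circ> inv_into U \<phi>)" if U: "(U, \<phi>) \<in> atlas M" for U \<phi>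
  proof (rule smooth_onI)
    fix x assume "x \<in> \<phi> ` U"
    then obtain q where q: "q \<in> U" "x = \<phi> q" by blast
    note c = atlas_charts[OF U]
    obtain W G where W: "open W" "\<phi> q \<in> W" "Cinfty_on W G" and ev: "\<forall>\<^sub>F q' in nbM q. f q' = G (\<phi> q')"
      using assms(2)[OF U q(1)] by auto
    obtain r where r: "r > 0" "\<And>y. y \<in> cball (\<phi> q) r \<Longrightarrow> y \<in> model M \<Longrightarrow>
        y \<in> \<phi> ` U \<and> f (inv_into U \<phi> y) = G (\<phi> (inv_into U \<phi> y))"
      using chart_pull[OF c q(1) ev] by blast
    have "G y = f (inv_into U \<phi> y)" if y: "y \<in> ball (\<phi> q) r" "y \<in> \<phi> ` U" for y
      using r(2)[of y] y chart_model[OF c] f_inv_into_f[OF y(2)] by auto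
    then show "\<exists>W F. open W \<and> x \<in> W \<and> Cinfty_on W F \<and> (\<forall>y\<in>W \<inter> \<phi> ` U. F y = (f \<circ> inv_into U \<phi>) y)"
      using W r(1) q
      by (intro exI[of _ "W \<inter> ball (\<phi> q) r"] exI[of _ G]) (auto intro: Ck_on_subset)
  qed
  then show ?thesis using assms(1) by (auto simp: Cinf_def)
qed

lemma Cinf_local:
  assumes "\<And>p. p \<notin> pts M \<Longrightarrow> f p = 0"
    and "\<And>p. p \<in> pts M \<Longrightarrow> \<exists>g\<in>Cinf M. \<forall>\<^sub>F q in nbM p. f q = g q"
  shows "f \<in> Cinf M"
proof (rule CinfI[OF assms(1)])
  fix U \<phi> q assume U: "(U, \<phi>) \<in> atlas M" and q: "q \<in> U"
  note c = atlas_charts[OF U]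
  obtain g where g: "g \<in> Cinf M" "\<forall>\<^sub>F q' in nbM q. f q' = g q'"
    using assms(2) chart_sub[OF c] q by blast
  obtain W G where W: "open W" "\<phi> q \<in> W" "Cinfty_on W G" "\<forall>\<^sub>F q' in nbM q. g q' = G (\<phi> q')"
    using Cinf_chart[OF g(1) c q] .
  have "\<forall>\<^sub>F q' in nbM q. f q' = G (\<phi> q')" using g(2) W(4) by eventually_elim simp
  then show "\<exists>W G. open W \<and> \<phi> q \<in> W \<and> Cinfty_on W G \<and> (\<forall>\<^sub>F q' in nbM q. f q' = G (\<phi> q'))"
    using W by blast
qed auto

lemma Cinf_add: 
  assumes "f \<in> Cinf M" "g \<in> Cinf M" shows "f + g \<in> Cinf M"
  using assms unfolding Cinf_def
  by (auto intro!: smooth_on_binary[where op = "(+)"] Ck_on_add simp: o_def)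

lemma Cinf_mult: 
  assumes "f \<in> Cinf M" "g \<in> Cinf M" shows "f * g \<in> Cinf M"
  using assms unfolding Cinf_def
  by (auto intro!: smooth_on_binary[where op = "(*)"] Ck_on_mult simp: o_def)

lemma Cinf_const: "(\<lambda>p. if p \<in> pts M then c else 0) \<in> Cinf M"
proof (rule CinfI)
  fix U \<phi> q
  show "\<exists>W G. open W \<and> \<phi> q \<in> W \<and> Cinfty_on W G \<and> (\<forall>\<^sub>F q' in nbM q. (if q' \<in> pts M then c else 0) = G (\<phi> q'))"
    by (intro exI[of _ UNIV] exI[of _ "\<lambda>_. c"]) (auto simp: Ck_on_const eventually_nb)
qed auto

definition one :: "'m \<Rightarrow> real" where "one p = (if p \<in> pts M then 1 else 0)"

lemma one_simps [simp]: "p \<in> pts M \<Longrightarrow> one p = 1" "p \<notin> pts M \<Longrightarrow> one p = 0"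
  by (auto simp: one_def)

lemma Cinf_one: "one \<in> Cinf M"
  using Cinf_const[of 1] unfolding one_def[abs_def] by simp

lemma Cinf_scale: 
  assumes "f \<in> Cinf M" shows "(\<lambda>x. c * f x) \<in> Cinf M"
proof -
  have "(\<lambda>x. c * f x) = (\<lambda>p. if p \<in> pts M then c else 0) * f"
    using assms by (auto simp: fun_eq_iff Cinf_outside)
  then show ?thesis using Cinf_mult[OF Cinf_const assms] by simp
qed

lemma Cinf_zero: "0 \<in> Cinf M"
  using Cinf_const[of 0] by (simp add: zero_fun_def)

lemma Cinf_uminus: assumes "f \<in> Cinf M" shows "- f \<in> Cinf M"
  using Cinf_scale[OF assms, of "-1"] by (simp add: fun_Compl_def)

lemma Cinf_diff: "f \<in> Cinf M \<Longrightarrow> g \<in> Cinf M \<Longrightarrow> f - g \<in> Cinf M"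
  using Cinf_add[of f "- g"] Cinf_uminus[of g] by simp

lemma Cinf_sum: "(\<And>i. i \<in> I \<Longrightarrow> f i \<in> Cinf M) \<Longrightarrow> (\<Sum>i\<in>I. f i) \<in> Cinf M"
  by (induction I rule: infinite_finite_induct) (auto simp: Cinf_zero Cinf_add)

text \<open>The closed coordinate ball is compact in the model, so its image in M is compact and,
  the space being Hausdorff, closed. Hence the extension by zero vanishes near every point off that
  image.\<close>

lemma chart_supported:
  assumes c: "(U, \<phi>) \<in> smooth_charts M" and p: "p \<in> U" and r: "r > 0"
    and sub: "cball (\<phi> p) r \<inter> model M \<subseteq> \<phi> ` U"
    and G: "Cinfty_on UNIV G" "\<And>y. y \<notin> ball (\<phi> p) r \<Longrightarrow> G y = 0"
  shows "(\<lambda>q. if q \<in> U then G (\<phi> q) else 0) \<in> Cinf M" (is "?f \<in> _")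
    and "q \<notin> inv_into U \<phi> ` (cball (\<phi> p) r \<inter> model M) \<Longrightarrow>
      \<forall>\<^sub>F q' in nbM q. (if q' \<in> U then G (\<phi> q') else 0) = 0"
proof -
  let ?K = "inv_into U \<phi> ` (cball (\<phi> p) r \<inter> model M)"
  have "compact (cball (\<phi> p) r \<inter> model M)"
    by (rule compact_Int_closed[OF compact_cball closed_subspace[OF subspace_model]])
  then have "compact ?K"
    by (rule compact_continuous_image[OF continuous_on_subset[OF chart_cont_inv[OF c] sub]])
  then have K: "closed ?K" by (rule compact_imp_closed)
  have z: "?f q = 0" if "q \<notin> ?K" for q
  proof (cases "q \<in> U")
    case True
    have "\<phi> q \<notin> ball (\<phi> p) r"
    proof
      assume "\<phi> q \<in> ball (\<phi> p) r"
      then have "\<phi> q \<in> cball (\<phi> p) r \<inter> model M" using True chart_model[OF c] by auto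
      then have "inv_into U \<phi> (\<phi> q) \<in> ?K" by blast
      then show False using that chart_inv[OF c True] by simp
    qed
    then show ?thesis using G(2) by simp
  qed auto
  show ev0: "\<forall>\<^sub>F q' in nbM q. ?f q' = 0" if "q \<notin> ?K" for q
    unfolding eventually_nb
    by (rule exI[of _ "- ?K"]) (use K z that in \<open>simp add: open_Compl\<close>)
  show "?f \<in> Cinf M"
  proof (rule CinfI)
    fix q assume q: "q \<notin> pts M"
    then show "?f q = 0" using chart_sub[OF c] by auto
  next
    fix V \<kappa> q assume V: "(V, \<kappa>) \<in> atlas M" and q: "q \<in> V"
    note Vc = atlas_charts[OF V]
    show "\<exists>W G'. open W \<and> \<kappa> q \<in> W \<and> Cinfty_on W G' \<and> (\<forall>\<^sub>F q' in nbM q. ?f q' = G' (\<kappa> q'))"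
    proof (cases "q \<in> U")
      case True
      have "smooth_on UNIV G" using smooth_on_Cinfty[OF open_UNIV G(1)] by simp
      then have "smooth_on (\<kappa> ` (V \<inter> U)) (G \<circ> (\<phi> \<circ> inv_into V \<kappa>))"
        by (rule smooth_on_compose[OF chart_trans'[OF c V]]) auto
      then obtain W F where W: "open W" "\<kappa> q \<in> W" "Cinfty_on W F"
        "\<And>y. y \<in> W \<Longrightarrow> y \<in> \<kappa> ` (V \<inter> U) \<Longrightarrow> F y = (G \<circ> (\<phi> \<circ> inv_into V \<kappa>)) y"
        by (rule smooth_onE[where x = "\<kappa> q"]) (use q True in auto)
      have "\<forall>\<^sub>F q' in nbM q. ?f q' = F (\<kappa> q')"
        using chart_eventually[OF Vc q W(1,2)] chart_eventually_in[OF c True]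
        by eventually_elim (use W(4) chart_inv[OF Vc] in auto)
      then show ?thesis using W by blast
    next
      case False
      have "cball (\<phi> p) r \<inter> model M \<subseteq> \<phi> ` U" by fact
      then have "?K \<subseteq> U" by (auto intro: inv_into_into)
      then have "\<forall>\<^sub>F q' in nbM q. ?f q' = 0" using ev0[of q] False by blast
      then show ?thesis
        by (intro exI[of _ UNIV] exI[of _ "\<lambda>_. 0"]) (auto simp: Ck_on_const)
    qed
  qed
qed

text \<open>The last clause is what globalises local constructions: near any q either the cut-off
  kills them or they make sense throughout a neighbourhood of q.\<close>

lemma bump:
  assumes p: "p \<in> pts M" and P: "eventually P (nbM p)"
  obtains \<theta> where "\<theta> \<in> Cinf M" "\<forall>\<^sub>F q in nbM p. \<theta> q = 1"
    "\<And>q. q \<in> pts M \<Longrightarrow> (\<forall>\<^sub>F q' in nbM q. \<theta> q' = 0) \<or> eventually P (nbM q)"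
proof -
  obtain U \<phi> where U: "(U, \<phi>) \<in> atlas M" and pU: "p \<in> U" using atlas_cover[OF p] .
  note c = atlas_charts[OF U]
  obtain r where r: "r > 0" "\<And>y. y \<in> cball (\<phi> p) r \<Longrightarrow> y \<in> model M \<Longrightarrow>
      y \<in> \<phi> ` U \<and> eventually P (nbM (inv_into U \<phi> y))"
    using chart_pull[OF c pU eventually_nb_nb[OF P]] by blast
  obtain b where b: "Cinfty_on UNIV b" "\<And>x. x \<in> ball (\<phi> p) (r/2) \<Longrightarrow> b x = 1"
    "\<And>x. x \<notin> ball (\<phi> p) r \<Longrightarrow> b x = (0::real)"
    using Cinfty_bump[OF r(1)] by blast
  have sub: "cball (\<phi> p) r \<inter> model M \<subseteq> \<phi> ` U" using r by auto
  note f = chart_supported[OF c pU r(1) sub b(1,3)]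
  show ?thesis
  proof (rule that[OF f(1)])
    show "\<forall>\<^sub>F q in nbM p. (if q \<in> U then b (\<phi> q) else 0) = 1"
      using chart_eventually[OF c pU open_ball[of "\<phi> p" "r/2"]] r(1)
      by (auto elim!: eventually_mono simp: b(2))
    fix q assume "q \<in> pts M"
    show "(\<forall>\<^sub>F q' in nbM q. (if q' \<in> U then b (\<phi> q') else 0) = 0) \<or> eventually P (nbM q)"
      using f(2)[of q] r(2) by blast
  qed
qed

lemma bump_point:
  assumes p: "p \<in> pts M" and P: "eventually P (nbM p)"
  obtains \<theta> where "\<theta> \<in> Cinf M" "\<forall>\<^sub>F q in nbM p. \<theta> q = 1" "\<theta> p = 1" "\<forall>q. \<theta> q = 0 \<or> P q"
proof -
  obtain \<theta> where th: "\<theta> \<in> Cinf M" "\<forall>\<^sub>F q in nbM p. \<theta> q = 1"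
    "\<And>q. q \<in> pts M \<Longrightarrow> (\<forall>\<^sub>F q' in nbM q. \<theta> q' = 0) \<or> eventually P (nbM q)"
    using bump[OF p P] by blast
  have "\<theta> q = 0 \<or> P q" for q
    using th(3)[of q] eventually_nb_self[of _ q "pts M"] Cinf_outside[OF th(1), of q] by blast
  then show ?thesis using that th(1,2) eventually_nb_self[OF th(2) p] by blast
qed

lemma chart_fun:
  assumes c: "(U, \<phi>) \<in> smooth_charts M" and p: "p \<in> U" and W: "open W" "\<phi> p \<in> W" and G: "Cinfty_on W G"
  obtains g where "g \<in> Cinf M" "\<forall>\<^sub>F q in nbM p. g q = G (\<phi> q)"
proof -
  obtain r1 where r1: "r1 > 0" "\<And>y. y \<in> cball (\<phi> p) r1 \<Longrightarrow> y \<in> model M \<Longrightarrow> y \<in> \<phi> ` U \<and> True"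
    using chart_pull[OF c p, of "\<lambda>_. True"] by auto
  obtain r2 where r2: "r2 > 0" "cball (\<phi> p) r2 \<subseteq> W"
    using W open_contains_cball by blast
  define r where "r = min r1 r2"
  have r: "r > 0" "cball (\<phi> p) r \<inter> model M \<subseteq> \<phi> ` U" "cball (\<phi> p) r \<subseteq> W"
    using r1 r2 by (auto simp: r_def)
  obtain b where b: "Cinfty_on UNIV b" "\<And>x. x \<in> ball (\<phi> p) (r/2) \<Longrightarrow> b x = 1"
    "\<And>x. x \<notin> ball (\<phi> p) r \<Longrightarrow> b x = (0::real)"
    using Cinfty_bump[OF r(1)] by blast
  \<comment> \<open>G is smooth on W only, so it is cut off before being transported by the chart.
    As the closed ball of radius r lies in W, H is smooth on the whole Euclidean space.\<close>
  define H where "H y = b y * (if y \<in> W then G y else 0)" for y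
  have H: "Ck_on k UNIV H" for k
  proof (rule Ck_on_local)
    fix x
    show "\<exists>V. open V \<and> x \<in> V \<and> Ck_on k V H"
    proof (cases "x \<in> W")
      case True
      have "Ck_on k W (\<lambda>y. b y * G y)"
        using Ck_on_mult[OF W(1) Ck_on_subset[OF b(1)[rule_format]] G[rule_format]] by simp
      then have "Ck_on k W H" by (rule Ck_on_cong[OF W(1), rotated]) (simp add: H_def)
      then show ?thesis using W True by blast
    next
      case False
      have "Ck_on k (- cball (\<phi> p) r) H"
        by (rule Ck_on_cong[OF _ _ Ck_on_const[of _ _ 0]]) (use b(3) in \<open>auto simp: H_def\<close>)
      moreover have "x \<in> - cball (\<phi> p) r" "open (- cball (\<phi> p) r)" using False r by auto
      ultimately show ?thesis by blast
    qed
  qed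
  have H0: "H y = 0" if "y \<notin> ball (\<phi> p) r" for y using b(3)[OF that] by (simp add: H_def)
  show ?thesis
  proof (rule that[OF chart_supported(1)[OF c p r(1,2) allI[OF H] H0]])
    have "\<phi> p \<in> ball (\<phi> p) (r/2) \<inter> W" using r W by simp
    from chart_eventually[OF c p open_Int[OF open_ball W(1)] this]
    show "\<forall>\<^sub>F q in nbM p. (if q \<in> U then H (\<phi> q) else 0) = G (\<phi> q)"
      by eventually_elim (auto simp: H_def b(2))
  qed
qed

subsection \<open>Tangent vectors\<close>

lemma tangent_add: "v \<in> tangent M p \<Longrightarrow> f \<in> Cinf M \<Longrightarrow> g \<in> Cinf M \<Longrightarrow> v (f + g) = v f + v g"
  and tangent_scale: "v \<in> tangent M p \<Longrightarrow> f \<in> Cinf M \<Longrightarrow> v (\<lambda>x. c * f x) = c * v f"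
  and tangent_mult: "v \<in> tangent M p \<Longrightarrow> f \<in> Cinf M \<Longrightarrow> g \<in> Cinf M \<Longrightarrow> v (f * g) = f p * v g + g p * v f"
  and tangent_outside: "v \<in> tangent M p \<Longrightarrow> f \<notin> Cinf M \<Longrightarrow> v f = 0"
  by (auto simp: tangent_def)

lemma tangent_zero: "v \<in> tangent M p \<Longrightarrow> v 0 = 0"
  using tangent_scale[of v p 0 0] Cinf_zero by (simp add: zero_fun_def)

lemma tangent_uminus: "v \<in> tangent M p \<Longrightarrow> f \<in> Cinf M \<Longrightarrow> v (- f) = - v f"
  using tangent_scale[of v p f "-1"] by (simp add: fun_Compl_def)

lemma tangent_diff: "v \<in> tangent M p \<Longrightarrow> f \<in> Cinf M \<Longrightarrow> g \<in> Cinf M \<Longrightarrow> v (f - g) = v f - v g"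
  using tangent_add[of v p f "- g"] tangent_uminus[of v p g] Cinf_uminus[of g] by simp

lemma tangent_sum: "v \<in> tangent M p \<Longrightarrow> (\<And>i. i \<in> I \<Longrightarrow> f i \<in> Cinf M) \<Longrightarrow> v (\<Sum>i\<in>I. f i) = (\<Sum>i\<in>I. v (f i))"
  by (induction I rule: infinite_finite_induct) (auto simp: tangent_zero tangent_add Cinf_sum)

text \<open>With a cut-off equal to 1 at p, the function \<theta> (f - g) is identically zero, and
  the Leibniz rule at p returns v f - v g.\<close>

lemma tangent_local:
  assumes v: "v \<in> tangent M p" and p: "p \<in> pts M" and f: "f \<in> Cinf M" and g: "g \<in> Cinf M"
    and ev: "\<forall>\<^sub>F q in nbM p. f q = g q"
  shows "v f = v g"
proof -
  obtain \<theta> where chi: "\<theta> \<in> Cinf M" "\<theta> p = 1" "\<forall>q. \<theta> q = 0 \<or> f q = g q"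
    using bump_point[OF p ev] by blast
  have "\<theta> q * (f - g) q = 0" for q using spec[OF chi(3), of q] by auto
  then have "\<theta> * (f - g) = 0" by (simp add: fun_eq_iff)
  then have "0 = v (\<theta> * (f - g))" using tangent_zero[OF v] by simp
  also have "\<dots> = \<theta> p * v (f - g) + (f - g) p * v \<theta>"
    using tangent_mult[OF v chi(1) Cinf_diff[OF f g]] .
  also have "\<dots> = v f - v g"
    using chi(2) eventually_nb_self[OF ev p] tangent_diff[OF v f g] by simp
  finally show ?thesis by simp
qed

lemma tangent_const:
  assumes v: "v \<in> tangent M p" and p: "p \<in> pts M" and f: "f \<in> Cinf M"
    and ev: "\<forall>\<^sub>F q in nbM p. f q = c"
  shows "v f = 0"
proof -
  have "one * one = one" by (auto simp: one_def fun_eq_iff)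
  then have "v one = v one + v one"
    using tangent_mult[OF v Cinf_one Cinf_one] p by simp
  then have 0: "v one = 0" by simp
  have "\<forall>\<^sub>F q in nbM p. f q = c * one q"
    using ev eventually_nb_in by eventually_elim simp
  then have "v f = v (\<lambda>x. c * one x)" by (rule tangent_local[OF v p f Cinf_scale[OF Cinf_one]])
  then show ?thesis using tangent_scale[OF v Cinf_one] 0 by simp
qed

lemma tangent_plus: "v \<in> tangent M p \<Longrightarrow> w \<in> tangent M p \<Longrightarrow> v + w \<in> tangent M p"
  by (auto simp: tangent_def algebra_simps)

lemma tangent_smult: "v \<in> tangent M p \<Longrightarrow> (\<lambda>f. c * v f) \<in> tangent M p"
  by (auto simp: tangent_def algebra_simps)

lemma zero_tangent: "0 \<in> tangent M p"
  by (auto simp: tangent_def)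

lemma tangent_minus: "v \<in> tangent M p \<Longrightarrow> w \<in> tangent M p \<Longrightarrow> v - w \<in> tangent M p"
  using tangent_plus[of v p "\<lambda>f. (-1) * w f"] tangent_smult[of w p "-1"]
  by (simp add: fun_diff_def plus_fun_def)

lemma tangent_sums: "(\<And>i. i \<in> I \<Longrightarrow> v i \<in> tangent M p) \<Longrightarrow> (\<Sum>i\<in>I. v i) \<in> tangent M p"
  by (induction I rule: infinite_finite_induct) (auto simp: zero_tangent tangent_plus)

text \<open>\<open>tangent\<close> is not restricted to points of M. Elsewhere all functions vanish
  at p, and writing f as \<open>one * f\<close> makes the Leibniz rule return 0.\<close>

lemma tangent_off: assumes "p \<notin> pts M" "v \<in> tangent M p" shows "v = 0"
proof
  fix f
  show "v f = 0 f"
  proof (cases "f \<in> Cinf M")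
    case True
    have "one * f = f" using True by (auto simp: one_def fun_eq_iff Cinf_outside)
    then show ?thesis using tangent_mult[OF assms(2) Cinf_one True] assms(1) Cinf_outside[OF True] by simp
  qed (use tangent_outside[OF assms(2)] in simp)
qed

section \<open>Derivations at a point as coordinate vectors\<close>

lemma coord_vec_eq:
  assumes c: "(U, \<phi>) \<in> smooth_charts M" and q: "q \<in> U" and w: "w \<in> model M" and f: "f \<in> Cinf M"
    and W: "open W" "\<phi> q \<in> W" and G: "Cinfty_on W G" and ev: "\<forall>\<^sub>F q' in nbM q. f q' = G (\<phi> q')"
  shows "coord_vec M (U, \<phi>) q w f = frechet_derivative G (at (\<phi> q)) w"
proof -
  let ?c = "\<lambda>t. \<phi> q + t *\<^sub>R w"
  obtain r where r: "r > 0" "\<And>y. y \<in> cball (\<phi> q) r \<Longrightarrow> y \<in> model M \<Longrightarrow>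
      y \<in> \<phi> ` U \<and> f (inv_into U \<phi> y) = G (\<phi> (inv_into U \<phi> y))"
    using chart_pull[OF c q ev] by blast
  \<comment> \<open>The model is a subspace, so the coordinate line does not leave it and can be
    pulled back to M for small t.\<close>
  have cm: "?c t \<in> model M" for t
    using subspace_model w q chart_model[OF c] by (auto intro: subspace_add subspace_scale)
  have "\<forall>\<^sub>F t in nhds 0. ?c t \<in> ball (\<phi> q) r"
  proof -
    have "(?c \<longlongrightarrow> ?c 0) (nhds 0)"
      by (intro tendsto_add tendsto_const tendsto_scaleR filterlim_ident)
    then show ?thesis using r(1) by (intro topological_tendstoD) auto
  qed
  then have ev2: "\<forall>\<^sub>F t in nhds 0. f (inv_into U \<phi> (?c t)) = G (?c t)"
  proof eventually_elim
    case (elim t)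
    then show ?case using r(2)[of "?c t"] cm f_inv_into_f[of "?c t" \<phi> U] by auto
  qed
  have "(?c has_derivative (\<lambda>h. h *\<^sub>R w)) (at 0)" by (auto intro!: derivative_eq_intros)
  moreover have D: "(G has_derivative frechet_derivative G (at (\<phi> q))) (at (?c 0))"
    using Cinfty_on_diff[OF G W(2)] by simp
  ultimately have "((\<lambda>t. G (?c t)) has_derivative (\<lambda>h. frechet_derivative G (at (\<phi> q)) (h *\<^sub>R w))) (at 0)"
    by (rule has_derivative_compose)
  then have "((\<lambda>t. G (?c t)) has_real_derivative frechet_derivative G (at (\<phi> q)) w) (at 0)"
    using linear_cmul[OF has_derivative_linear[OF D]]
    by (simp add: has_field_derivative_def mult.commute[of _ "frechet_derivative G (at (\<phi> q)) w"])
  then have "((\<lambda>t. f (inv_into U \<phi> (?c t))) has_real_derivative frechet_derivative G (at (\<phi> q)) w) (at 0)"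
    using DERIV_cong_ev[OF refl ev2 refl] by simp
  then show ?thesis using f by (simp add: coord_vec_def DERIV_imp_deriv)
qed

lemma coord_vec_linear_fun:
  assumes c: "(U, \<phi>) \<in> smooth_charts M" and q: "q \<in> U" and w: "w \<in> model M" and x: "x \<in> Cinf M"
    and ev: "\<forall>\<^sub>F q' in nbM q. x q' = \<phi> q' \<bullet> z"
  shows "coord_vec M (U, \<phi>) q w x = w \<bullet> z"
proof -
  have "((\<lambda>y. y \<bullet> z) has_derivative (\<lambda>h. h \<bullet> z)) (at (\<phi> q))"
    by (auto intro!: derivative_eq_intros)
  then have "frechet_derivative (\<lambda>y. y \<bullet> z) (at (\<phi> q)) = (\<lambda>h. h \<bullet> z)"
    using frechet_derivative_at by metis
  moreover have "Cinfty_on UNIV (\<lambda>y. y \<bullet> z)"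
    by (auto intro!: Ck_on_inner Ck_on_ident Ck_on_const)
  ultimately show ?thesis using coord_vec_eq[OF c q w x open_UNIV UNIV_I _ ev] by simp
qed

lemma coord_vec_outside: "f \<notin> Cinf M \<Longrightarrow> coord_vec M c q w f = 0"
  by (cases c) (simp add: coord_vec_def)

lemma coord_vec_tangent:
  assumes c: "(U, \<phi>) \<in> smooth_charts M" and q: "q \<in> U" and w: "w \<in> model M"
  shows "coord_vec M (U, \<phi>) q w \<in> tangent M q"
proof -
  note eq = coord_vec_eq[OF c q w]
  have qM: "q \<in> pts M" using chart_sub[OF c] q by auto
  have *: "coord_vec M (U, \<phi>) q w (f + g) = coord_vec M (U, \<phi>) q w f + coord_vec M (U, \<phi>) q w g \<and>
    coord_vec M (U, \<phi>) q w (f * g) = f q * coord_vec M (U, \<phi>) q w g + g q * coord_vec M (U, \<phi>) q w f"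
    if f: "f \<in> Cinf M" and g: "g \<in> Cinf M" for f g
  proof -
    obtain W F where W: "open W" "\<phi> q \<in> W" "Cinfty_on W F" "\<forall>\<^sub>F q' in nbM q. f q' = F (\<phi> q')"
      using Cinf_chart[OF f c q] .
    obtain V G where V: "open V" "\<phi> q \<in> V" "Cinfty_on V G" "\<forall>\<^sub>F q' in nbM q. g q' = G (\<phi> q')"
      using Cinf_chart[OF g c q] .
    have o: "open (W \<inter> V)" "\<phi> q \<in> W \<inter> V" using W V by auto
    have F': "Cinfty_on (W \<inter> V) F" and G': "Cinfty_on (W \<inter> V) G"
      using W V by (auto intro: Ck_on_subset)
    note DF = Cinfty_on_diff[OF W(3,2)] and DG = Cinfty_on_diff[OF V(3,2)]
    have 1: "Cinfty_on (W \<inter> V) (\<lambda>y. F y + G y)" "Cinfty_on (W \<inter> V) (\<lambda>y. F y * G y)"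
      using F' G' o by (auto intro!: Ck_on_add Ck_on_mult)
    have "\<forall>\<^sub>F q' in nbM q. (f + g) q' = F (\<phi> q') + G (\<phi> q')" using W(4) V(4) by eventually_elim simp
    note 2 = eq[OF Cinf_add[OF f g] o 1(1) this]
    have "\<forall>\<^sub>F q' in nbM q. (f * g) q' = F (\<phi> q') * G (\<phi> q')" using W(4) V(4) by eventually_elim simp
    note 3 = eq[OF Cinf_mult[OF f g] o 1(2) this]
    have "f q = F (\<phi> q)" "g q = G (\<phi> q)"
      using eventually_nb_self[OF W(4) qM] eventually_nb_self[OF V(4) qM] by auto
    then show ?thesis
      using 2 3 eq[OF f W] eq[OF g V] frechet_derivative_at[OF has_derivative_add[OF DF DG], symmetric]
         frechet_derivative_at[OF has_derivative_mult[OF DF DG], symmetric]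
      by (simp add: plus_fun_def times_fun_def mult.commute)
  qed
  have "coord_vec M (U, \<phi>) q w (\<lambda>x. k * f x) = k * coord_vec M (U, \<phi>) q w f" if f: "f \<in> Cinf M" for f k
  proof -
    obtain W F where W: "open W" "\<phi> q \<in> W" "Cinfty_on W F" "\<forall>\<^sub>F q' in nbM q. f q' = F (\<phi> q')"
      using Cinf_chart[OF f c q] .
    have 1: "Cinfty_on W (\<lambda>y. k * F y)" using W by (auto intro!: Ck_on_mult Ck_on_const)
    have "\<forall>\<^sub>F q' in nbM q. k * f q' = k * F (\<phi> q')" using W(4) by eventually_elim simp
    from eq[OF Cinf_scale[OF f] W(1,2) 1 this] eq[OF f W]
    show ?thesis
      using frechet_derivative_at[OF has_derivative_mult_right[OF Cinfty_on_diff[OF W(3,2)]], symmetric]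
      by simp
  qed
  then show ?thesis using * coord_vec_outside by (auto simp: tangent_def)
qed

lemma coord_vec_sum:
  assumes c: "(U, \<phi>) \<in> smooth_charts M" and q: "q \<in> U" and w: "\<And>i. i \<in> I \<Longrightarrow> w i \<in> model M"
  shows "coord_vec M (U, \<phi>) q (\<Sum>i\<in>I. a i *\<^sub>R w i) f = (\<Sum>i\<in>I. a i * coord_vec M (U, \<phi>) q (w i) f)"
proof (cases "f \<in> Cinf M")
  case True
  obtain W F where W: "open W" "\<phi> q \<in> W" "Cinfty_on W F" "\<forall>\<^sub>F q' in nbM q. f q' = F (\<phi> q')"
    using Cinf_chart[OF True c q] .
  have lin: "linear (frechet_derivative F (at (\<phi> q)))"
    using has_derivative_linear[OF Cinfty_on_diff[OF W(3,2)]] .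
  have m: "(\<Sum>i\<in>I. a i *\<^sub>R w i) \<in> model M"
    using subspace_model w by (intro subspace_sum subspace_scale) auto
  show ?thesis
    unfolding coord_vec_eq[OF c q m True W]
    by (simp add: linear_sum[OF lin] linear_cmul[OF lin] coord_vec_eq[OF c q w True W])
qed (simp add: coord_vec_outside)

text \<open>Hadamard's lemma writes a function near p as a constant plus a sum of products x_b g_b
  with x_b(p) = 0, and a derivation sees only v(x_b) and g_b(p).\<close>

lemma tangent_coord:
  assumes c: "(U, \<phi>) \<in> smooth_charts M" and p: "p \<in> U" and v: "v \<in> tangent M p"
  obtains u where "u \<in> model M" "v = coord_vec M (U, \<phi>) p u"
proof -
  have pM: "p \<in> pts M" using chart_sub[OF c] p by auto
  have lin: "Cinfty_on UNIV (\<lambda>y. (y - \<phi> p) \<bullet> b)" for b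
    by (auto intro!: Ck_on_inner Ck_on_diff Ck_on_ident Ck_on_const)
  have "\<exists>x. x \<in> Cinf M \<and> (\<forall>\<^sub>F q in nbM p. x q = (\<phi> q - \<phi> p) \<bullet> b)" for b
    using chart_fun[OF c p open_UNIV _ lin] by auto
  then obtain x where x: "\<And>b. x b \<in> Cinf M" "\<And>b. \<forall>\<^sub>F q in nbM p. x b q = (\<phi> q - \<phi> p) \<bullet> b"
    by metis
  have x0: "x b p = 0" for b using eventually_nb_self[OF x(2) pM] by simp
  define u where "u = (\<Sum>b\<in>Basis. v (x b) *\<^sub>R b)"
  \<comment> \<open>The index b runs over a basis of the whole Euclidean space, so membership in the
    model has to be proved: if y is orthogonal to the model, the corresponding linear function is
    constant on the chart, v kills it, and u is orthogonal to y.\<close>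
  have um: "u \<in> model M"
  proof -
    have "u \<bullet> y = 0" if y: "\<And>z. z \<in> model M \<Longrightarrow> orthogonal z y" for y
    proof -
      have "u \<bullet> y = v (\<Sum>b\<in>Basis. (\<lambda>q. (b \<bullet> y) * x b q))"
        by (subst tangent_sum[OF v])
           (auto intro!: Cinf_scale x simp: u_def inner_sum_left tangent_scale[OF v x(1)] mult.commute)
      also have "\<dots> = 0"
      proof (rule tangent_const[OF v pM])
        show "(\<Sum>b\<in>Basis. (\<lambda>q. (b \<bullet> y) * x b q)) \<in> Cinf M" by (intro Cinf_sum Cinf_scale x)
        have "\<forall>\<^sub>F q in nbM p. \<forall>b\<in>Basis. x b q = (\<phi> q - \<phi> p) \<bullet> b"
          using x(2) by (simp add: eventually_ball_finite_distrib)
        then show "\<forall>\<^sub>F q in nbM p. (\<Sum>b\<in>Basis. (\<lambda>q. (b \<bullet> y) * x b q)) q = 0"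
          using chart_eventually_in[OF c p]
        proof eventually_elim
          case (elim q)
          have "\<phi> q - \<phi> p \<in> model M"
            using chart_model[OF c] elim p subspace_model by (auto intro: subspace_diff)
          then have "(\<phi> q - \<phi> p) \<bullet> y = 0" using y by (auto simp: orthogonal_def)
          then show ?case using elim
            by (simp add: sum_fun_apply) (subst (asm) euclidean_inner, simp add: mult.commute inner_commute)
        qed
      qed
      finally show ?thesis .
    qed
    moreover obtain y z where yz: "y \<in> span (model M)" "\<And>w. w \<in> span (model M) \<Longrightarrow> orthogonal z w" "u = y + z"
      using orthogonal_subspace_decomp_exists[of "model M" u] by metis
    ultimately have "u \<bullet> z = 0" by (simp add: orthogonal_commute span_base)
    moreover have "y \<bullet> z = 0" using yz by (auto simp: orthogonal_def inner_commute)
    ultimately have "z = 0" using yz(3) by (simp add: inner_add_left)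
    then show ?thesis using yz subspace_model by (simp add: span_eq_iff[THEN iffD2])
  qed
  have "v f = coord_vec M (U, \<phi>) p u f" for f
  proof (cases "f \<in> Cinf M")
    case f: True
    obtain W F where W: "open W" "\<phi> p \<in> W" "Cinfty_on W F" "\<forall>\<^sub>F q in nbM p. f q = F (\<phi> q)"
      using Cinf_chart[OF f c p] .
    obtain r where r: "r > 0" "ball (\<phi> p) r \<subseteq> W" using W open_contains_ball by blast
    have FB: "Cinfty_on (ball (\<phi> p) r) F" using W(3) r(2) by (auto intro: Ck_on_subset)
    obtain G where G: "\<And>b. Cinfty_on (ball (\<phi> p) r) (G b)"
      "\<And>y. y \<in> ball (\<phi> p) r \<Longrightarrow> F y = F (\<phi> p) + (\<Sum>b\<in>Basis. ((y - \<phi> p) \<bullet> b) * G b y)"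
      "\<And>b. G b (\<phi> p) = frechet_derivative F (at (\<phi> p)) b"
      using Hadamard[OF FB r(1)] by blast
    have pb: "\<phi> p \<in> ball (\<phi> p) r" using r by simp
    have "\<exists>g. g \<in> Cinf M \<and> (\<forall>\<^sub>F q in nbM p. g q = G b (\<phi> q))" for b
      using chart_fun[OF c p open_ball pb G(1)] by metis
    then obtain g where g: "\<And>b. g b \<in> Cinf M" "\<And>b. \<forall>\<^sub>F q in nbM p. g b q = G b (\<phi> q)"
      by metis
    have gp: "g b p = frechet_derivative F (at (\<phi> p)) b" for b
      using eventually_nb_self[OF g(2) pM] G(3) by simp
    let ?s = "\<Sum>b\<in>Basis. x b * g b"
    have s: "?s \<in> Cinf M" by (intro Cinf_sum Cinf_mult x g)
    have "v (f - ?s) = 0"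
    proof (rule tangent_const[OF v pM Cinf_diff[OF f s]])
      have "\<forall>\<^sub>F q in nbM p. \<forall>b\<in>Basis. x b q = (\<phi> q - \<phi> p) \<bullet> b \<and> g b q = G b (\<phi> q)"
        using x(2) g(2) by (simp add: eventually_ball_finite_distrib eventually_conj_iff)
      then show "\<forall>\<^sub>F q in nbM p. (f - ?s) q = F (\<phi> p)"
        using chart_eventually[OF c p open_ball pb] W(4)
        by eventually_elim (use G(2) in \<open>auto simp: sum_fun_apply\<close>)
    qed
    then have "v f = v ?s" using tangent_diff[OF v f s] by simp
    also have "\<dots> = (\<Sum>b\<in>Basis. frechet_derivative F (at (\<phi> p)) b * v (x b))"
      by (subst tangent_sum[OF v]) (auto intro!: Cinf_mult x g simp: tangent_mult[OF v x(1) g(1)] x0 gp)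
    also have "\<dots> = frechet_derivative F (at (\<phi> p)) u"
    proof -
      have lin: "linear (frechet_derivative F (at (\<phi> p)))"
        using has_derivative_linear[OF Cinfty_on_diff[OF W(3,2)]] .
      show ?thesis by (simp add: u_def linear_sum[OF lin] linear_cmul[OF lin] mult.commute)
    qed
    also have "\<dots> = coord_vec M (U, \<phi>) p u f" using coord_vec_eq[OF c p um f W] by simp
    finally show ?thesis .
  qed (use tangent_outside[OF v] coord_vec_outside in simp)
  then show ?thesis using that um by blast
qed

text \<open>Functions and vector fields that are globally defined but act as dual coordinates and
  coordinate fields only near p. All later reductions to exact forms rest on this expansion.\<close>

lemma frame:
  assumes p: "p \<in> pts M"
  obtains B x X where "finite (B::'e set)" "\<And>b. b \<in> B \<Longrightarrow> x b \<in> Cinf M" "\<And>b. b \<in> B \<Longrightarrow> X b \<in> vector_fields M"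
    "\<forall>\<^sub>F q in nbM p. \<forall>v\<in>tangent M q. v = (\<lambda>f. \<Sum>b\<in>B. v (x b) * X b q f)"
proof -
  obtain U \<phi> where U: "(U, \<phi>) \<in> atlas M" and pU: "p \<in> U" using atlas_cover[OF p] .
  note c = atlas_charts[OF U]
  obtain B where fin: "finite B" and B: "B \<subseteq> model M"
      "\<And>u. u \<in> model M \<Longrightarrow> u = (\<Sum>b\<in>B. (u \<bullet> b) *\<^sub>R b)"
    using orthonormal_expansion[OF subspace_model] by metis
  have lin: "Cinfty_on UNIV (\<lambda>y. y \<bullet> b)" for b
    by (auto intro!: Ck_on_inner Ck_on_ident Ck_on_const)
  have "\<exists>x. x \<in> Cinf M \<and> (\<forall>\<^sub>F q in nbM p. x q = \<phi> q \<bullet> b)" for b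
    using chart_fun[OF c pU open_UNIV _ lin] by auto
  then obtain x where x: "\<And>b. x b \<in> Cinf M" "\<And>b. \<forall>\<^sub>F q in nbM p. x b q = \<phi> q \<bullet> b"
    by metis
  obtain \<theta> where chi: "\<theta> \<in> Cinf M" "\<forall>\<^sub>F q in nbM p. \<theta> q = 1"
    "\<And>q. q \<in> pts M \<Longrightarrow> (\<forall>\<^sub>F q' in nbM q. \<theta> q' = 0) \<or> (\<forall>\<^sub>F q' in nbM q. q' \<in> U)"
    using bump[OF p chart_eventually_in[OF c pU]] by blast
  \<comment> \<open>Coordinate fields times a cut-off: zero outside the chart, and the coordinate
    fields themselves where \<theta> = 1.\<close>
  define X where "X b q = (\<lambda>f. if q \<in> U then \<theta> q * coord_vec M (U, \<phi>) q b f else 0)" for b q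
  have XV: "X b \<in> vector_fields M" if b: "b \<in> B" for b
    unfolding vector_fields_def mem_Collect_eq
  proof (intro conjI ballI allI impI)
    have bm: "b \<in> model M" using B b by auto
    fix q assume q: "q \<in> pts M"
    show "X b q \<in> tangent M q"
    proof (cases "q \<in> U")
      case True
      then show ?thesis using tangent_smult[OF coord_vec_tangent[OF c True bm], of "\<theta> q"] by (simp add: X_def)
    next
      case False then show ?thesis using zero_tangent by (simp add: X_def zero_fun_def)
    qed
  next
    fix q assume q: "q \<notin> pts M"
    then show "X b q = 0" using chart_sub[OF c] by (auto simp: X_def fun_eq_iff)
  next
    have bm: "b \<in> model M" using B b by auto
    fix f assume f: "f \<in> Cinf M"
    show "act (X b) f \<in> Cinf M"
    proof (rule Cinf_local)
      fix q assume "q \<notin> pts M"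
      then show "act (X b) f q = 0" using chart_sub[OF c] by (auto simp: X_def act_def)
    next
      fix q assume q: "q \<in> pts M"
      from chi(3)[OF q] show "\<exists>g\<in>Cinf M. \<forall>\<^sub>F q' in nbM q. act (X b) f q' = g q'"
      proof
        assume 0: "\<forall>\<^sub>F q' in nbM q. \<theta> q' = 0"
        have "\<forall>\<^sub>F q' in nbM q. act (X b) f q' = 0 q'"
          using 0 by eventually_elim (simp add: act_def X_def)
        then show ?thesis using Cinf_zero by blast
      next
        assume U: "\<forall>\<^sub>F q' in nbM q. q' \<in> U"
        then have qU: "q \<in> U" using eventually_nb_self q by blast
        obtain W F where W: "open W" "\<phi> q \<in> W" "Cinfty_on W F" "\<forall>\<^sub>F q' in nbM q. f q' = F (\<phi> q')"
          using Cinf_chart[OF f c qU] .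
        obtain g where g: "g \<in> Cinf M" "\<forall>\<^sub>F q' in nbM q. g q' = frechet_derivative F (at (\<phi> q')) b"
          using chart_fun[OF c qU W(1,2) Ck_on_frechet[OF W(3)], of b] by blast
        have "\<forall>\<^sub>F q' in nbM q. act (X b) f q' = (\<theta> * g) q'"
          using chart_eventually[OF c qU W(1,2)] eventually_nb_nb[OF W(4)] g(2)
          by eventually_elim (use coord_vec_eq[OF c _ bm f W(1) _ W(3)] in \<open>auto simp: act_def X_def\<close>)
        then show ?thesis using Cinf_mult[OF chi(1) g(1)] by blast
      qed
    qed
  qed
  have "\<forall>\<^sub>F q in nbM p. \<forall>b\<in>B. \<forall>\<^sub>F q' in nbM q. x b q' = \<phi> q' \<bullet> b"
    using fin eventually_nb_nb[OF x(2)] by (simp add: eventually_ball_finite_distrib)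
  then have "\<forall>\<^sub>F q in nbM p. \<forall>v\<in>tangent M q. v = (\<lambda>f. \<Sum>b\<in>B. v (x b) * X b q f)"
    using chart_eventually_in[OF c pU] chi(2)
  proof eventually_elim
    case (elim q)
    show ?case
    proof
      fix v assume "v \<in> tangent M q"
      then obtain u where u: "u \<in> model M" "v = coord_vec M (U, \<phi>) q u"
        using tangent_coord[OF c elim(2)] by blast
      have vx: "v (x b) = u \<bullet> b" if "b \<in> B" for b
        using coord_vec_linear_fun[OF c elim(2) u(1) x(1) elim(1)[rule_format, OF that]] u(2) by simp
      have "v f = (\<Sum>b\<in>B. (u \<bullet> b) * coord_vec M (U, \<phi>) q b f)" for f
        using coord_vec_sum[OF c elim(2), of B "\<lambda>b. b" "\<lambda>b. u \<bullet> b" f] B(1) B(2)[OF u(1)] u(2)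
        by (simp add: subset_iff)
      then show "v = (\<lambda>f. \<Sum>b\<in>B. v (x b) * X b q f)"
        using elim vx by (simp add: fun_eq_iff X_def)
    qed
  qed
  then show ?thesis by (intro that[of B x X] fin x(1) XV)
qed

end

section \<open>Embedded submanifolds\<close>

locale submanifold = M: manifold M + N: manifold N
  for M N :: "('m::{t2_space,second_countable_topology}, 'e::euclidean_space) mfd" +
  assumes emb: "embedded_submanifold N M"
begin

abbreviation nbM :: "'m \<Rightarrow> 'm filter" where "nbM p \<equiv> nb (pts M) p"
abbreviation nbN :: "'m \<Rightarrow> 'm filter" where "nbN p \<equiv> nb (pts N) p"

lemma pts_sub: "pts N \<subseteq> pts M" and model_sub: "model N \<subseteq> model M"
  using emb by (auto simp: embedded_submanifold_def)

lemma nbM_nbN: "eventually P (nbM p) \<Longrightarrow> eventually P (nbN p)"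
  using eventually_nb_mono pts_sub by blast

lemma slice:
  assumes "p \<in> pts N"
  obtains U \<phi> where "(U, \<phi>) \<in> slice_charts N M" "(U, \<phi>) \<in> smooth_charts M" "p \<in> U"
    "(U \<inter> pts N, \<phi>) \<in> smooth_charts N"
proof -
  have "\<exists>(U, \<phi>)\<in>slice_charts N M. p \<in> U \<and> (U \<inter> pts N, \<phi>) \<in> smooth_charts N"
    using emb assms by (simp add: embedded_submanifold_def)
  then show ?thesis using that by (auto simp: slice_charts_def)
qed

lemma restr_simps [simp]: "p \<in> pts N \<Longrightarrow> restr N f p = f p" "p \<notin> pts N \<Longrightarrow> restr N f p = 0"
  by (auto simp: restr_def)

lemma restr_add: "restr N (f + g) = restr N f + restr N g"
  and restr_mult: "restr N (f * g) = restr N f * restr N g"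
  and restr_scale: "restr N (\<lambda>x. c * f x) = (\<lambda>x. c * restr N f x)"
  by (auto simp: restr_def fun_eq_iff)

text \<open>In a slice chart the local representative of f is already smooth on an open set of the
  ambient Euclidean space; the same representative, read in the chart of M, is an extension.\<close>

lemma Cinf_extend:
  assumes f: "f \<in> Cinf N" and p: "p \<in> pts N"
  obtains F where "F \<in> Cinf M" "\<forall>\<^sub>F q in nbN p. F q = f q"
proof -
  obtain U \<phi> where c: "(U, \<phi>) \<in> smooth_charts M" "p \<in> U" "(U \<inter> pts N, \<phi>) \<in> smooth_charts N"
    using slice[OF p] by blast
  obtain W G where W: "open W" "\<phi> p \<in> W" "Cinfty_on W G" "\<forall>\<^sub>F q in nbN p. f q = G (\<phi> q)"
    by (rule N.Cinf_chart[OF f c(3)]) (use p c in auto)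
  obtain F where F: "F \<in> Cinf M" "\<forall>\<^sub>F q in nbM p. F q = G (\<phi> q)"
    using M.chart_fun[OF c(1,2) W(1,2,3)] .
  have "\<forall>\<^sub>F q in nbN p. F q = f q" using nbM_nbN[OF F(2)] W(4) by eventually_elim simp
  then show ?thesis using that F by blast
qed

lemma restr_Cinf:
  assumes f: "f \<in> Cinf M" shows "restr N f \<in> Cinf N"
proof (rule N.Cinf_local)
  fix p assume p: "p \<in> pts N"
  obtain U \<phi> where c: "(U, \<phi>) \<in> smooth_charts M" "p \<in> U" "(U \<inter> pts N, \<phi>) \<in> smooth_charts N"
    using slice[OF p] by blast
  obtain W G where W: "open W" "\<phi> p \<in> W" "Cinfty_on W G" "\<forall>\<^sub>F q in nbM p. f q = G (\<phi> q)"
    using M.Cinf_chart[OF f c(1,2)] .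
  have "p \<in> U \<inter> pts N" using p c by auto
  then obtain g where g: "g \<in> Cinf N" "\<forall>\<^sub>F q in nbN p. g q = G (\<phi> q)"
    using N.chart_fun[OF c(3) _ W(1,2,3)] by blast
  have "\<forall>\<^sub>F q in nbN p. restr N f q = g q"
    using nbM_nbN[OF W(4)] g(2) eventually_nb_in by eventually_elim simp
  then show "\<exists>g\<in>Cinf N. \<forall>\<^sub>F q in nbN p. restr N f q = g q" using g by blast
qed simp

lemma push_apply: "f \<in> Cinf M \<Longrightarrow> push M N w f = w (restr N f)"
  by (simp add: push_def)

lemma push_add: "push M N (v + w) = push M N v + push M N w"
  and push_scale: "push M N (\<lambda>f. c * v f) = (\<lambda>f. c * push M N v f)"
  and push_zero: "push M N 0 = 0"
  by (auto simp: push_def fun_eq_iff)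

lemma push_tangent:
  assumes w: "w \<in> tangent N p" and p: "p \<in> pts N"
  shows "push M N w \<in> tangent M p"
  using w p
  by (auto simp: tangent_def push_apply M.Cinf_add M.Cinf_mult M.Cinf_scale restr_add restr_mult
        restr_scale restr_Cinf) (simp add: push_def)

lemma coord_vec_push:
  assumes c: "(U, \<phi>) \<in> smooth_charts M" "(U \<inter> pts N, \<phi>) \<in> smooth_charts N"
    and q: "q \<in> U \<inter> pts N" and u: "u \<in> model N"
  shows "coord_vec M (U, \<phi>) q u = push M N (coord_vec N (U \<inter> pts N, \<phi>) q u)"
proof
  fix f
  show "coord_vec M (U, \<phi>) q u f = push M N (coord_vec N (U \<inter> pts N, \<phi>) q u) f"
  proof (cases "f \<in> Cinf M")
    case f: True
    have qU: "q \<in> U" and uM: "u \<in> model M" using q u model_sub by auto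
    obtain W G where W: "open W" "\<phi> q \<in> W" "Cinfty_on W G" "\<forall>\<^sub>F q' in nbM q. f q' = G (\<phi> q')"
      using M.Cinf_chart[OF f c(1) qU] .
    have "\<forall>\<^sub>F q' in nbN q. restr N f q' = G (\<phi> q')"
      using nbM_nbN[OF W(4)] eventually_nb_in by eventually_elim simp
    then show ?thesis
      using M.coord_vec_eq[OF c(1) qU uM f W] N.coord_vec_eq[OF c(2) q u restr_Cinf[OF f] W(1,2,3)]
      by (simp add: push_apply f)
  qed (simp add: M.coord_vec_outside push_def)
qed

text \<open>A linear function orthogonal to the model of N vanishes on the slice; the cut-off, zero
  outside U, makes it vanish on all of N, so that its differential is conormal.\<close>

lemma normal_coordinate:
  assumes c: "(U, \<phi>) \<in> smooth_charts M" "(U \<inter> pts N, \<phi>) \<in> smooth_charts N"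
    and q: "q \<in> U \<inter> pts N" and z: "\<And>u. u \<in> model N \<Longrightarrow> orthogonal z u"
  obtains x where "x \<in> Cinf M" "restr N x = 0" "\<forall>\<^sub>F q' in nbM q. x q' = \<phi> q' \<bullet> z"
proof -
  have lin: "Cinfty_on UNIV (\<lambda>y. y \<bullet> z)"
    by (auto intro!: Ck_on_inner Ck_on_ident Ck_on_const)
  have qU: "q \<in> U" using q by auto
  obtain x where x: "x \<in> Cinf M" "\<forall>\<^sub>F q' in nbM q. x q' = \<phi> q' \<bullet> z"
    using M.chart_fun[OF c(1) qU open_UNIV UNIV_I lin] .
  have ev: "\<forall>\<^sub>F q' in nbM q. q' \<in> U \<and> x q' = \<phi> q' \<bullet> z"
    using M.chart_eventually_in[OF c(1) qU] x(2) by eventually_elim simp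
  have qM: "q \<in> pts M" using q pts_sub by auto
  obtain \<theta> where th: "\<theta> \<in> Cinf M" "\<forall>\<^sub>F q' in nbM q. \<theta> q' = 1" "\<theta> q = 1"
    "\<forall>q. \<theta> q = 0 \<or> (q \<in> U \<and> x q = \<phi> q \<bullet> z)"
    using M.bump_point[OF qM ev] .
  show ?thesis
  proof (rule that[of "\<theta> * x"])
    show "\<theta> * x \<in> Cinf M" by (intro M.Cinf_mult th x)
    show "\<forall>\<^sub>F q' in nbM q. (\<theta> * x) q' = \<phi> q' \<bullet> z"
      using th(2) x(2) by eventually_elim simp
    have "(\<theta> * x) p = 0" if p: "p \<in> pts N" for p
    proof -
      have "\<phi> p \<bullet> z = 0" if "p \<in> U"
        using z[of "\<phi> p"] N.chart_model[OF c(2)] p that by (auto simp: orthogonal_def inner_commute)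
      then show ?thesis using spec[OF th(4), of p] by auto
    qed
    then show "restr N (\<theta> * x) = 0" by (auto simp: restr_def fun_eq_iff)
  qed
qed

text \<open>Tests the vector with the linear coordinate in its own direction: that coordinate is
  zero on N, whereas the vector returns z \<bullet> z.\<close>

lemma normal_coord_zero:
  assumes c: "(U, \<phi>) \<in> smooth_charts M" "(U \<inter> pts N, \<phi>) \<in> smooth_charts N"
    and q: "q \<in> U \<inter> pts N" and z: "z \<in> model M" "\<And>u. u \<in> model N \<Longrightarrow> orthogonal z u"
    and w: "w \<in> tangent N q" "coord_vec M (U, \<phi>) q z = push M N w"
  shows "z = 0"
proof -
  obtain x where x: "x \<in> Cinf M" "restr N x = 0" "\<forall>\<^sub>F q' in nbM q. x q' = \<phi> q' \<bullet> z"
    using normal_coordinate[OF c q z(2)] by blast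
  have "z \<bullet> z = coord_vec M (U, \<phi>) q z x"
    using M.coord_vec_linear_fun[OF c(1) _ z(1) x(1,3)] q by simp
  also have "\<dots> = 0" using w x N.tangent_zero by (simp add: push_apply)
  finally show ?thesis by simp
qed

lemma orthogonal_decomp:
  obtains y z where "y \<in> model N" "\<And>w. w \<in> model N \<Longrightarrow> orthogonal z w" "u = y + z"
proof -
  have "span (model N) = model N" using N.subspace_model by (simp add: span_eq_iff)
  then show ?thesis using orthogonal_subspace_decomp_exists[of "model N" u] that by metis
qed

text \<open>The codimension is locally constant, so the conormal bundle either vanishes near a point or
  has a section that does not vanish at that point.\<close>

lemma codim_cases:
  assumes p: "p \<in> pts N"
  shows "(\<forall>\<^sub>F q in nbN p. \<forall>v\<in>tangent M q. \<exists>w\<in>tangent N q. v = push M N w) \<or>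
    (\<exists>x\<in>Cinf M. restr N x = 0 \<and> (\<exists>v\<in>tangent M p. v x \<noteq> 0))"
proof (cases "model N = model M")
  case True
  obtain U \<phi> where c: "(U, \<phi>) \<in> smooth_charts M" "p \<in> U" "(U \<inter> pts N, \<phi>) \<in> smooth_charts N"
    using slice[OF p] by blast
  have "\<forall>\<^sub>F q in nbN p. \<forall>v\<in>tangent M q. \<exists>w\<in>tangent N q. v = push M N w"
    using nbM_nbN[OF M.chart_eventually_in[OF c(1,2)]] eventually_nb_in
  proof eventually_elim
    case (elim q)
    show ?case
    proof
      fix v assume "v \<in> tangent M q"
      then obtain u where u: "u \<in> model M" "v = coord_vec M (U, \<phi>) q u"
        using M.tangent_coord[OF c(1) elim(1)] by blast
      then show "\<exists>w\<in>tangent N q. v = push M N w"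
        using coord_vec_push[OF c(1,3), of q u] N.coord_vec_tangent[OF c(3), of q u] True elim by auto
    qed
  qed
  then show ?thesis ..
next
  case False
  then obtain u where u: "u \<in> model M" "u \<notin> model N" using model_sub by auto
  obtain y z where yz: "y \<in> model N" "\<And>w. w \<in> model N \<Longrightarrow> orthogonal z w" "u = y + z"
    using orthogonal_decomp by blast
  have z: "z \<in> model M" "z \<noteq> 0"
    using subspace_diff[OF M.subspace_model u(1), of y] yz u model_sub by auto
  obtain U \<phi> where c: "(U, \<phi>) \<in> smooth_charts M" "p \<in> U" "(U \<inter> pts N, \<phi>) \<in> smooth_charts N"
    using slice[OF p] by blast
  have q: "p \<in> U \<inter> pts N" using c p by auto
  obtain x where x: "x \<in> Cinf M" "restr N x = 0" "\<forall>\<^sub>F q' in nbM p. x q' = \<phi> q' \<bullet> z"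
    using normal_coordinate[OF c(1,3) q yz(2)] by blast
  have "coord_vec M (U, \<phi>) p z x \<noteq> 0"
    using M.coord_vec_linear_fun[OF c(1,2) z(1) x(1,3)] z by simp
  then show ?thesis using x M.coord_vec_tangent[OF c(1,2) z(1)] by blast
qed

definition coset :: "'m \<Rightarrow> 'm tvec \<Rightarrow> 'm tvec set" where
  "coset q v = {v + push M N w | w. w \<in> tangent N q}"

lemma coset_mem: "x \<in> coset q v \<longleftrightarrow> (\<exists>w\<in>tangent N q. x = v + push M N w)"
  by (auto simp: coset_def)

lemma normal_space_coset: "normal_space M N q = coset q ` tangent M q"
  by (auto simp: normal_space_def coset_def)

lemma zero_coset: "push M N ` tangent N q = coset q 0"
  by (auto simp: coset_def)

lemma nscale_coset: "nscale M N q t (coset q v) = coset q (\<lambda>f. t * v f)"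
proof (intro set_eqI iffI)
  fix x assume "x \<in> nscale M N q t (coset q v)"
  then obtain w w' where w: "w \<in> tangent N q" "w' \<in> tangent N q"
    "x = (\<lambda>f. t * (v + push M N w) f) + push M N w'"
    unfolding nscale_def coset_def by auto
  have "x = (\<lambda>f. t * v f) + push M N ((\<lambda>f. t * w f) + w')"
    using w by (simp add: push_add push_scale fun_eq_iff algebra_simps)
  then show "x \<in> coset q (\<lambda>f. t * v f)"
    unfolding coset_def using N.tangent_plus[OF N.tangent_smult[OF w(1)] w(2)] by blast
next
  fix x assume "x \<in> coset q (\<lambda>f. t * v f)"
  then obtain w where w: "w \<in> tangent N q" "x = (\<lambda>f. t * v f) + push M N w"
    unfolding coset_def by auto
  have "v \<in> coset q v" unfolding coset_def using N.zero_tangent push_zero by force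
  then show "x \<in> nscale M N q t (coset q v)" unfolding nscale_def using w by blast
qed

text \<open>Justifies the definite description in \<open>normal_chart\<close>. Existence subtracts
  from a representative its component along N; uniqueness is \<open>normal_coord_zero\<close> for
  the difference of two candidates.\<close>

lemma nchart_ex1:
  assumes c: "(U, \<phi>) \<in> smooth_charts M" "(U \<inter> pts N, \<phi>) \<in> smooth_charts N"
    and q: "q \<in> U \<inter> pts N" and v: "v \<in> tangent M q"
  shows "\<exists>!w. w \<in> model M \<and> (\<forall>u\<in>model N. orthogonal w u) \<and> coord_vec M (U, \<phi>) q w \<in> coset q v"
proof -
  have qU: "q \<in> U" using q by auto
  obtain u where u: "u \<in> model M" "v = coord_vec M (U, \<phi>) q u"
    using M.tangent_coord[OF c(1) qU v] .
  obtain y z where yz: "y \<in> model N" "\<And>w. w \<in> model N \<Longrightarrow> orthogonal z w" "u = y + z"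
    using orthogonal_decomp by blast
  have yM: "y \<in> model M" using yz model_sub by auto
  have z: "z \<in> model M"
    using subspace_diff[OF M.subspace_model u(1) yM] yz by simp
  \<comment> \<open>Linearity is at hand for finite sums, so a - b is read as a sum over the two
    Booleans with coefficients 1 and -1.\<close>
  have diff: "coord_vec M (U, \<phi>) q (a - b) = coord_vec M (U, \<phi>) q a - coord_vec M (U, \<phi>) q b"
    if "a \<in> model M" "b \<in> model M" for a b
    using M.coord_vec_sum[OF c(1) qU, of "{True, False}" "\<lambda>i. if i then a else b" "\<lambda>i. if i then 1 else -1"] that
    by (auto simp: fun_eq_iff)
  have "z = u - y" using yz by simp
  then have "coord_vec M (U, \<phi>) q z = v + push M N (\<lambda>f. (-1) * coord_vec N (U \<inter> pts N, \<phi>) q y f)"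
    using diff[OF u(1) yM] coord_vec_push[OF c q yz(1)] u(2)
    by (simp add: push_scale fun_eq_iff push_def)
  then have "coord_vec M (U, \<phi>) q z \<in> coset q v"
    unfolding coset_mem using N.tangent_smult[OF N.coord_vec_tangent[OF c(2) q yz(1)], of "-1"] by blast
  then have ex: "z \<in> model M \<and> (\<forall>u\<in>model N. orthogonal z u) \<and> coord_vec M (U, \<phi>) q z \<in> coset q v"
    using z yz by blast
  moreover have "a = b" if a: "a \<in> model M \<and> (\<forall>u\<in>model N. orthogonal a u) \<and> coord_vec M (U, \<phi>) q a \<in> coset q v"
    and b: "b \<in> model M \<and> (\<forall>u\<in>model N. orthogonal b u) \<and> coord_vec M (U, \<phi>) q b \<in> coset q v" for a b
  proof -
    obtain w w' where w: "w \<in> tangent N q" "coord_vec M (U, \<phi>) q a = v + push M N w"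
      "w' \<in> tangent N q" "coord_vec M (U, \<phi>) q b = v + push M N w'"
      using a b by (auto simp: coset_mem)
    have "coord_vec M (U, \<phi>) q (a - b) = push M N (w - w')"
      using diff a b w by (simp add: fun_eq_iff push_def)
    moreover have "w - w' \<in> tangent N q" using N.tangent_minus w by blast
    moreover have "a - b \<in> model M" using a b subspace_diff[OF M.subspace_model] by auto
    moreover have "orthogonal (a - b) u" if "u \<in> model N" for u
      using a b that by (simp add: orthogonal_def inner_diff_left)
    ultimately have "a - b = 0" using normal_coord_zero[OF c q] by blast
    then show ?thesis by simp
  qed
  ultimately show ?thesis by blast
qed

end

section \<open>Tubular neighbourhood maps and functions constant along their fibres\<close>

locale tubular = submanifold M N
  for M N :: "('m::{t2_space,second_countable_topology}, 'e::euclidean_space) mfd" +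
  fixes e :: "'m \<times> 'm tvec set \<Rightarrow> 'm"
  assumes tub: "tubular_map M N e"
begin

lemma tub_velocity_mem:
  assumes "q \<in> pts N" "v \<in> tangent M q"
  shows "tub_velocity M N e q (coset q v) \<in> coset q v"
proof -
  have "(q, coset q v) \<in> normal_bundle M N"
    using assms by (simp add: normal_bundle_def normal_space_coset)
  then show ?thesis using tub by (auto simp: tubular_map_def)
qed

text \<open>In the chart transported by \<open>e\<close> the fibres of the normal bundle are straight lines
  orthogonal to \<open>model N\<close>; composing with the orthogonal projection to \<open>model N\<close> therefore extends a
  function on \<open>N\<close> to a function constant along the fibres.\<close>

lemma fibre_constant_extension:
  assumes g: "g \<in> Cinf N" and p: "p \<in> pts N"
  obtains G where "G \<in> Cinf M" "\<forall>\<^sub>F q in nbN p. G q = g q"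
    "\<forall>\<^sub>F q in nbN p. \<forall>c\<in>normal_space M N q. tub_velocity M N e q c G = 0"
proof -
  obtain U \<phi> where sl: "(U, \<phi>) \<in> slice_charts N M"
    and c1: "(U, \<phi>) \<in> smooth_charts M" and pU: "p \<in> U" and c2: "(U \<inter> pts N, \<phi>) \<in> smooth_charts N"
    by (rule slice[OF p])
  note c = c1 c2
  \<comment> \<open>Domain and, next, coordinate map of the chart of M that e transports from the
    bundle chart of the normal bundle over U.\<close>
  define V where "V = e ` {x\<in>normal_bundle M N. fst x \<in> U}"
  define \<kappa> where "\<kappa> = normal_chart M N (U, \<phi>) \<circ> inv_into (normal_bundle M N) e"
  have inj: "inj_on e (normal_bundle M N)"
    and k: "(V, \<kappa>) \<in> smooth_charts M"
    and e0: "\<And>q. q \<in> pts N \<Longrightarrow> e (q, coset q 0) = q"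
    using tub sl unfolding tubular_map_def V_def \<kappa>_def zero_coset by fast+
  \<comment> \<open>The fibre coordinate of the class of v.\<close>
  define nw where "nw q v = (THE w. w \<in> model M \<and> (\<forall>u\<in>model N. orthogonal w u) \<and>
      coord_vec M (U, \<phi>) q w \<in> coset q v)" for q v
  have nw: "nw q v \<in> model M" "\<And>u. u \<in> model N \<Longrightarrow> orthogonal (nw q v) u"
    "coord_vec M (U, \<phi>) q (nw q v) \<in> coset q v"
    if "q \<in> U \<inter> pts N" "v \<in> tangent M q" for q v
    using theI'[OF nchart_ex1[OF c that]] unfolding nw_def by auto
  have nwI: "nw q v = w"
    if "q \<in> U \<inter> pts N" "v \<in> tangent M q" "w \<in> model M" "\<forall>u\<in>model N. orthogonal w u"
      "coord_vec M (U, \<phi>) q w \<in> coset q v" for q v w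
    unfolding nw_def using nchart_ex1[OF c that(1,2)] that by (intro the1_equality) auto
  have mem: "(q, coset q v) \<in> normal_bundle M N" if "q \<in> U \<inter> pts N" "v \<in> tangent M q" for q v
    using that by (simp add: normal_bundle_def normal_space_coset)
  have eV: "e (q, coset q v) \<in> V" and ke: "\<kappa> (e (q, coset q v)) = \<phi> q + nw q v"
    if "q \<in> U \<inter> pts N" "v \<in> tangent M q" for q v
  proof -
    show "e (q, coset q v) \<in> V" using mem[OF that] that by (force simp: V_def)
    show "\<kappa> (e (q, coset q v)) = \<phi> q + nw q v"
      using inv_into_f_f[OF inj mem[OF that]] by (simp add: \<kappa>_def normal_chart_def nw_def)
  qed
  have scale: "coord_vec M (U, \<phi>) q (t *\<^sub>R w) = (\<lambda>f. t * coord_vec M (U, \<phi>) q w f)"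
    if "q \<in> U" "w \<in> model M" for q w t
    using M.coord_vec_sum[OF c(1) that(1), of "{()}" "\<lambda>_. w" "\<lambda>_. t"] that(2) by (auto simp: fun_eq_iff)
  have nw_scale: "nw q (\<lambda>f. t * v f) = t *\<^sub>R nw q v"
    if q: "q \<in> U \<inter> pts N" and v: "v \<in> tangent M q" for q v t
  proof (rule nwI[OF q M.tangent_smult[OF v]])
    show "t *\<^sub>R nw q v \<in> model M" using nw(1)[OF q v] M.subspace_model by (simp add: subspace_scale)
    show "\<forall>u\<in>model N. orthogonal (t *\<^sub>R nw q v) u" using nw(2)[OF q v] by (simp add: orthogonal_def)
    obtain w where w: "w \<in> tangent N q" "coord_vec M (U, \<phi>) q (nw q v) = v + push M N w"
      using nw(3)[OF q v] by (auto simp: coset_mem)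
    have "coord_vec M (U, \<phi>) q (t *\<^sub>R nw q v) = (\<lambda>f. t * v f) + push M N (\<lambda>f. t * w f)"
      using scale[of q "nw q v" t] nw(1)[OF q v] q w(2) by (simp add: push_scale fun_eq_iff algebra_simps)
    then show "coord_vec M (U, \<phi>) q (t *\<^sub>R nw q v) \<in> coset q (\<lambda>f. t * v f)"
      unfolding coset_mem using N.tangent_smult[OF w(1)] by blast
  qed
  have nw0: "nw q 0 = 0" if q: "q \<in> U \<inter> pts N" for q
    using nw_scale[OF q M.zero_tangent, of 0] by (simp add: zero_fun_def)
  \<comment> \<open>On the zero section the fibre coordinate is 0, so the transported chart agrees
    there with the slice chart.\<close>
  have kN: "q \<in> V" "\<kappa> q = \<phi> q" if q: "q \<in> U \<inter> pts N" for q
    using eV[OF q M.zero_tangent] ke[OF q M.zero_tangent] e0[of q] nw0[OF q] q by auto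
  \<comment> \<open>The fibre coordinate is homogeneous, so the curve defining the velocity is a
    straight line in the chart \<kappa>.\<close>
  have vel: "tub_velocity M N e q (coset q v) = coord_vec M (V, \<kappa>) q (nw q v)"
    if q: "q \<in> U \<inter> pts N" and v: "v \<in> tangent M q" for q v
  proof -
    have "e (q, nscale M N q t (coset q v)) = inv_into V \<kappa> (\<kappa> q + t *\<^sub>R nw q v)" for t
    proof -
      let ?x = "e (q, coset q (\<lambda>f. t * v f))"
      have "\<kappa> ?x = \<kappa> q + t *\<^sub>R nw q v"
        using ke[OF q M.tangent_smult[OF v]] nw_scale[OF q v] kN[OF q] by simp
      then have "?x = inv_into V \<kappa> (\<kappa> q + t *\<^sub>R nw q v)"
        using M.chart_inv[OF k eV[OF q M.tangent_smult[OF v]]] by metis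
      then show ?thesis by (simp add: nscale_coset)
    qed
    then show ?thesis by (simp add: tub_velocity_def coord_vec_def fun_eq_iff)
  qed
  obtain W G0 where W: "open W" "\<phi> p \<in> W" "Cinfty_on W G0" "\<forall>\<^sub>F q in nbN p. g q = G0 (\<phi> q)"
    by (rule N.Cinf_chart[OF g c(2)]) (use p pU in auto)
  obtain B where B: "B \<subseteq> model N" "\<And>y. y \<in> model N \<Longrightarrow> y = (\<Sum>b\<in>B. (y \<bullet> b) *\<^sub>R b)"
    using orthonormal_expansion[OF N.subspace_model] by metis
  \<comment> \<open>The orthogonal projection, written so that its linearity is visible: it fixes
    the model of N and kills fibre coordinates.\<close>
  define P where "P y = (\<Sum>b\<in>B. (y \<bullet> b) *\<^sub>R b)" for y
  have PN: "P y = y" if "y \<in> model N" for y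
    unfolding P_def by (rule B(2)[OF that, symmetric])
  have P0: "P z = 0" if "\<And>u. u \<in> model N \<Longrightarrow> orthogonal z u" for z
    unfolding P_def by (rule sum.neutral) (use that B(1) in \<open>auto simp: orthogonal_def\<close>)
  have blP: "bounded_linear P" unfolding P_def
    by (intro bounded_linear_sum bounded_linear_scaleR_const bounded_linear_inner_left)
  have oW: "open (P -` W)"
    by (rule open_vimage[OF W(1) linear_continuous_on[OF blP]])
  have G1: "Cinfty_on (P -` W) (\<lambda>y. G0 (P y))"
    using Ck_on_compose[OF oW Ck_on_bounded_linear[OF oW blP Ck_on_ident[OF oW]] W(3)[rule_format]]
    by blast
  have pN: "p \<in> U \<inter> pts N" using pU p by auto
  have phiN: "\<phi> q \<in> model N" if "q \<in> U \<inter> pts N" for q using N.chart_model[OF c(2)] that by auto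
  have kp: "\<kappa> p \<in> P -` W" using kN(2)[OF pN] PN[OF phiN[OF pN]] W by simp
  obtain G where G: "G \<in> Cinf M" "\<forall>\<^sub>F q in nbM p. G q = G0 (P (\<kappa> q))"
    using M.chart_fun[OF k kN(1)[OF pN] oW kp G1] .
  have evU: "\<forall>\<^sub>F q in nbN p. q \<in> U \<inter> pts N \<and> \<phi> q \<in> W"
    using nbM_nbN[OF M.chart_eventually[OF c(1) pU W(1,2)]] eventually_nb_in by eventually_elim simp
  show ?thesis
  proof (rule that[OF G(1)])
    show "\<forall>\<^sub>F q in nbN p. G q = g q"
      using evU nbM_nbN[OF G(2)] W(4) by eventually_elim (simp add: kN PN phiN)
    show "\<forall>\<^sub>F q in nbN p. \<forall>c\<in>normal_space M N q. tub_velocity M N e q c G = 0"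
      using evU nbM_nbN[OF eventually_nb_nb[OF G(2)]]
    proof eventually_elim
      case (elim q)
      have q: "q \<in> U \<inter> pts N" using elim by auto
      have Pq: "P (\<phi> q) = \<phi> q" using PN phiN q by auto
      have kq: "\<kappa> q \<in> P -` W" using kN(2)[OF q] Pq elim by simp
      show ?case
      proof
        fix c assume "c \<in> normal_space M N q"
        then obtain v where v: "v \<in> tangent M q" "c = coset q v" by (auto simp: normal_space_coset)
        let ?w = "nw q v"
        have "tub_velocity M N e q c G = frechet_derivative (\<lambda>y. G0 (P y)) (at (\<kappa> q)) ?w"
          using vel[OF q v(1)] v(2) M.coord_vec_eq[OF k kN(1)[OF q] nw(1)[OF q v(1)] G(1) oW kq G1 elim(2)]
          by simp
        also have "\<dots> = 0"
        proof -
          have D: "(G0 has_derivative frechet_derivative G0 (at (P (\<kappa> q)))) (at (P (\<kappa> q)))"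
            using Cinfty_on_diff[OF W(3)] kq by simp
          have "((\<lambda>y. G0 (P y)) has_derivative (\<lambda>h. frechet_derivative G0 (at (P (\<kappa> q))) (P h))) (at (\<kappa> q))"
            using has_derivative_compose[OF bounded_linear_imp_has_derivative[OF blP] D] .
          then have "frechet_derivative (\<lambda>y. G0 (P y)) (at (\<kappa> q)) =
              (\<lambda>h. frechet_derivative G0 (at (P (\<kappa> q))) (P h))"
            using frechet_derivative_at by metis
          moreover have "P ?w = 0" using P0 nw(2)[OF q v(1)] by blast
          ultimately show ?thesis using linear_0[OF has_derivative_linear[OF D]] by simp
        qed
        finally show "tub_velocity M N e q c G = 0" .
      qed
    qed
  qed
qed

end

section \<open>Covectors and sections of cotangent bundles\<close>

lemma cotangent_add: "a \<in> cotangent M p \<Longrightarrow> v \<in> tangent M p \<Longrightarrow> w \<in> tangent M p \<Longrightarrow> a (v + w) = a v + a w"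
  and cotangent_scale: "a \<in> cotangent M p \<Longrightarrow> v \<in> tangent M p \<Longrightarrow> a (\<lambda>f. c * v f) = c * a v"
  and cotangent_outside: "a \<in> cotangent M p \<Longrightarrow> v \<notin> tangent M p \<Longrightarrow> a v = 0"
  by (auto simp: cotangent_def)

lemma cotangent_ext: "a \<in> cotangent M p \<Longrightarrow> b \<in> cotangent M p \<Longrightarrow> (\<And>v. v \<in> tangent M p \<Longrightarrow> a v = b v) \<Longrightarrow> a = b"
  using cotangent_outside by (metis ext)

lemma cotangent_plus: "a \<in> cotangent M p \<Longrightarrow> b \<in> cotangent M p \<Longrightarrow> a + b \<in> cotangent M p"
  and cotangent_smult: "a \<in> cotangent M p \<Longrightarrow> (\<lambda>v. c * a v) \<in> cotangent M p"
  and zero_cotangent: "0 \<in> cotangent M p"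
  by (auto simp: cotangent_def algebra_simps)



lemma cotangent_sums: "(\<And>i. i \<in> I \<Longrightarrow> a i \<in> cotangent M p) \<Longrightarrow> (\<Sum>i\<in>I. a i) \<in> cotangent M p"
  by (induction I rule: infinite_finite_induct) (auto simp: zero_cotangent cotangent_plus)

lemma fscale_apply [simp]: "fscale f a p v = f p * a p v" by (simp add: fscale_def)

lemma fscale_zero [simp]: "fscale 0 a = 0" "fscale f 0 = 0"
  by (auto simp: fun_eq_iff)

lemma fscale_distrib: "fscale f (a + b) = fscale f a + fscale f b"
  "fscale f (a - b) = fscale f a - fscale f b"
  "fscale (f + g) a = fscale f a + fscale g a"
  "fscale f (- a) = - fscale f a"
  "fscale f (fscale g a) = fscale (f * g) a"
  by (auto simp: fun_eq_iff algebra_simps)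

lemma ev_add: "ev (a + b) X = ev a X + ev b X"
  and ev_fscale: "ev (fscale f a) X = f * ev a X"
  by (auto simp: ev_def fun_eq_iff)

lemma dff_outside: "p \<notin> pts M \<Longrightarrow> dff M f p = 0"
  by (simp add: dff_def fun_eq_iff)

lemma dff_apply: "p \<in> pts M \<Longrightarrow> v \<in> tangent M p \<Longrightarrow> dff M f p v = v f"
  by (simp add: dff_def)

context manifold
begin

lemma cotangent_zero: "a \<in> cotangent M p \<Longrightarrow> a 0 = 0"
  using cotangent_scale[of a M p 0 0] zero_tangent by (simp add: zero_fun_def)



lemma cotangent_sum:
  "a \<in> cotangent M p \<Longrightarrow> (\<And>i. i \<in> I \<Longrightarrow> v i \<in> tangent M p) \<Longrightarrow> a (\<Sum>i\<in>I. v i) = (\<Sum>i\<in>I. a (v i))"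
  by (induction I rule: infinite_finite_induct) (auto simp: cotangent_zero cotangent_add tangent_sums)

lemma vf_tangent: "X \<in> vector_fields M \<Longrightarrow> p \<in> pts M \<Longrightarrow> X p \<in> tangent M p"
  and vf_outside: "X \<in> vector_fields M \<Longrightarrow> p \<notin> pts M \<Longrightarrow> X p = 0"
  and vf_act: "X \<in> vector_fields M \<Longrightarrow> f \<in> Cinf M \<Longrightarrow> act X f \<in> Cinf M"
  by (auto simp: vector_fields_def)

lemma vf_tangent': "X \<in> vector_fields M \<Longrightarrow> X p \<in> tangent M p"
  using vf_tangent[of X p] vf_outside[of X p] zero_tangent[of p] by metis

lemma vf_add: "X \<in> vector_fields M \<Longrightarrow> Y \<in> vector_fields M \<Longrightarrow> X + Y \<in> vector_fields M"
proof -
  have "act (X + Y) f = act X f + act Y f" for f by (auto simp: act_def fun_eq_iff)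
  then show "X \<in> vector_fields M \<Longrightarrow> Y \<in> vector_fields M \<Longrightarrow> X + Y \<in> vector_fields M"
    by (auto simp: vector_fields_def tangent_plus Cinf_add)
qed

lemma vf_fscale: 
  assumes "X \<in> vector_fields M" "f \<in> Cinf M" shows "(\<lambda>p g. f p * X p g) \<in> vector_fields M"
proof -
  have "act (\<lambda>p g. f p * X p g) g = f * act X g" for g by (auto simp: act_def fun_eq_iff)
  then show ?thesis using assms
    by (auto simp: vector_fields_def tangent_smult Cinf_mult zero_fun_def)
qed

lemma vf_zero: "0 \<in> vector_fields M"
proof -
  have "act 0 f = 0" for f :: "'m \<Rightarrow> real" by (auto simp: act_def fun_eq_iff)
  then show ?thesis by (auto simp: vector_fields_def zero_tangent Cinf_zero)
qed

lemma vf_sum: "(\<And>i. i \<in> I \<Longrightarrow> X i \<in> vector_fields M) \<Longrightarrow> (\<Sum>i\<in>I. X i) \<in> vector_fields M"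
  by (induction I rule: infinite_finite_induct) (auto simp: vf_zero vf_add)

lemma cosections_cotangent: "a \<in> cosections K M \<Longrightarrow> p \<in> pts M \<Longrightarrow> a p \<in> cotangent K p"
  and cosections_outside: "a \<in> cosections K M \<Longrightarrow> p \<notin> pts M \<Longrightarrow> a p = 0"
  and cosections_ev: "a \<in> cosections K M \<Longrightarrow> X \<in> vector_fields K \<Longrightarrow> ev a X \<in> Cinf M"
  by (auto simp: cosections_def)

lemma cosections_cotangent': "a \<in> cosections K M \<Longrightarrow> a p \<in> cotangent K p"
  using cosections_cotangent[of a K p] cosections_outside[of a K p] zero_cotangent[of K p] by metis

lemma cosections_add: "a \<in> cosections K M \<Longrightarrow> b \<in> cosections K M \<Longrightarrow> a + b \<in> cosections K M"
  by (auto simp: cosections_def cotangent_plus ev_add Cinf_add)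

lemma cosections_fscale:
  assumes "f \<in> Cinf M" "a \<in> cosections K M" shows "fscale f a \<in> cosections K M"
proof -
  have "fscale f a p = (\<lambda>v. f p * a p v)" for p by (simp add: fun_eq_iff)
  then show ?thesis
    using assms by (auto simp: cosections_def ev_fscale Cinf_mult zero_fun_def intro!: cotangent_smult)
qed

lemma cosections_zero: "0 \<in> cosections K M"
proof -
  have "ev 0 X = 0" for X :: "'m vfield" by (auto simp: ev_def fun_eq_iff)
  then show ?thesis by (auto simp: cosections_def zero_cotangent Cinf_zero)
qed

lemma cosections_uminus:
  assumes "a \<in> cosections K M" shows "- a \<in> cosections K M"
proof -
  have "- a = fscale (- one) a"
    using cosections_outside[OF assms] by (auto simp: fun_eq_iff one_def)
  then show ?thesis using cosections_fscale[OF Cinf_uminus[OF Cinf_one] assms] by simp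
qed

lemma cosections_diff: "a \<in> cosections K M \<Longrightarrow> b \<in> cosections K M \<Longrightarrow> a - b \<in> cosections K M"
  using cosections_add[of a K "- b"] cosections_uminus[of b K] by simp

lemma cosections_sum: "(\<And>i. i \<in> I \<Longrightarrow> a i \<in> cosections K M) \<Longrightarrow> (\<Sum>i\<in>I. a i) \<in> cosections K M"
  by (induction I rule: infinite_finite_induct) (auto simp: cosections_zero cosections_add)

lemma cosections_local:
  assumes "\<And>p. p \<notin> pts M \<Longrightarrow> a p = 0"
    and "\<And>p. p \<in> pts M \<Longrightarrow> \<exists>b\<in>cosections K M. \<forall>\<^sub>F q in nbM p. a q = b q"
  shows "a \<in> cosections K M"
  unfolding cosections_def mem_Collect_eq
proof (intro conjI ballI allI impI)
  fix p assume p: "p \<in> pts M"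
  then obtain b where b: "b \<in> cosections K M" "\<forall>\<^sub>F q in nbM p. a q = b q" using assms(2) by blast
  then show "a p \<in> cotangent K p" using eventually_nb_self[OF b(2) p] cosections_cotangent p by simp
next
  fix X assume X: "X \<in> vector_fields K"
  show "ev a X \<in> Cinf M"
  proof (rule Cinf_local)
    fix p assume p: "p \<in> pts M"
    obtain b where b: "b \<in> cosections K M" "\<forall>\<^sub>F q in nbM p. a q = b q" using assms(2)[OF p] by blast
    have "\<forall>\<^sub>F q in nbM p. ev a X q = ev b X q" using b(2) by eventually_elim (simp add: ev_def)
    then show "\<exists>g\<in>Cinf M. \<forall>\<^sub>F q in nbM p. ev a X q = g q" using cosections_ev[OF b(1) X] by blast
  qed (simp add: ev_def assms(1))
qed (use assms(1) in auto)

lemma fscale_one: "a \<in> cosections K M \<Longrightarrow> fscale one a = a"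
  using cosections_outside by (fastforce simp: fun_eq_iff one_def)

lemma dff_cotangent: "dff M f p \<in> cotangent M p"
proof (cases "p \<in> pts M")
  case True
  then show ?thesis by (auto simp: cotangent_def dff_def tangent_plus tangent_smult)
next
  case False
  then show ?thesis using zero_cotangent by (simp add: dff_outside)
qed

lemma ev_dff: "X \<in> vector_fields M \<Longrightarrow> ev (dff M f) X = act X f"
  using vf_outside vf_tangent by (fastforce simp: ev_def act_def dff_def fun_eq_iff)

lemma dff_one_form: "f \<in> Cinf M \<Longrightarrow> dff M f \<in> one_forms M"
  by (auto simp: one_forms_def cosections_def dff_cotangent dff_outside ev_dff vf_act)

lemma one_forms_cotangent: "a \<in> one_forms M \<Longrightarrow> a p \<in> cotangent M p"
  unfolding one_forms_def by (rule cosections_cotangent')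

lemmas one_forms_ev = cosections_ev[of _ M, folded one_forms_def]
  and one_forms_outside = cosections_outside[of _ M, folded one_forms_def]
  and one_forms_add = cosections_add[of _ M, folded one_forms_def]
  and one_forms_diff = cosections_diff[of _ M, folded one_forms_def]
  and one_forms_zero = cosections_zero[of M, folded one_forms_def]
  and one_forms_uminus = cosections_uminus[of _ M, folded one_forms_def]
  and one_forms_fscale = cosections_fscale[of _ _ M, folded one_forms_def]
  and one_forms_sum = cosections_sum[of _ _ M, folded one_forms_def]
  and fscale_one_form = fscale_one[of _ M, folded one_forms_def]

lemma dff_add: "f \<in> Cinf M \<Longrightarrow> g \<in> Cinf M \<Longrightarrow> dff M (f + g) = dff M f + dff M g"
  and dff_scale: "f \<in> Cinf M \<Longrightarrow> dff M (\<lambda>x. c * f x) = fscale (\<lambda>_. c) (dff M f)"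
  and dff_mult: "f \<in> Cinf M \<Longrightarrow> g \<in> Cinf M \<Longrightarrow> dff M (f * g) = fscale f (dff M g) + fscale g (dff M f)"
  and dff_uminus: "f \<in> Cinf M \<Longrightarrow> dff M (- f) = - dff M f"
  and dff_zero: "dff M 0 = 0"
  by (auto simp: dff_def fun_eq_iff tangent_add tangent_scale tangent_mult tangent_uminus tangent_zero)



section \<open>Local expansion of 1-forms and reduction to exact forms\<close>

lemma frame_expand:
  assumes fr: "\<forall>v\<in>tangent M q. v = (\<lambda>f. \<Sum>b\<in>B. v (x b) * X b q f)"
    and X: "\<And>b. b \<in> B \<Longrightarrow> X b q \<in> tangent M q" and q: "q \<in> pts M" and a: "a \<in> cotangent M q"
  shows "a = (\<lambda>v. \<Sum>b\<in>B. a (X b q) * dff M (x b) q v)"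
proof (rule cotangent_ext[OF a])
  have "(\<Sum>b\<in>B. (\<lambda>v. a (X b q) * dff M (x b) q v)) \<in> cotangent M q"
    by (intro cotangent_sums cotangent_smult dff_cotangent)
  moreover have "(\<Sum>b\<in>B. (\<lambda>v. a (X b q) * dff M (x b) q v)) = (\<lambda>v. \<Sum>b\<in>B. a (X b q) * dff M (x b) q v)"
    by (simp add: fun_eq_iff sum_fun_apply)
  ultimately show "(\<lambda>v. \<Sum>b\<in>B. a (X b q) * dff M (x b) q v) \<in> cotangent M q" by simp
next
  fix v assume v: "v \<in> tangent M q"
  have "v = (\<Sum>b\<in>B. (\<lambda>f. v (x b) * X b q f))"
    using fr v by (simp add: fun_eq_iff sum_fun_apply)
  then have "a v = a (\<Sum>b\<in>B. (\<lambda>f. v (x b) * X b q f))" by simp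
  also have "\<dots> = (\<Sum>b\<in>B. v (x b) * a (X b q))"
    by (subst cotangent_sum[OF a]) (auto intro!: tangent_smult X simp: cotangent_scale[OF a X])
  finally show "a v = (\<Sum>b\<in>B. a (X b q) * dff M (x b) q v)"
    using q v by (simp add: dff_apply mult.commute)
qed

text \<open>Only the value at p matters, so the coefficients of the expansion may be frozen and
  absorbed into one function. Pointwise statements about covectors thus reduce to
  differentials.\<close>

lemma covector_exact:
  assumes p: "p \<in> pts M" and a: "a \<in> cotangent M p"
  obtains g where "g \<in> Cinf M" "a = dff M g p"
proof -
  obtain B x X where fr: "finite (B::'e set)" "\<And>b. b \<in> B \<Longrightarrow> x b \<in> Cinf M" "\<And>b. b \<in> B \<Longrightarrow> X b \<in> vector_fields M"
    "\<forall>\<^sub>F q in nbM p. \<forall>v\<in>tangent M q. v = (\<lambda>f. \<Sum>b\<in>B. v (x b) * X b q f)"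
    using frame[OF p] by blast
  let ?g = "\<Sum>b\<in>B. (\<lambda>q. a (X b p) * x b q)"
  have "a = (\<lambda>v. \<Sum>b\<in>B. a (X b p) * dff M (x b) p v)"
    by (rule frame_expand[where B = B and x = x and X = X, OF eventually_nb_self[OF fr(4) p] _ p a])
       (use fr vf_tangent p in auto)
  also have "\<dots> = dff M ?g p"
  proof
    fix v
    show "(\<Sum>b\<in>B. a (X b p) * dff M (x b) p v) = dff M ?g p v"
    proof (cases "v \<in> tangent M p")
      case True
      have "v ?g = (\<Sum>b\<in>B. a (X b p) * v (x b))"
        by (subst tangent_sum[OF True]) (auto intro!: Cinf_scale fr(2) simp: tangent_scale[OF True fr(2)])
      then show ?thesis using p True by (simp add: dff_apply)
    qed (simp add: dff_def)
  qed
  finally have "a = dff M ?g p" .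
  moreover have "?g \<in> Cinf M" by (intro Cinf_sum Cinf_scale fr(2))
  ultimately show ?thesis using that by blast
qed

text \<open>A combination of the local frame with constant coefficients. It lets a 1-form be
  recovered from its contractions with global vector fields, hence the uniqueness of Lie
  derivatives.\<close>

lemma tangent_extend:
  assumes p: "p \<in> pts M" and v: "v \<in> tangent M p"
  obtains Y where "Y \<in> vector_fields M" "Y p = v"
proof -
  obtain B x X where fr: "finite (B::'e set)" "\<And>b. b \<in> B \<Longrightarrow> x b \<in> Cinf M" "\<And>b. b \<in> B \<Longrightarrow> X b \<in> vector_fields M"
    "\<forall>\<^sub>F q in nbM p. \<forall>v\<in>tangent M q. v = (\<lambda>f. \<Sum>b\<in>B. v (x b) * X b q f)"
    using frame[OF p] by blast
  let ?Y = "\<Sum>b\<in>B. (\<lambda>q g. (\<lambda>q. if q \<in> pts M then v (x b) else 0) q * X b q g)"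
  have "?Y \<in> vector_fields M" by (intro vf_sum vf_fscale fr(3) Cinf_const)
  moreover have "?Y p = v"
    using eventually_nb_self[OF fr(4) p] v p by (simp add: fun_eq_iff sum_fun_apply)
  ultimately show ?thesis using that by blast
qed

text \<open>The last clause holds because the coefficients are contractions of the form with frame
  fields. It serves for forms that vanish only along a submanifold.\<close>

lemma local_presentation_vanishing:
  assumes p: "p \<in> pts M" and a: "a \<in> one_forms M"
  shows "\<exists>(B::'e set) f x. finite B \<and> (\<forall>b\<in>B. f b \<in> Cinf M \<and> x b \<in> Cinf M) \<and>
    (\<forall>\<^sub>F q in nbM p. a q = (\<Sum>b\<in>B. fscale (f b) (dff M (x b))) q) \<and> (\<forall>b q. a q = 0 \<longrightarrow> f b q = 0)"
proof -
  obtain B x X where fr: "finite (B::'e set)" "\<And>b. b \<in> B \<Longrightarrow> x b \<in> Cinf M" "\<And>b. b \<in> B \<Longrightarrow> X b \<in> vector_fields M"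
    "\<forall>\<^sub>F q in nbM p. \<forall>v\<in>tangent M q. v = (\<lambda>f. \<Sum>b\<in>B. v (x b) * X b q f)"
    using frame[OF p] by blast
  have "\<forall>\<^sub>F q in nbM p. a q = (\<Sum>b\<in>B. fscale (ev a (X b)) (dff M (x b))) q"
    using fr(4) eventually_nb_in
  proof eventually_elim
    case (elim q)
    have "a q = (\<lambda>v. \<Sum>b\<in>B. a q (X b q) * dff M (x b) q v)"
      by (rule frame_expand[where B = B and x = x and X = X, OF elim(1) _ elim(2) one_forms_cotangent[OF a]])
         (use fr(3) vf_tangent' in auto)
    note fe = fun_cong[OF this]
    show ?case
      by (rule ext, unfold sum_fun_apply fscale_apply ev_def, rule fe)
  qed
  then show ?thesis
    using fr(1,2) one_forms_ev[OF a fr(3)]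
    by (intro exI[of _ B] exI[of _ "\<lambda>b. ev a (X b)"] exI[of _ x]) (simp add: ev_def)
qed

lemma local_presentation:
  assumes "p \<in> pts M" and "a \<in> one_forms M"
  obtains B f x where "finite (B::'e set)" "\<And>b. b \<in> B \<Longrightarrow> f b \<in> Cinf M" "\<And>b. b \<in> B \<Longrightarrow> x b \<in> Cinf M"
    "\<forall>\<^sub>F q in nbM p. a q = (\<Sum>b\<in>B. fscale (f b) (dff M (x b))) q"
proof -
  obtain B f x where "finite (B::'e set) \<and> (\<forall>b\<in>B. f b \<in> Cinf M \<and> x b \<in> Cinf M) \<and>
    (\<forall>\<^sub>F q in nbM p. a q = (\<Sum>b\<in>B. fscale (f b) (dff M (x b))) q) \<and> (\<forall>b q. a q = 0 \<longrightarrow> f b q = 0)"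
    using local_presentation_vanishing[OF assms] by (elim exE)
  then show ?thesis by (intro that[of B f x]) auto
qed

lemma additive_sum:
  fixes T :: "'m cofield \<Rightarrow> real"
  assumes add: "\<And>a b. a \<in> one_forms M \<Longrightarrow> b \<in> one_forms M \<Longrightarrow> T (a + b) = T a + T b"
    and "finite B" "\<And>b. b \<in> B \<Longrightarrow> \<alpha> b \<in> one_forms M"
  shows "T (\<Sum>b\<in>B. \<alpha> b) = (\<Sum>b\<in>B. T (\<alpha> b))"
  using assms(2,3)
proof (induction B rule: finite_induct)
  case empty
  have "T 0 = 0" using add[OF one_forms_zero one_forms_zero] by simp
  then show ?case by (simp only: sum.empty)
next
  case (insert b B)
  have s: "(\<Sum>b\<in>B. \<alpha> b) \<in> one_forms M" "\<alpha> b \<in> one_forms M"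
    using insert by (auto intro: one_forms_sum)
  have "T (\<Sum>b\<in>B. \<alpha> b) = (\<Sum>b\<in>B. T (\<alpha> b))" using insert by blast
  then show ?case by (simp only: sum.insert[OF insert(1,2)] add[OF s(2,1)])
qed

text \<open>Locally every 1-form is a combination of differentials; a bump function makes this global.\<close>

lemma tensor_zero:
  fixes T :: "'m cofield \<Rightarrow> real"
  assumes p: "p \<in> pts M"
    and add: "\<And>a b. a \<in> one_forms M \<Longrightarrow> b \<in> one_forms M \<Longrightarrow> T (a + b) = T a + T b"
    and scale: "\<And>f a. f \<in> Cinf M \<Longrightarrow> a \<in> one_forms M \<Longrightarrow> T (fscale f a) = f p * T a"
    and exact: "\<And>g. g \<in> Cinf M \<Longrightarrow> T (dff M g) = 0"
    and a: "a \<in> one_forms M"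
  shows "T a = 0"
proof -
  obtain B f x where fr: "finite (B::'e set)" "\<And>b. b \<in> B \<Longrightarrow> f b \<in> Cinf M" "\<And>b. b \<in> B \<Longrightarrow> x b \<in> Cinf M"
    and ev: "\<forall>\<^sub>F q in nbM p. a q = (\<Sum>b\<in>B. fscale (f b) (dff M (x b))) q"
    using local_presentation[OF p a] by blast
  let ?s = "\<Sum>b\<in>B. fscale (f b) (dff M (x b))"
  obtain \<theta> where th: "\<theta> \<in> Cinf M" "\<forall>\<^sub>F q in nbM p. \<theta> q = 1" "\<theta> p = 1"
    "\<forall>q. \<theta> q = 0 \<or> a q = ?s q"
    using bump_point[OF p ev] .
  \<comment> \<open>The two forms agree only near p; multiplied by \<theta> they agree everywhere,
    and \<theta> p = 1 leaves the values of T unchanged.\<close>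
  have "\<theta> q * a q v = \<theta> q * ?s q v" for q v using spec[OF th(4), of q] by auto
  then have eq: "fscale \<theta> a = fscale \<theta> ?s" by (simp add: fun_eq_iff)
  have s: "?s \<in> one_forms M" by (intro one_forms_sum one_forms_fscale dff_one_form fr)
  have "T ?s = (\<Sum>b\<in>B. T (fscale (f b) (dff M (x b))))"
    by (rule additive_sum[where T = T, OF _ fr(1)], erule (1) add)
       (intro one_forms_fscale dff_one_form fr, assumption+)
  also have "\<dots> = 0"
    by (rule sum.neutral) (use scale exact fr dff_one_form in simp)
  finally have "T ?s = 0" .
  then show ?thesis using scale[OF th(1) a] scale[OF th(1) s] eq th(3) by simp
qed

text \<open>Linearity is assumed in the second slot alone; skew-symmetry carries it to the first, so
  each slot in turn is reduced to differentials.\<close>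

lemma tensor_zero_skew:
  fixes T :: "'m cofield \<Rightarrow> 'm cofield \<Rightarrow> real"
  assumes p: "p \<in> pts M"
    and add: "\<And>a b c. a \<in> one_forms M \<Longrightarrow> b \<in> one_forms M \<Longrightarrow> c \<in> one_forms M \<Longrightarrow>
      T a (b + c) = T a b + T a c"
    and scale: "\<And>f a b. f \<in> Cinf M \<Longrightarrow> a \<in> one_forms M \<Longrightarrow> b \<in> one_forms M \<Longrightarrow>
      T a (fscale f b) = f p * T a b"
    and skew: "\<And>a b. a \<in> one_forms M \<Longrightarrow> b \<in> one_forms M \<Longrightarrow> T a b = - T b a"
    and exact: "\<And>f g. f \<in> Cinf M \<Longrightarrow> g \<in> Cinf M \<Longrightarrow> T (dff M f) (dff M g) = 0"
    and a: "a \<in> one_forms M" and b: "b \<in> one_forms M"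
  shows "T a b = 0"
proof (rule tensor_zero[OF p, of "T a"])
  fix g assume g: "g \<in> Cinf M"
  have "T (dff M g) a = 0"
    by (rule tensor_zero[OF p, of "T (dff M g)"]) (use a g add scale exact dff_one_form in auto)
  then show "T a (dff M g) = 0" using skew[OF a dff_one_form[OF g]] by simp
qed (use add scale a b in auto)

section \<open>Lie derivatives of 1-forms\<close>

lemma act_lie_bracket: "act (lie_bracket X Y) f = act X (act Y f) - act Y (act X f)"
  by (simp add: act_def lie_bracket_def fun_eq_iff)

lemma lie_bracket_vf:
  assumes X: "X \<in> vector_fields M" and Y: "Y \<in> vector_fields M"
  shows "lie_bracket X Y \<in> vector_fields M"
proof -
  have lin: "act Z (f + g) = act Z f + act Z g" "act Z (\<lambda>x. c * f x) = (\<lambda>x. c * act Z f x)"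
    "act Z (f * g) = f * act Z g + g * act Z f"
    if "Z \<in> vector_fields M" "f \<in> Cinf M" "g \<in> Cinf M" for Z f g c
    using that(2,3)
    by (auto simp: act_def fun_eq_iff tangent_add[OF vf_tangent'[OF that(1)]]
        tangent_scale[OF vf_tangent'[OF that(1)]] tangent_mult[OF vf_tangent'[OF that(1)]])
  have out: "act Z f = 0" if "Z \<in> vector_fields M" "f \<notin> Cinf M" for Z f
    using tangent_outside[OF vf_tangent'[OF that(1)] that(2)] by (simp add: act_def fun_eq_iff)
  note t = vf_tangent'[OF X] vf_tangent'[OF Y]
  have z: "v \<in> tangent M p \<Longrightarrow> v (f * g + h * k) = f p * v g + g p * v f + h p * v k + k p * v h"
    if "f \<in> Cinf M" "g \<in> Cinf M" "h \<in> Cinf M" "k \<in> Cinf M" for v p f g h k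
    using that by (simp add: tangent_add tangent_mult Cinf_mult)
  have "lie_bracket X Y p \<in> tangent M p" for p
    unfolding tangent_def mem_Collect_eq
  proof (intro conjI allI impI ballI)
    fix f assume "f \<notin> Cinf M"
    then show "lie_bracket X Y p f = 0"
      using out X Y tangent_zero[OF t(1)] tangent_zero[OF t(2)] by (simp add: lie_bracket_def)
  next
    fix f g assume f: "f \<in> Cinf M" and g: "g \<in> Cinf M"
    show "lie_bracket X Y p (f + g) = lie_bracket X Y p f + lie_bracket X Y p g"
      using lin[OF X f g] lin[OF Y f g] tangent_add[OF t(1)] tangent_add[OF t(2)] vf_act X Y f g
      by (simp add: lie_bracket_def)
    show "lie_bracket X Y p (f * g) = f p * lie_bracket X Y p g + g p * lie_bracket X Y p f"
      using lin[OF X f g] lin[OF Y f g] z[OF f vf_act[OF X g] g vf_act[OF X f] t(2)]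
        z[OF f vf_act[OF Y g] g vf_act[OF Y f] t(1)]
      by (simp add: lie_bracket_def) (simp add: act_def algebra_simps)
  next
    fix c f assume f: "f \<in> Cinf M"
    show "lie_bracket X Y p (\<lambda>x. c * f x) = c * lie_bracket X Y p f"
      using lin(2)[OF X f f] lin(2)[OF Y f f] tangent_scale[OF t(1)] tangent_scale[OF t(2)] vf_act X Y f
      by (simp add: lie_bracket_def algebra_simps)
  qed
  moreover have "lie_bracket X Y p = 0" if "p \<notin> pts M" for p
    using vf_outside[OF X that] vf_outside[OF Y that] by (simp add: lie_bracket_def fun_eq_iff)
  ultimately show ?thesis
    unfolding vector_fields_def mem_Collect_eq act_lie_bracket by (auto intro!: Cinf_diff vf_act X Y)
qed

text \<open>The condition under the definite description in \<open>lie_form\<close>, as a relation,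
  so that candidates can be exhibited and compared before the description is resolved.\<close>

definition cartan :: "'m vfield \<Rightarrow> 'm cofield \<Rightarrow> 'm cofield \<Rightarrow> bool" where
  "cartan X \<beta> \<gamma> \<longleftrightarrow> \<gamma> \<in> one_forms M \<and>
     (\<forall>Y\<in>vector_fields M. ev \<gamma> Y = act X (ev \<beta> Y) - ev \<beta> (lie_bracket X Y))"

lemma cartan_unique: "cartan X \<beta> \<gamma> \<Longrightarrow> cartan X \<beta> \<gamma>' \<Longrightarrow> \<gamma> = \<gamma>'"
proof
  fix p assume c: "cartan X \<beta> \<gamma>" "cartan X \<beta> \<gamma>'"
  then have o: "\<gamma> \<in> one_forms M" "\<gamma>' \<in> one_forms M" by (auto simp: cartan_def)
  show "\<gamma> p = \<gamma>' p"
  proof (cases "p \<in> pts M")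
    case True
    show ?thesis
    proof (rule cotangent_ext[OF one_forms_cotangent[OF o(1)] one_forms_cotangent[OF o(2)]])
      fix v assume "v \<in> tangent M p"
      then obtain Y where Y: "Y \<in> vector_fields M" "Y p = v" using tangent_extend[OF True] by blast
      then have "ev \<gamma> Y p = ev \<gamma>' Y p" using c by (simp add: cartan_def)
      then show "\<gamma> p v = \<gamma>' p v" using Y by (simp add: ev_def)
    qed
  qed (use o one_forms_outside in simp)
qed

text \<open>Near p the form is a sum of f_b dx_b, so its Lie derivative at p must be the sum of
  X(f_b) dx_b + f_b d(X x_b). Covectors are found point by point; smoothness of the assembled form
  follows from the formula for its contractions, which no longer mentions a local
  presentation.\<close>

lemma cartan_exists:
  assumes X: "X \<in> vector_fields M" and \<beta>: "\<beta> \<in> one_forms M"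
  shows "\<exists>\<gamma>. cartan X \<beta> \<gamma>"
proof -
  have "\<exists>c. c \<in> cotangent M p \<and> (\<forall>Y\<in>vector_fields M. c (Y p) = act X (ev \<beta> Y) p - ev \<beta> (lie_bracket X Y) p)"
    if p: "p \<in> pts M" for p
  proof -
    obtain B f x where fr: "finite (B::'e set)" "\<And>b. b \<in> B \<Longrightarrow> f b \<in> Cinf M" "\<And>b. b \<in> B \<Longrightarrow> x b \<in> Cinf M"
      and ev: "\<forall>\<^sub>F q in nbM p. \<beta> q = (\<Sum>b\<in>B. fscale (f b) (dff M (x b))) q"
      using local_presentation[OF p \<beta>] by blast
    define c where "c = (\<Sum>b\<in>B. (\<lambda>v. X p (f b) * dff M (x b) p v) + (\<lambda>v. f b p * dff M (act X (x b)) p v))"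
    have "c \<in> cotangent M p"
      unfolding c_def by (intro cotangent_sums cotangent_plus cotangent_smult dff_cotangent)
    moreover have "c (Y p) = act X (ev \<beta> Y) p - ev \<beta> (lie_bracket X Y) p" if Y: "Y \<in> vector_fields M" for Y
    proof -
      note tX = vf_tangent'[OF X] and tY = vf_tangent'[OF Y]
      let ?s = "\<Sum>b\<in>B. f b * act Y (x b)"
      have s: "?s \<in> Cinf M" by (intro Cinf_sum Cinf_mult fr vf_act Y)
      have "\<forall>\<^sub>F q in nbM p. ev \<beta> Y q = ?s q"
        using ev eventually_nb_in
        by eventually_elim (use tY in \<open>simp add: ev_def sum_fun_apply act_def dff_apply\<close>)
      then have "X p (ev \<beta> Y) = X p ?s" by (rule tangent_local[OF tX p one_forms_ev[OF \<beta> Y] s])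
      also have "\<dots> = (\<Sum>b\<in>B. X p (f b * act Y (x b)))"
        by (rule tangent_sum[OF tX]) (intro Cinf_mult fr vf_act Y)
      also have "\<dots> = (\<Sum>b\<in>B. f b p * X p (act Y (x b)) + Y p (x b) * X p (f b))"
        by (rule sum.cong[OF refl], subst tangent_mult[OF tX fr(2) vf_act[OF Y fr(3)]])
           (auto simp: act_def)
      finally have 1: "act X (ev \<beta> Y) p = (\<Sum>b\<in>B. f b p * X p (act Y (x b)) + Y p (x b) * X p (f b))"
        by (simp add: act_def)
      have "lie_bracket X Y p \<in> tangent M p" using vf_tangent'[OF lie_bracket_vf[OF X Y]] .
      then have 2: "ev \<beta> (lie_bracket X Y) p = (\<Sum>b\<in>B. f b p * (X p (act Y (x b)) - Y p (act X (x b))))"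
        using eventually_nb_self[OF ev p] p
        by (simp add: ev_def sum_fun_apply dff_apply) (simp add: lie_bracket_def)
      have "c (Y p) = (\<Sum>b\<in>B. X p (f b) * Y p (x b) + f b p * Y p (act X (x b)))"
        using tY p by (simp add: c_def sum_fun_apply dff_apply)
      then show ?thesis unfolding 1 2 by (simp add: sum_subtractf[symmetric] algebra_simps)
    qed
    ultimately show ?thesis by blast
  qed
  then obtain \<gamma> where g: "\<And>p. p \<in> pts M \<Longrightarrow> \<gamma> p \<in> cotangent M p"
    "\<And>p Y. p \<in> pts M \<Longrightarrow> Y \<in> vector_fields M \<Longrightarrow> \<gamma> p (Y p) = act X (ev \<beta> Y) p - ev \<beta> (lie_bracket X Y) p"
    by metis
  define \<gamma>' where "\<gamma>' p = (if p \<in> pts M then \<gamma> p else 0)" for p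
  have e: "ev \<gamma>' Y = act X (ev \<beta> Y) - ev \<beta> (lie_bracket X Y)" if Y: "Y \<in> vector_fields M" for Y
  proof
    fix p
    show "ev \<gamma>' Y p = (act X (ev \<beta> Y) - ev \<beta> (lie_bracket X Y)) p"
      using g(2)[OF _ Y, of p] vf_outside[OF X, of p] one_forms_outside[OF \<beta>, of p]
      by (cases "p \<in> pts M") (auto simp: ev_def \<gamma>'_def act_def)
  qed
  have "\<gamma>' \<in> one_forms M"
    unfolding one_forms_def cosections_def mem_Collect_eq
    using g(1) e Cinf_diff vf_act[OF X] one_forms_ev[OF \<beta>] lie_bracket_vf[OF X]
    by (auto simp: \<gamma>'_def)
  then show ?thesis using e unfolding cartan_def by blast
qed

lemma lie_formI: "cartan X \<beta> \<gamma> \<Longrightarrow> lie_form M X \<beta> = \<gamma>"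
  unfolding lie_form_def cartan_def[symmetric] using cartan_unique by (intro the_equality) auto

lemma lie_form_cartan:
  "X \<in> vector_fields M \<Longrightarrow> \<beta> \<in> one_forms M \<Longrightarrow> cartan X \<beta> (lie_form M X \<beta>)"
  using cartan_exists lie_formI by metis

lemma lie_form_one_form: "X \<in> vector_fields M \<Longrightarrow> \<beta> \<in> one_forms M \<Longrightarrow> lie_form M X \<beta> \<in> one_forms M"
  using lie_form_cartan by (auto simp: cartan_def)

lemma act_add: "X \<in> vector_fields M \<Longrightarrow> f \<in> Cinf M \<Longrightarrow> g \<in> Cinf M \<Longrightarrow> act X (f + g) = act X f + act X g"
  and act_mult: "X \<in> vector_fields M \<Longrightarrow> f \<in> Cinf M \<Longrightarrow> g \<in> Cinf M \<Longrightarrow> act X (f * g) = f * act X g + g * act X f"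
  by (auto simp: act_def fun_eq_iff tangent_add[OF vf_tangent'] tangent_mult[OF vf_tangent'])

lemma cartanD:
  "cartan X \<beta> \<gamma> \<Longrightarrow> Y \<in> vector_fields M \<Longrightarrow> act X (ev \<beta> Y) = ev \<gamma> Y + ev \<beta> (lie_bracket X Y)"
  by (simp add: cartan_def)

lemma lie_form_add:
  assumes X: "X \<in> vector_fields M" and b: "\<beta> \<in> one_forms M" "\<beta>' \<in> one_forms M"
  shows "lie_form M X (\<beta> + \<beta>') = lie_form M X \<beta> + lie_form M X \<beta>'"
  using lie_form_cartan[OF X b(1)] lie_form_cartan[OF X b(2)] b
  by (intro lie_formI) (auto simp: cartan_def one_forms_add ev_add act_add[OF X] one_forms_ev)

lemma lie_form_add_field:
  assumes X: "X \<in> vector_fields M" "X' \<in> vector_fields M" and b: "\<beta> \<in> one_forms M"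
  shows "lie_form M (X + X') \<beta> = lie_form M X \<beta> + lie_form M X' \<beta>"
proof (rule lie_formI)
  have "ev \<beta> (lie_bracket (X + X') Y) = ev \<beta> (lie_bracket X Y) + ev \<beta> (lie_bracket X' Y)"
    if Y: "Y \<in> vector_fields M" for Y
  proof
    fix p
    have "lie_bracket (X + X') Y p = lie_bracket X Y p + lie_bracket X' Y p"
    proof
      fix g
      have "act (X + X') g = act X g + act X' g" by (simp add: act_def fun_eq_iff)
      \<comment> \<open>Brackets are compared on all functions g; off \<open>Cinf\<close> the fields
        act as zero, a case not covered by additivity of tangent vectors.\<close>
      moreover have "Y p (act X g + act X' g) = Y p (act X g) + Y p (act X' g)"
      proof (cases "g \<in> Cinf M")
        case True then show ?thesis using tangent_add[OF vf_tangent'[OF Y]] vf_act X by blast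
      next
        case False
        then have "act X g = 0" "act X' g = 0"
          using tangent_outside vf_tangent' X by (fastforce simp: act_def fun_eq_iff)+
        then show ?thesis using tangent_zero[OF vf_tangent'[OF Y]] by simp
      qed
      ultimately show "lie_bracket (X + X') Y p g = (lie_bracket X Y p + lie_bracket X' Y p) g"
        by (simp add: lie_bracket_def)
    qed
    then show "ev \<beta> (lie_bracket (X + X') Y) p = (ev \<beta> (lie_bracket X Y) + ev \<beta> (lie_bracket X' Y)) p"
      using cotangent_add[OF one_forms_cotangent[OF b]] vf_tangent' lie_bracket_vf X Y by (simp add: ev_def)
  qed
  then show "cartan (X + X') \<beta> (lie_form M X \<beta> + lie_form M X' \<beta>)"
    using lie_form_cartan[OF X(1) b] lie_form_cartan[OF X(2) b]
    by (auto simp: cartan_def one_forms_add ev_add fun_eq_iff act_def)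
qed

lemma lie_form_fscale:
  assumes X: "X \<in> vector_fields M" and b: "\<beta> \<in> one_forms M" and f: "f \<in> Cinf M"
  shows "lie_form M X (fscale f \<beta>) = fscale (act X f) \<beta> + fscale f (lie_form M X \<beta>)"
proof (rule lie_formI)
  have "ev (fscale (act X f) \<beta> + fscale f (lie_form M X \<beta>)) Y =
      act X (ev (fscale f \<beta>) Y) - ev (fscale f \<beta>) (lie_bracket X Y)" if Y: "Y \<in> vector_fields M" for Y
    using cartanD[OF lie_form_cartan[OF X b] Y]
    by (simp add: ev_add ev_fscale act_mult[OF X f one_forms_ev[OF b Y]] algebra_simps)
  then show "cartan X (fscale f \<beta>) (fscale (act X f) \<beta> + fscale f (lie_form M X \<beta>))"
    using X b f lie_form_one_form by (auto simp: cartan_def one_forms_add one_forms_fscale vf_act)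
qed

text \<open>The extra term comes from [f X, Y] = f [X, Y] - Y(f) X.\<close>

lemma lie_form_scale_field:
  assumes X: "X \<in> vector_fields M" and b: "\<beta> \<in> one_forms M" and f: "f \<in> Cinf M"
  shows "lie_form M (\<lambda>p g. f p * X p g) \<beta> = fscale f (lie_form M X \<beta>) + fscale (ev \<beta> X) (dff M f)"
proof (rule lie_formI)
  let ?X = "\<lambda>p g. f p * X p g"
  have "ev \<beta> (lie_bracket ?X Y) = f * ev \<beta> (lie_bracket X Y) - act Y f * ev \<beta> X"
    if Y: "Y \<in> vector_fields M" for Y
  proof
    fix p
    have "lie_bracket ?X Y p = (\<lambda>g. f p * lie_bracket X Y p g) + (\<lambda>g. (- Y p f) * X p g)"
    proof
      fix g
      have a: "act ?X g = f * act X g" by (simp add: act_def fun_eq_iff)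
      have "Y p (f * act X g) = f p * Y p (act X g) + X p g * Y p f"
      proof (cases "g \<in> Cinf M")
        case True
        then show ?thesis using tangent_mult[OF vf_tangent'[OF Y] f vf_act[OF X True]] by (simp add: act_def)
      next
        case False
        then have 0: "act X g = 0" using tangent_outside vf_tangent'[OF X] by (fastforce simp: act_def fun_eq_iff)
        then have "X p g = 0" by (metis act_def zero_fun_apply)
        then show ?thesis using 0 tangent_zero[OF vf_tangent'[OF Y]] by simp
      qed
      then show "lie_bracket ?X Y p g = ((\<lambda>g. f p * lie_bracket X Y p g) + (\<lambda>g. (- Y p f) * X p g)) g"
        using a by (simp add: lie_bracket_def algebra_simps)
    qed
    then have "\<beta> p (lie_bracket ?X Y p) = f p * \<beta> p (lie_bracket X Y p) + (- Y p f) * \<beta> p (X p)"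
      by (simp only: cotangent_add[OF one_forms_cotangent[OF b] tangent_smult[OF vf_tangent'[OF lie_bracket_vf[OF X Y]]]
            tangent_smult[OF vf_tangent'[OF X]]]
          cotangent_scale[OF one_forms_cotangent[OF b] vf_tangent'[OF lie_bracket_vf[OF X Y]]]
          cotangent_scale[OF one_forms_cotangent[OF b] vf_tangent'[OF X]])
    then show "ev \<beta> (lie_bracket ?X Y) p = (f * ev \<beta> (lie_bracket X Y) - act Y f * ev \<beta> X) p"
      by (simp add: ev_def act_def)
  qed
  note br = this
  have "ev (fscale f (lie_form M X \<beta>) + fscale (ev \<beta> X) (dff M f)) Y =
      act ?X (ev \<beta> Y) - ev \<beta> (lie_bracket ?X Y)" if Y: "Y \<in> vector_fields M" for Y
  proof -
    have "act ?X (ev \<beta> Y) = f * act X (ev \<beta> Y)" by (simp add: act_def fun_eq_iff)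
    then show ?thesis using cartanD[OF lie_form_cartan[OF X b] Y]
      by (simp add: br[OF Y] ev_add ev_fscale ev_dff[OF Y] algebra_simps)
  qed
  then show "cartan ?X \<beta> (fscale f (lie_form M X \<beta>) + fscale (ev \<beta> X) (dff M f))"
    unfolding cartan_def
    by (intro conjI ballI one_forms_add one_forms_fscale dff_one_form one_forms_ev lie_form_one_form X b f)
qed

lemma lie_form_dff:
  assumes X: "X \<in> vector_fields M" and g: "g \<in> Cinf M"
  shows "lie_form M X (dff M g) = dff M (act X g)"
  using lie_bracket_vf[OF X]
  by (intro lie_formI) (auto simp: cartan_def dff_one_form vf_act X g ev_dff act_lie_bracket)

end

section \<open>The cotangent Lie algebroid of a Poisson manifold\<close>

locale poisson = manifold M
  for M :: "('m::{t2_space,second_countable_topology}, 'e::euclidean_space) mfd" +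
  fixes \<pi> :: "'m bivec"
  assumes poisson: "poisson_manifold M \<pi>"
begin

lemma biv: "\<pi> \<in> bivector_fields M"
  using poisson by (simp add: poisson_manifold_def)

lemma pi_outside: "p \<notin> pts M \<Longrightarrow> \<pi> p a b = 0"
  using biv unfolding bivector_fields_def mem_Collect_eq by (elim conjE) blast

lemma pi_skew: "a \<in> cotangent M p \<Longrightarrow> b \<in> cotangent M p \<Longrightarrow> \<pi> p a b = - \<pi> p b a"
  and pi_scale: "a \<in> cotangent M p \<Longrightarrow> b \<in> cotangent M p \<Longrightarrow> \<pi> p (\<lambda>v. c * a v) b = c * \<pi> p a b"
  and pi_add: "a \<in> cotangent M p \<Longrightarrow> a' \<in> cotangent M p \<Longrightarrow> b \<in> cotangent M p \<Longrightarrow>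
     \<pi> p (a + a') b = \<pi> p a b + \<pi> p a' b"
proof -
  have *: "\<pi> p a b = - \<pi> p b a \<and> \<pi> p (\<lambda>v. c * a v) b = c * \<pi> p a b \<and>
      (\<forall>a'\<in>cotangent M p. \<pi> p (a + a') b = \<pi> p a b + \<pi> p a' b)"
    if "a \<in> cotangent M p" "b \<in> cotangent M p" for a b c
  proof (cases "p \<in> pts M")
    case True
    have "\<forall>p\<in>pts M. \<forall>a\<in>cotangent M p. \<forall>b\<in>cotangent M p. \<pi> p a a = 0 \<and> \<pi> p a b = - \<pi> p b a \<and>
        (\<forall>c. \<pi> p (\<lambda>v. c * a v) b = c * \<pi> p a b) \<and>
        (\<forall>a'\<in>cotangent M p. \<pi> p (a + a') b = \<pi> p a b + \<pi> p a' b)"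
      using biv unfolding bivector_fields_def mem_Collect_eq by (elim conjE)
    note h = bspec[OF bspec[OF bspec[OF this True] that(1)] that(2)]
    show ?thesis
      by (intro conjI, rule conjunct1[OF conjunct2[OF h]],
          rule spec[OF conjunct1[OF conjunct2[OF conjunct2[OF h]]]], rule conjunct2[OF conjunct2[OF conjunct2[OF h]]])
  qed (simp add: pi_outside)
  show "a \<in> cotangent M p \<Longrightarrow> b \<in> cotangent M p \<Longrightarrow> \<pi> p a b = - \<pi> p b a"
    by (rule conjunct1[OF *])
  show "a \<in> cotangent M p \<Longrightarrow> b \<in> cotangent M p \<Longrightarrow> \<pi> p (\<lambda>v. c * a v) b = c * \<pi> p a b"
    by (rule conjunct1[OF conjunct2[OF *]])
  show "a \<in> cotangent M p \<Longrightarrow> a' \<in> cotangent M p \<Longrightarrow> b \<in> cotangent M p \<Longrightarrow>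
     \<pi> p (a + a') b = \<pi> p a b + \<pi> p a' b"
    by (rule bspec[OF conjunct2[OF conjunct2[OF *]]])
qed

lemma pi_scale2: "a \<in> cotangent M p \<Longrightarrow> b \<in> cotangent M p \<Longrightarrow> \<pi> p a (\<lambda>v. c * b v) = c * \<pi> p a b"
  using pi_skew[of a p "\<lambda>v. c * b v"] pi_scale[of b p a c] pi_skew[of b p a] cotangent_smult[of b M p c] by simp

lemma pi_add2: "a \<in> cotangent M p \<Longrightarrow> b \<in> cotangent M p \<Longrightarrow> b' \<in> cotangent M p \<Longrightarrow>
     \<pi> p a (b + b') = \<pi> p a b + \<pi> p a b'"
  using pi_skew[of a p "b + b'"] pi_add[of b p b' a] pi_skew[of b p a] pi_skew[of b' p a]
    cotangent_plus[of b M p b'] by simp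

lemma pi_zero: "b \<in> cotangent M p \<Longrightarrow> \<pi> p 0 b = 0"
  using pi_scale[of 0 p b 0] zero_cotangent[of M p] by (simp add: zero_fun_def)

lemma ev2_Cinf: "\<alpha> \<in> one_forms M \<Longrightarrow> \<beta> \<in> one_forms M \<Longrightarrow> ev2 \<pi> \<alpha> \<beta> \<in> Cinf M"
  using biv unfolding bivector_fields_def mem_Collect_eq by (elim conjE) blast

lemma pbracket_Cinf: "f \<in> Cinf M \<Longrightarrow> g \<in> Cinf M \<Longrightarrow> pbracket M \<pi> f g \<in> Cinf M"
  by (simp add: pbracket_def ev2_Cinf dff_one_form)

lemma sharp_apply: "f \<in> Cinf M \<Longrightarrow> sharp M \<pi> \<alpha> p f = \<pi> p (\<alpha> p) (dff M f p)"
  by (simp add: sharp_def)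

lemma act_sharp: "f \<in> Cinf M \<Longrightarrow> act (sharp M \<pi> \<alpha>) f = ev2 \<pi> \<alpha> (dff M f)"
  by (simp add: act_def sharp_apply ev2_def)

lemma sharp_dff: "f \<in> Cinf M \<Longrightarrow> sharp M \<pi> (dff M g) p f = pbracket M \<pi> g f p"
  by (simp add: sharp_apply pbracket_def ev2_def)

lemma act_sharp_dff: "f \<in> Cinf M \<Longrightarrow> act (sharp M \<pi> (dff M g)) f = pbracket M \<pi> g f"
  by (simp add: act_sharp pbracket_def)

lemma sharp_vf:
  assumes a: "\<alpha> \<in> one_forms M" shows "sharp M \<pi> \<alpha> \<in> vector_fields M"
proof -
  note c = one_forms_cotangent[OF a]
  have sc: "fscale f (dff M g) p = (\<lambda>v. f p * dff M g p v)" for f g p by (simp add: fun_eq_iff)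
  have "sharp M \<pi> \<alpha> p \<in> tangent M p" for p
    unfolding tangent_def mem_Collect_eq
  proof (intro conjI allI impI ballI)
    fix f g assume f: "f \<in> Cinf M" and g: "g \<in> Cinf M"
    show "sharp M \<pi> \<alpha> p (f + g) = sharp M \<pi> \<alpha> p f + sharp M \<pi> \<alpha> p g"
      using f g by (simp add: sharp_apply Cinf_add dff_add pi_add2[OF c dff_cotangent dff_cotangent])
    show "sharp M \<pi> \<alpha> p (f * g) = f p * sharp M \<pi> \<alpha> p g + g p * sharp M \<pi> \<alpha> p f"
      using f g by (simp add: sharp_apply Cinf_mult dff_mult sc
          pi_add2[OF c cotangent_smult[OF dff_cotangent] cotangent_smult[OF dff_cotangent]] pi_scale2[OF c dff_cotangent])
  next
    fix k f assume f: "f \<in> Cinf M"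
    show "sharp M \<pi> \<alpha> p (\<lambda>x. k * f x) = k * sharp M \<pi> \<alpha> p f"
      using f by (simp add: sharp_apply Cinf_scale dff_scale sc pi_scale2[OF c dff_cotangent])
  qed (simp add: sharp_def)
  moreover have "sharp M \<pi> \<alpha> p = 0" if "p \<notin> pts M" for p
    using that by (simp add: sharp_def pi_outside fun_eq_iff)
  ultimately show ?thesis
    unfolding vector_fields_def mem_Collect_eq
    using a by (auto simp: act_sharp intro!: ev2_Cinf dff_one_form)
qed

lemma sharp_add: "\<alpha> \<in> one_forms M \<Longrightarrow> \<beta> \<in> one_forms M \<Longrightarrow> sharp M \<pi> (\<alpha> + \<beta>) = sharp M \<pi> \<alpha> + sharp M \<pi> \<beta>"
  by (auto simp: sharp_def fun_eq_iff
      pi_add[OF one_forms_cotangent one_forms_cotangent dff_cotangent])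

lemma sharp_fscale: "\<alpha> \<in> one_forms M \<Longrightarrow> sharp M \<pi> (fscale f \<alpha>) = (\<lambda>p g. f p * sharp M \<pi> \<alpha> p g)"
proof -
  have sc: "fscale f \<alpha> p = (\<lambda>v. f p * \<alpha> p v)" for p by (simp add: fun_eq_iff)
  show "\<alpha> \<in> one_forms M \<Longrightarrow> sharp M \<pi> (fscale f \<alpha>) = (\<lambda>p g. f p * sharp M \<pi> \<alpha> p g)"
    by (auto simp: sharp_def fun_eq_iff sc pi_scale[OF one_forms_cotangent dff_cotangent])
qed

lemma ev2_add: "\<alpha> \<in> one_forms M \<Longrightarrow> \<beta> \<in> one_forms M \<Longrightarrow> \<beta>' \<in> one_forms M \<Longrightarrow>
    ev2 \<pi> \<alpha> (\<beta> + \<beta>') = ev2 \<pi> \<alpha> \<beta> + ev2 \<pi> \<alpha> \<beta>'"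
  by (auto simp: ev2_def fun_eq_iff pi_add2[OF one_forms_cotangent one_forms_cotangent one_forms_cotangent])

lemma ev2_skew: "\<alpha> \<in> one_forms M \<Longrightarrow> \<beta> \<in> one_forms M \<Longrightarrow> ev2 \<pi> \<alpha> \<beta> = - ev2 \<pi> \<beta> \<alpha>"
  by (auto simp: ev2_def fun_eq_iff intro!: pi_skew one_forms_cotangent)

lemma ev2_fscale: "\<alpha> \<in> one_forms M \<Longrightarrow> \<beta> \<in> one_forms M \<Longrightarrow> ev2 \<pi> \<alpha> (fscale f \<beta>) = f * ev2 \<pi> \<alpha> \<beta>"
proof -
  have sc: "fscale f \<beta> p = (\<lambda>v. f p * \<beta> p v)" for p by (simp add: fun_eq_iff)
  show "\<alpha> \<in> one_forms M \<Longrightarrow> \<beta> \<in> one_forms M \<Longrightarrow> ev2 \<pi> \<alpha> (fscale f \<beta>) = f * ev2 \<pi> \<alpha> \<beta>"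
    by (auto simp: ev2_def fun_eq_iff sc pi_scale2[OF one_forms_cotangent one_forms_cotangent])
qed

text \<open>\<open>sharp\<close> is defined through its action on functions, so a general form has
  first to be replaced, at the given point, by a differential.\<close>

lemma ev_sharp:
  assumes "\<alpha> \<in> one_forms M" "\<beta> \<in> one_forms M"
  shows "ev \<beta> (sharp M \<pi> \<alpha>) = ev2 \<pi> \<alpha> \<beta>"
proof
  fix p
  show "ev \<beta> (sharp M \<pi> \<alpha>) p = ev2 \<pi> \<alpha> \<beta> p"
  proof (cases "p \<in> pts M")
    case True
    obtain g where g: "g \<in> Cinf M" "\<beta> p = dff M g p"
      using covector_exact[OF True one_forms_cotangent[OF assms(2)]] .
    then show ?thesis
      using dff_apply[OF True vf_tangent'[OF sharp_vf[OF assms(1)]]] by (simp add: ev_def ev2_def sharp_apply)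
  qed (simp add: ev_def ev2_def pi_outside one_forms_outside[OF assms(2)])
qed

abbreviation kb :: "'m cofield \<Rightarrow> 'm cofield \<Rightarrow> 'm cofield" where "kb \<equiv> koszul M \<pi>"

lemma koszul_one_form: "\<alpha> \<in> one_forms M \<Longrightarrow> \<beta> \<in> one_forms M \<Longrightarrow> kb \<alpha> \<beta> \<in> one_forms M"
  unfolding koszul_def by (intro one_forms_diff lie_form_one_form sharp_vf dff_one_form ev2_Cinf)

lemma koszul_skew: "\<alpha> \<in> one_forms M \<Longrightarrow> \<beta> \<in> one_forms M \<Longrightarrow> kb \<alpha> \<beta> = - kb \<beta> \<alpha>"
  using ev2_skew[of \<alpha> \<beta>] dff_uminus[OF ev2_Cinf, of \<beta> \<alpha>] by (simp add: koszul_def)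

lemma koszul_add: "\<alpha> \<in> one_forms M \<Longrightarrow> \<beta> \<in> one_forms M \<Longrightarrow> \<beta>' \<in> one_forms M \<Longrightarrow>
    kb \<alpha> (\<beta> + \<beta>') = kb \<alpha> \<beta> + kb \<alpha> \<beta>'"
  by (simp add: koszul_def lie_form_add sharp_add lie_form_add_field sharp_vf ev2_add dff_add ev2_Cinf)



lemma koszul_zero: "\<alpha> \<in> one_forms M \<Longrightarrow> kb \<alpha> 0 = 0"
  using koszul_add[of \<alpha> 0 0] one_forms_zero by simp

lemma koszul_uminus: "\<alpha> \<in> one_forms M \<Longrightarrow> \<beta> \<in> one_forms M \<Longrightarrow> kb \<alpha> (- \<beta>) = - kb \<alpha> \<beta>"
  using koszul_add[of \<alpha> \<beta> "- \<beta>"] one_forms_uminus[of \<beta>] koszul_zero[of \<alpha>]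
  by (simp add: eq_neg_iff_add_eq_0 add.commute)

text \<open>The term \<pi>(\<alpha>, \<beta>) df arises twice with opposite signs, from the Lie
  derivative along the rescaled field of \<beta> and from d(f \<pi>(\<alpha>, \<beta>)); only the
  anchor term survives.\<close>

lemma koszul_leibniz:
  assumes a: "\<alpha> \<in> one_forms M" and b: "\<beta> \<in> one_forms M" and f: "f \<in> Cinf M"
  shows "kb \<alpha> (fscale f \<beta>) = fscale f (kb \<alpha> \<beta>) + fscale (act (sharp M \<pi> \<alpha>) f) \<beta>"
proof -
  have 1: "ev \<alpha> (sharp M \<pi> \<beta>) = - ev2 \<pi> \<alpha> \<beta>"
    using ev_sharp[OF b a] ev2_skew[OF a b] by simp
  show ?thesis
    unfolding koszul_def ev2_fscale[OF a b] sharp_fscale[OF b]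
      lie_form_fscale[OF sharp_vf[OF a] b f] lie_form_scale_field[OF sharp_vf[OF b] a f] 1
      dff_mult[OF f ev2_Cinf[OF a b]]
    by (auto simp: fun_eq_iff algebra_simps)
qed

text \<open>Each of the two Lie derivatives contributes one d{f, g}, and the last term takes one
  copy away.\<close>

lemma koszul_dff:
  assumes f: "f \<in> Cinf M" and g: "g \<in> Cinf M"
  shows "kb (dff M f) (dff M g) = dff M (pbracket M \<pi> f g)"
proof -
  have "pbracket M \<pi> g f = - pbracket M \<pi> f g"
    using ev2_skew[OF dff_one_form[OF g] dff_one_form[OF f]] by (simp add: pbracket_def)
  then show ?thesis
    using f g by (simp add: koszul_def lie_form_dff sharp_vf dff_one_form act_sharp_dff dff_uminus pbracket_Cinf)
       (simp add: pbracket_def)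
qed

text \<open>The difference d of the forms vanishes near p, so \<theta> d = 0 for a cut-off with
  \<theta> p = 1; the Leibniz rule for this product leaves the bracket with d at p.\<close>

lemma koszul_local:
  assumes a: "\<alpha> \<in> one_forms M" and b: "\<beta> \<in> one_forms M" "\<beta>' \<in> one_forms M" and p: "p \<in> pts M"
    and ev: "\<forall>\<^sub>F q in nbM p. \<beta> q = \<beta>' q"
  shows "kb \<alpha> \<beta> p = kb \<alpha> \<beta>' p"
proof -
  let ?d = "\<beta> - \<beta>'"
  have d: "?d \<in> one_forms M" using b by (rule one_forms_diff)
  have ev0: "\<forall>\<^sub>F q in nbM p. ?d q = 0" using ev by eventually_elim simp
  obtain \<theta> where th: "\<theta> \<in> Cinf M" "\<theta> p = 1" "\<forall>q. \<theta> q = 0 \<or> ?d q = 0"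
    using bump_point[OF p ev0] by blast
  have "\<theta> q * ?d q v = 0" for q v using spec[OF th(3), of q] by auto
  then have "fscale \<theta> ?d = 0" by (simp add: fun_eq_iff)
  then have "0 = (fscale \<theta> (kb \<alpha> ?d) + fscale (act (sharp M \<pi> \<alpha>) \<theta>) ?d) p"
    using koszul_leibniz[OF a d th(1)] koszul_zero[OF a] by simp
  moreover have "?d p = 0" using eventually_nb_self[OF ev0 p] .
  moreover note th(2)
  ultimately have "kb \<alpha> ?d p = 0" by (simp add: fun_eq_iff)
  moreover have "kb \<alpha> \<beta> = kb \<alpha> ?d + kb \<alpha> \<beta>'" using koszul_add[OF a d b(2)] by simp
  ultimately show ?thesis by simp
qed

lemma koszul_local2:
  assumes a: "\<alpha> \<in> one_forms M" "\<alpha>' \<in> one_forms M" and b: "\<beta> \<in> one_forms M" "\<beta>' \<in> one_forms M" and p: "p \<in> pts M"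
    and ev: "\<forall>\<^sub>F q in nbM p. \<alpha> q = \<alpha>' q" "\<forall>\<^sub>F q in nbM p. \<beta> q = \<beta>' q"
  shows "kb \<alpha> \<beta> p = kb \<alpha>' \<beta>' p"
  using koszul_local[OF a(1) b p ev(2)] koszul_local[OF b(2) a p ev(1)]
    koszul_skew[OF a(1) b(2)] koszul_skew[OF a(2) b(2)] by simp

lemma jacobi: "f \<in> Cinf M \<Longrightarrow> g \<in> Cinf M \<Longrightarrow> h \<in> Cinf M \<Longrightarrow>
    pbracket M \<pi> f (pbracket M \<pi> g h) = pbracket M \<pi> (pbracket M \<pi> f g) h + pbracket M \<pi> g (pbracket M \<pi> f h)"
proof -
  assume f: "f \<in> Cinf M" and g: "g \<in> Cinf M" and h: "h \<in> Cinf M"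
  have sk: "pbracket M \<pi> a b = - pbracket M \<pi> b a" if "a \<in> Cinf M" "b \<in> Cinf M" for a b
    using ev2_skew[OF dff_one_form[OF that(1)] dff_one_form[OF that(2)]] by (simp only: pbracket_def)
  have un: "pbracket M \<pi> a (- b) = - pbracket M \<pi> a b" if "a \<in> Cinf M" "b \<in> Cinf M" for a b
  proof
    fix p
    show "pbracket M \<pi> a (- b) p = (- pbracket M \<pi> a b) p"
      using tangent_uminus[OF vf_tangent'[OF sharp_vf[OF dff_one_form[OF that(1)]], of p] that(2)] that
      by (simp add: sharp_dff Cinf_uminus)
  qed
  have "pbracket M \<pi> f (pbracket M \<pi> g h) + pbracket M \<pi> g (pbracket M \<pi> h f) + pbracket M \<pi> h (pbracket M \<pi> f g) = 0"
    using poisson f g h by (simp add: poisson_manifold_def)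
  moreover have "pbracket M \<pi> g (pbracket M \<pi> h f) = - pbracket M \<pi> g (pbracket M \<pi> f h)"
    using sk[OF h f] un[OF g pbracket_Cinf[OF f h]] by simp
  moreover have "pbracket M \<pi> h (pbracket M \<pi> f g) = - pbracket M \<pi> (pbracket M \<pi> f g) h"
    using sk[OF h pbracket_Cinf[OF f g]] .
  ultimately show ?thesis by (simp add: algebra_simps)
qed



text \<open>For fixed h the defect T is skew and function-linear, and on differentials it is the
  Jacobi identity of the Poisson bracket. It precedes the Jacobi identity of the Koszul bracket,
  whose Jacobiator is tensorial thanks to it.\<close>

lemma koszul_anchor:
  assumes a: "\<alpha> \<in> one_forms M" and b: "\<beta> \<in> one_forms M" and h: "h \<in> Cinf M"
  shows "act (sharp M \<pi> (kb \<alpha> \<beta>)) h =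
    act (sharp M \<pi> \<alpha>) (act (sharp M \<pi> \<beta>) h) - act (sharp M \<pi> \<beta>) (act (sharp M \<pi> \<alpha>) h)"
proof
  fix p
  let ?S = "sharp M \<pi>"
  define T where "T \<alpha> \<beta> = ?S (kb \<alpha> \<beta>) p h - ?S \<alpha> p (act (?S \<beta>) h) + ?S \<beta> p (act (?S \<alpha>) h)" for \<alpha> \<beta>
  have "T \<alpha> \<beta> = 0" if p: "p \<in> pts M"
  proof -
    note t = vf_tangent'[OF sharp_vf] and c = vf_act[OF sharp_vf]
    have add: "T \<alpha> (\<beta> + \<beta>') = T \<alpha> \<beta> + T \<alpha> \<beta>'"
      if "\<alpha> \<in> one_forms M" "\<beta> \<in> one_forms M" "\<beta>' \<in> one_forms M" for \<alpha> \<beta> \<beta>'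
    proof -
      have "act (?S \<beta> + ?S \<beta>') h = act (?S \<beta>) h + act (?S \<beta>') h" by (simp add: act_def fun_eq_iff)
      then show ?thesis using that h
        by (simp add: T_def koszul_add sharp_add koszul_one_form tangent_add[OF t c c])
    qed
    have scale: "T \<alpha> (fscale f \<beta>) = f p * T \<alpha> \<beta>"
      if "f \<in> Cinf M" "\<alpha> \<in> one_forms M" "\<beta> \<in> one_forms M" for \<alpha> \<beta> f
    proof -
      have ap: "act X f p = X p f" for X and f :: "'m \<Rightarrow> real" by (simp add: act_def)
      have "act (\<lambda>p g. f p * ?S \<beta> p g) h = f * act (?S \<beta>) h" by (simp add: act_def fun_eq_iff)
      then show ?thesis using that h
        by (simp add: T_def koszul_leibniz sharp_add sharp_fscale koszul_one_form one_forms_fscale c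
            tangent_mult[OF t _ c] ap algebra_simps)
    qed
    have skew: "T \<alpha> \<beta> = - T \<beta> \<alpha>" if "\<alpha> \<in> one_forms M" "\<beta> \<in> one_forms M" for \<alpha> \<beta>
    proof -
      have "?S (- \<gamma>) p h = - ?S \<gamma> p h" if "\<gamma> \<in> one_forms M" for \<gamma>
      proof -
        have "- \<gamma> = fscale (- one) \<gamma>" using one_forms_outside[OF that] by (auto simp: fun_eq_iff one_def)
        then show ?thesis using sharp_fscale[OF that, of "- one"] p by simp
      qed
      then show ?thesis using koszul_skew[OF that] koszul_one_form[OF that(2,1)] by (simp add: T_def)
    qed
    have exact: "T (dff M f) (dff M g) = 0" if "f \<in> Cinf M" "g \<in> Cinf M" for f g
      using jacobi[OF that h] that h pbracket_Cinf
      by (simp add: T_def koszul_dff sharp_dff act_sharp_dff)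
    show ?thesis
      by (rule tensor_zero_skew[where T = T, OF p add scale skew exact a b])
  qed
  then show "act (?S (kb \<alpha> \<beta>)) h p = (act (?S \<alpha>) (act (?S \<beta>) h) - act (?S \<beta>) (act (?S \<alpha>) h)) p"
    using vf_outside[OF sharp_vf, of _ p] a b koszul_one_form
    by (cases "p \<in> pts M") (auto simp: act_def T_def)
qed

lemma koszul_jacobi:
  assumes "\<alpha> \<in> one_forms M" "\<beta> \<in> one_forms M" "\<gamma> \<in> one_forms M"
  shows "kb \<alpha> (kb \<beta> \<gamma>) = kb (kb \<alpha> \<beta>) \<gamma> + kb \<beta> (kb \<alpha> \<gamma>)"
proof (intro ext)
  fix p v
  define J where "J \<alpha> \<beta> \<gamma> = kb \<alpha> (kb \<beta> \<gamma>) - kb (kb \<alpha> \<beta>) \<gamma> - kb \<beta> (kb \<alpha> \<gamma>)" for \<alpha> \<beta> \<gamma>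
  note k = koszul_one_form
  have "J \<alpha> \<beta> \<gamma> p v = 0" if p: "p \<in> pts M"
  proof -
    have add: "J \<alpha> \<beta> (\<gamma> + \<gamma>') = J \<alpha> \<beta> \<gamma> + J \<alpha> \<beta> \<gamma>'"
      if "\<alpha> \<in> one_forms M" "\<beta> \<in> one_forms M" "\<gamma> \<in> one_forms M" "\<gamma>' \<in> one_forms M" for \<alpha> \<beta> \<gamma> \<gamma>'
      using that by (simp add: J_def koszul_add k algebra_simps)
    \<comment> \<open>The terms in which f is differentiated twice cancel because the anchor
      respects brackets.\<close>
    have scale: "J \<alpha> \<beta> (fscale f \<gamma>) = fscale f (J \<alpha> \<beta> \<gamma>)"
      if "\<alpha> \<in> one_forms M" "\<beta> \<in> one_forms M" "\<gamma> \<in> one_forms M" "f \<in> Cinf M" for \<alpha> \<beta> \<gamma> f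
    proof -
      note c = vf_act[OF sharp_vf]
      show ?thesis using that
        by (simp add: J_def koszul_leibniz koszul_add k one_forms_fscale c koszul_anchor)
           (auto simp: fun_eq_iff algebra_simps)
    qed
    have un: "kb (- \<alpha>) \<beta> = - kb \<alpha> \<beta>" if "\<alpha> \<in> one_forms M" "\<beta> \<in> one_forms M" for \<alpha> \<beta>
      using koszul_skew[OF one_forms_uminus[OF that(1)] that(2)] koszul_uminus[OF that(2,1)] koszul_skew[OF that] by simp
    \<comment> \<open>Tensoriality of the Jacobiator is at hand in the third slot; the two
      transpositions give access to the others.\<close>
    have sk12: "J \<alpha> \<beta> \<gamma> = - J \<beta> \<alpha> \<gamma>"
      if "\<alpha> \<in> one_forms M" "\<beta> \<in> one_forms M" "\<gamma> \<in> one_forms M" for \<alpha> \<beta> \<gamma>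
      using koszul_skew[OF that(1,2)] un[OF k[OF that(2,1)] that(3)] by (simp add: J_def)
    have sk23: "J \<alpha> \<beta> \<gamma> = - J \<alpha> \<gamma> \<beta>"
      if "\<alpha> \<in> one_forms M" "\<beta> \<in> one_forms M" "\<gamma> \<in> one_forms M" for \<alpha> \<beta> \<gamma>
      using koszul_skew[OF that(2,3)] koszul_uminus[OF that(1) k[OF that(3,2)]]
        koszul_skew[OF k[OF that(1,2)] that(3)] koszul_skew[OF that(2) k[OF that(1,3)]]
      by (simp add: J_def)
    have T: "J \<alpha> \<beta> \<gamma> p v = 0"
      if "\<And>h. h \<in> Cinf M \<Longrightarrow> J \<alpha> \<beta> (dff M h) = 0" and "\<alpha> \<in> one_forms M" "\<beta> \<in> one_forms M" "\<gamma> \<in> one_forms M"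
      for \<alpha> \<beta> \<gamma> p v
    proof (cases "p \<in> pts M")
      case True
      show ?thesis by (rule tensor_zero[OF True, of "\<lambda>\<gamma>. J \<alpha> \<beta> \<gamma> p v"]) (use that add scale in auto)
    next
      case False
      have "J \<alpha> \<beta> \<gamma> \<in> one_forms M" unfolding J_def by (intro one_forms_diff k that)
      then show ?thesis using one_forms_outside False by simp
    qed
    \<comment> \<open>The slots are freed one at a time, starting from three differentials, where
      the identity is that of the Poisson bracket.\<close>
    have J1: "J (dff M f) (dff M g) \<gamma> = 0"
      if "f \<in> Cinf M" "g \<in> Cinf M" "\<gamma> \<in> one_forms M" for f g \<gamma>
    proof (intro ext)
      fix p v
      have "J (dff M f) (dff M g) (dff M h) = 0" if h: "h \<in> Cinf M" for h
        using jacobi[OF \<open>f \<in> Cinf M\<close> \<open>g \<in> Cinf M\<close> h] that \<open>f \<in> Cinf M\<close> \<open>g \<in> Cinf M\<close> pbracket_Cinf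
        by (simp add: J_def koszul_dff dff_add)
      then show "J (dff M f) (dff M g) \<gamma> p v = 0 p v"
        using T[of "dff M f" "dff M g" \<gamma>] that dff_one_form by simp
    qed
    have J2: "J (dff M f) \<beta> \<gamma> = 0"
      if "f \<in> Cinf M" "\<beta> \<in> one_forms M" "\<gamma> \<in> one_forms M" for f \<beta> \<gamma>
    proof (intro ext)
      fix p v
      have "J (dff M f) \<beta> (dff M g) = 0" if "g \<in> Cinf M" for g
        using sk23[of "dff M f" \<beta> "dff M g"] J1[of f g \<beta>] that \<open>f \<in> Cinf M\<close> \<open>\<beta> \<in> one_forms M\<close> dff_one_form by simp
      then show "J (dff M f) \<beta> \<gamma> p v = 0 p v"
        using T[of "dff M f" \<beta> \<gamma>] that dff_one_form by simp
    qed
    have "J \<alpha> \<beta> (dff M f) = 0" if f: "f \<in> Cinf M" for f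
      using sk23[OF assms(1,2) dff_one_form[OF f]] sk12[OF assms(1) dff_one_form[OF f] assms(2)]
        J2[OF f assms(1,2)] by simp
    then show ?thesis using T assms by blast
  qed
  moreover have "J \<alpha> \<beta> \<gamma> p v = 0" if "p \<notin> pts M"
  proof -
    have "J \<alpha> \<beta> \<gamma> \<in> one_forms M" unfolding J_def by (intro one_forms_diff k assms)
    then show ?thesis using one_forms_outside that by simp
  qed
  ultimately show "kb \<alpha> (kb \<beta> \<gamma>) p v = (kb (kb \<alpha> \<beta>) \<gamma> + kb \<beta> (kb \<alpha> \<gamma>)) p v"
    by (cases "p \<in> pts M") (simp_all add: J_def)
qed

end

section \<open>The restricted Lie algebroid over a Poisson submanifold\<close>

context submanifold
begin

lemma restr_form_apply: "w \<in> tangent N p \<Longrightarrow> restr_form M N a p w = a p (push M N w)"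
  by (simp add: restr_form_def)

lemma restr_form_add: "restr_form M N (a + b) = restr_form M N a + restr_form M N b"
  and restr_form_fscale: "restr_form M N (fscale f a) = fscale f (restr_form M N a)"
  and restr_form_diff: "restr_form M N (a - b) = restr_form M N a - restr_form M N b"
  by (auto simp: restr_form_def fun_eq_iff)

lemma restr_form_pt:
  assumes "a p = b p" shows "restr_form M N a p = restr_form M N b p"
  unfolding restr_form_def assms ..

lemma restr_form_dff: "p \<in> pts N \<Longrightarrow> g \<in> Cinf M \<Longrightarrow> restr_form M N (dff M g) p = dff N (restr N g) p"
  using push_tangent pts_sub by (auto simp: restr_form_def dff_def fun_eq_iff push_apply)

lemma restr_form_sum: "restr_form M N (\<Sum>i\<in>I. a i) p = (\<Sum>i\<in>I. restr_form M N (a i) p)"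
  by (auto simp: restr_form_def fun_eq_iff sum_fun_apply)

lemma restr_form_off:
  assumes "p \<notin> pts N" "a p \<in> cotangent M p" shows "restr_form M N a p = 0"
proof
  fix w
  show "restr_form M N a p w = 0 w"
  proof (cases "w \<in> tangent N p")
    case True
    then have "w = 0" using N.tangent_off assms(1) by blast
    then show ?thesis using M.cotangent_zero[OF assms(2)] by (simp add: restr_form_def push_zero)
  qed (simp add: restr_form_def)
qed

lemma section_presentation:
  assumes a: "a \<in> cosections M N" and p: "p \<in> pts N"
  obtains B f x where "finite (B::'e set)" "\<And>b. b \<in> B \<Longrightarrow> f b \<in> Cinf N" "\<And>b. b \<in> B \<Longrightarrow> x b \<in> Cinf M"
    "\<forall>\<^sub>F q in nbN p. a q = (\<Sum>b\<in>B. fscale (f b) (dff M (x b))) q"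
proof -
  have pM: "p \<in> pts M" using p pts_sub by auto
  obtain B x X where fr: "finite (B::'e set)" "\<And>b. b \<in> B \<Longrightarrow> x b \<in> Cinf M" "\<And>b. b \<in> B \<Longrightarrow> X b \<in> vector_fields M"
    "\<forall>\<^sub>F q in nbM p. \<forall>v\<in>tangent M q. v = (\<lambda>f. \<Sum>b\<in>B. v (x b) * X b q f)"
    using M.frame[OF pM] by blast
  have "\<forall>\<^sub>F q in nbN p. a q = (\<Sum>b\<in>B. fscale (ev a (X b)) (dff M (x b))) q"
    using nbM_nbN[OF fr(4)] eventually_nb_in
  proof eventually_elim
    case (elim q)
    have qM: "q \<in> pts M" using elim pts_sub by auto
    have fe: "a q = (\<lambda>v. \<Sum>b\<in>B. a q (X b q) * dff M (x b) q v)"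
      by (rule M.frame_expand[where B = B and x = x and X = X, OF elim(1) _ qM N.cosections_cotangent'[OF a]])
         (use fr(3) M.vf_tangent' in auto)
    show ?case
      by (rule ext, unfold sum_fun_apply fscale_apply ev_def, rule fun_cong[OF fe])
  qed
  then show ?thesis using that[of B "\<lambda>b. ev a (X b)" x] fr(1,2) N.cosections_ev[OF a fr(3)] by blast
qed

text \<open>Only the coefficients live on N and need extending; the differentials are already those
  of functions on M.\<close>

lemma section_extend:
  assumes a: "a \<in> cosections M N" and p: "p \<in> pts N"
  obtains \<alpha> where "\<alpha> \<in> one_forms M" "\<forall>\<^sub>F q in nbN p. \<alpha> q = a q"
proof -
  obtain B f x where fr: "finite (B::'e set)" "\<And>b. b \<in> B \<Longrightarrow> f b \<in> Cinf N" "\<And>b. b \<in> B \<Longrightarrow> x b \<in> Cinf M"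
    "\<forall>\<^sub>F q in nbN p. a q = (\<Sum>b\<in>B. fscale (f b) (dff M (x b))) q"
    using section_presentation[OF a p] by blast
  have "\<exists>F. F \<in> Cinf M \<and> (\<forall>\<^sub>F q in nbN p. F q = f b q)" if "b \<in> B" for b
    using Cinf_extend[OF fr(2)[OF that] p] by metis
  then obtain F where F: "\<And>b. b \<in> B \<Longrightarrow> F b \<in> Cinf M" "\<And>b. b \<in> B \<Longrightarrow> \<forall>\<^sub>F q in nbN p. F b q = f b q"
    by metis
  show ?thesis
  proof (rule that)
    show "(\<Sum>b\<in>B. fscale (F b) (dff M (x b))) \<in> one_forms M"
      by (intro M.one_forms_sum M.one_forms_fscale M.dff_one_form F fr)
    have "\<forall>\<^sub>F q in nbN p. \<forall>b\<in>B. F b q = f b q"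
      using F(2) fr(1) by (simp add: eventually_ball_finite_distrib)
    then show "\<forall>\<^sub>F q in nbN p. (\<Sum>b\<in>B. fscale (F b) (dff M (x b))) q = a q"
      using fr(4)
    proof eventually_elim
      case (elim q)
      then show ?case by (simp add: fun_eq_iff sum_fun_apply)
    qed
  qed
qed

lemma extends_near_iff: "p \<in> pts N \<Longrightarrow> extends_near N p \<alpha> a \<longleftrightarrow> (\<forall>\<^sub>F q in nbN p. \<alpha> q = a q)"
  unfolding extends_near_def eventually_nb openin_open by blast

lemma restr_form_one_form:
  assumes a: "a \<in> cosections M N" shows "restr_form M N a \<in> one_forms N"
  unfolding one_forms_def
proof (rule N.cosections_local)
  show "restr_form M N a p = 0" if "p \<notin> pts N" for p
    by (rule restr_form_off[where a = a, OF that N.cosections_cotangent'[OF a]])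
next
  fix p assume p: "p \<in> pts N"
  obtain B f x where fr: "finite (B::'e set)" "\<And>b. b \<in> B \<Longrightarrow> f b \<in> Cinf N" "\<And>b. b \<in> B \<Longrightarrow> x b \<in> Cinf M"
    "\<forall>\<^sub>F q in nbN p. a q = (\<Sum>b\<in>B. fscale (f b) (dff M (x b))) q"
    using section_presentation[OF a p] by blast
  let ?s = "\<Sum>b\<in>B. fscale (f b) (dff N (restr N (x b)))"
  have "?s \<in> cosections N N"
    unfolding one_forms_def[symmetric]
    by (intro N.one_forms_sum N.one_forms_fscale N.dff_one_form restr_Cinf fr)
  moreover have "\<forall>\<^sub>F q in nbN p. restr_form M N a q = ?s q"
    using fr(4) eventually_nb_in
  proof eventually_elim
    case (elim q)
    have "restr_form M N a q = restr_form M N (\<Sum>b\<in>B. fscale (f b) (dff M (x b))) q"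
      by (rule restr_form_pt) (rule elim)
    also have "\<dots> = ?s q"
      unfolding restr_form_sum restr_form_fscale
      using restr_form_dff[OF elim(2) fr(3)] by (simp add: fun_eq_iff sum_fun_apply)
    finally show ?case .
  qed
  ultimately show "\<exists>b\<in>cosections N N. \<forall>\<^sub>F q in nbN p. restr_form M N a q = b q" by blast
qed

definition restr_sec :: "'m cofield \<Rightarrow> 'm cofield" where
  "restr_sec \<alpha> q = (if q \<in> pts N then \<alpha> q else 0)"

lemma restr_sec_cosection:
  assumes "\<alpha> \<in> one_forms M" shows "restr_sec \<alpha> \<in> cosections M N"
proof -
  have "ev (restr_sec \<alpha>) X = restr N (ev \<alpha> X)" for X
    by (simp add: ev_def restr_sec_def restr_def fun_eq_iff)
  then show ?thesis
    using assms M.one_forms_cotangent[OF assms] restr_Cinf[OF M.one_forms_ev[OF assms]]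
    by (simp add: cosections_def restr_sec_def)
qed

lemma restr_form_restr_sec:
  assumes "\<alpha> \<in> one_forms M" shows "restr_form M N (restr_sec \<alpha>) = restr_form M N \<alpha>"
proof
  fix p
  show "restr_form M N (restr_sec \<alpha>) p = restr_form M N \<alpha> p"
  proof (cases "p \<in> pts N")
    case False
    then show ?thesis
      using restr_form_off[where a = \<alpha>, OF False M.one_forms_cotangent[OF assms]]
        restr_form_off[where a = "restr_sec \<alpha>", OF False N.cosections_cotangent'[OF restr_sec_cosection[OF assms]]]
      by simp
  qed (auto intro: restr_form_pt simp: restr_sec_def)
qed

lemma restr_form_one_form': "\<alpha> \<in> one_forms M \<Longrightarrow> restr_form M N \<alpha> \<in> one_forms N"
  using restr_form_one_form[OF restr_sec_cosection] restr_form_restr_sec by metis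

end

section \<open>Bracket and anchor over the Poisson submanifold\<close>

locale psub = submanifold M N + M: poisson M \<pi> + N: poisson N \<psi>
  for M N :: "('m::{t2_space,second_countable_topology}, 'e::euclidean_space) mfd" and \<pi> \<psi> :: "'m bivec" +
  assumes psub: "poisson_submanifold N \<psi> M \<pi>"
begin

lemma pbracket_restr: "f \<in> Cinf M \<Longrightarrow> g \<in> Cinf M \<Longrightarrow>
    pbracket N \<psi> (restr N f) (restr N g) = restr N (pbracket M \<pi> f g)"
  using psub by (simp add: poisson_submanifold_def)

text \<open>At p the form is a differential, and then this is the inclusion being a Poisson map. In
  particular the field of \<alpha> is tangent to N along N: it sees only the restriction of
  F.\<close>

lemma sharp_restr:
  assumes a: "\<alpha> \<in> one_forms M" and F: "F \<in> Cinf M" and p: "p \<in> pts N"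
  shows "sharp M \<pi> \<alpha> p F = sharp N \<psi> (restr_form M N \<alpha>) p (restr N F)"
proof -
  have pM: "p \<in> pts M" using p pts_sub by auto
  obtain g where g: "g \<in> Cinf M" "\<alpha> p = dff M g p"
    using M.covector_exact[OF pM M.one_forms_cotangent[OF a]] .
  have "sharp M \<pi> \<alpha> p F = pbracket M \<pi> g F p"
    using F g by (simp add: M.sharp_apply pbracket_def ev2_def)
  also have "\<dots> = pbracket N \<psi> (restr N g) (restr N F) p"
    using pbracket_restr[OF g(1) F] p by simp
  also have "\<dots> = sharp N \<psi> (restr_form M N \<alpha>) p (restr N F)"
    using restr_form_pt[where a = \<alpha> and b = "dff M g" and p = p, OF g(2)] restr_form_dff[OF p g(1)] restr_Cinf[OF F]
    by (simp add: N.sharp_apply pbracket_def ev2_def)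
  finally show ?thesis .
qed

text \<open>This makes the bracket over N well defined. The difference of two extensions is a sum of
  f_b dx_b with f_b zero along N near p; by the Leibniz rule the bracket at p involves f_b(p) and
  the derivative of f_b in a direction tangent to N, both zero.\<close>

lemma koszul_ext:
  assumes a: "\<alpha> \<in> one_forms M" and b: "\<beta> \<in> one_forms M" "\<beta>' \<in> one_forms M" and p: "p \<in> pts N"
    and ev: "\<forall>\<^sub>F q in nbN p. \<beta> q = \<beta>' q"
  shows "koszul M \<pi> \<alpha> \<beta> p = koszul M \<pi> \<alpha> \<beta>' p"
proof -
  have pM: "p \<in> pts M" using p pts_sub by auto
  let ?d = "\<beta> - \<beta>'"
  have d: "?d \<in> one_forms M" using b by (rule M.one_forms_diff)
  obtain B f x where Bfx: "finite (B::'e set) \<and> (\<forall>b\<in>B. f b \<in> Cinf M \<and> x b \<in> Cinf M) \<and>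
      (\<forall>\<^sub>F q in nbM p. ?d q = (\<Sum>b\<in>B. fscale (f b) (dff M (x b))) q) \<and> (\<forall>b q. ?d q = 0 \<longrightarrow> f b q = 0)"
    using M.local_presentation_vanishing[OF pM d] by (elim exE)
  note finB = conjunct1[OF Bfx] and fx = conjunct1[OF conjunct2[OF Bfx]] and pr = conjunct2[OF conjunct2[OF Bfx]]
  have f: "\<And>b. b \<in> B \<Longrightarrow> f b \<in> Cinf M" and x: "\<And>b. b \<in> B \<Longrightarrow> x b \<in> Cinf M" using fx by blast+
  let ?s = "\<Sum>b\<in>B. fscale (f b) (dff M (x b))"
  have s: "?s \<in> one_forms M" by (intro M.one_forms_sum M.one_forms_fscale M.dff_one_form f x)
  have 1: "koszul M \<pi> \<alpha> ?d p = koszul M \<pi> \<alpha> ?s p" by (rule M.koszul_local[OF a d s pM conjunct1[OF pr]])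
  have zero: "koszul M \<pi> \<alpha> (fscale (f b) (dff M (x b))) p = 0" if b: "b \<in> B" for b
  proof -
    have f0: "\<forall>\<^sub>F q in nbN p. f b q = 0"
      using ev
    proof eventually_elim
      case (elim q)
      then show ?case by (intro mp[OF spec[OF spec[OF conjunct2[OF pr]]]]) simp
    qed
    have "sharp M \<pi> \<alpha> p (f b) = sharp N \<psi> (restr_form M N \<alpha>) p (restr N (f b))"
      using sharp_restr[OF a f[OF b] p] .
    also have "\<dots> = 0"
    proof (rule N.tangent_const[OF N.vf_tangent'[OF N.sharp_vf[OF restr_form_one_form'[OF a]]] p restr_Cinf[OF f[OF b]]])
      show "\<forall>\<^sub>F q in nbN p. restr N (f b) q = 0"
        using f0 eventually_nb_in by eventually_elim simp
    qed
    finally show ?thesis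
      using eventually_nb_self[OF f0 p] M.koszul_leibniz[OF a M.dff_one_form[OF x[OF b]] f[OF b]]
      by (simp add: fun_eq_iff act_def)
  qed
  have "koszul M \<pi> \<alpha> ?d p = 0"
  proof
    fix v
    have "koszul M \<pi> \<alpha> ?s p v = (\<Sum>b\<in>B. koszul M \<pi> \<alpha> (fscale (f b) (dff M (x b))) p v)"
    proof (rule M.additive_sum[where T = "\<lambda>\<gamma>. koszul M \<pi> \<alpha> \<gamma> p v", OF _ finB])
      show "koszul M \<pi> \<alpha> (\<gamma> + \<gamma>') p v = koszul M \<pi> \<alpha> \<gamma> p v + koszul M \<pi> \<alpha> \<gamma>' p v"
        if "\<gamma> \<in> one_forms M" "\<gamma>' \<in> one_forms M" for \<gamma> \<gamma>'
        unfolding M.koszul_add[OF a that] plus_fun_apply ..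
    qed (intro M.one_forms_fscale M.dff_one_form f x)
    then show "koszul M \<pi> \<alpha> ?d p v = 0 v" by (simp add: 1 zero)
  qed
  moreover have "koszul M \<pi> \<alpha> \<beta> = koszul M \<pi> \<alpha> ?d + koszul M \<pi> \<alpha> \<beta>'"
    using M.koszul_add[OF a d b(2)] by simp
  ultimately show ?thesis by simp
qed

lemma koszul_ext2:
  assumes a: "\<alpha> \<in> one_forms M" "\<alpha>' \<in> one_forms M" and b: "\<beta> \<in> one_forms M" "\<beta>' \<in> one_forms M" and p: "p \<in> pts N"
    and ev: "\<forall>\<^sub>F q in nbN p. \<alpha> q = \<alpha>' q" "\<forall>\<^sub>F q in nbN p. \<beta> q = \<beta>' q"
  shows "koszul M \<pi> \<alpha> \<beta> p = koszul M \<pi> \<alpha>' \<beta>' p"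
  using koszul_ext[OF a(1) b p ev(2)] koszul_ext[OF b(2) a p ev(1)]
    M.koszul_skew[OF a(1) b(2)] M.koszul_skew[OF a(2) b(2)] by simp

abbreviation L :: "'m cofield set" where "L \<equiv> cosections M N"
abbreviation bS :: "'m cofield \<Rightarrow> 'm cofield \<Rightarrow> 'm cofield" where "bS \<equiv> bracketS M \<pi> N"
abbreviation rho :: "'m cofield \<Rightarrow> ('m \<Rightarrow> real) \<Rightarrow> 'm \<Rightarrow> real" where
  "rho a \<equiv> act (sharp N \<psi> (restr_form M N a))"

text \<open>Resolves the definite description. Extensions are chosen separately at every point; by
  \<open>koszul_ext2\<close> the values do not depend on the choice, so near p the section is
  computed by the pair chosen at p and is smooth.\<close>

lemma bracketS_spec:
  assumes a: "a \<in> L" and b: "b \<in> L"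
  shows "bS a b \<in> L \<and> (\<forall>p\<in>pts N. \<forall>\<alpha>\<in>one_forms M. \<forall>\<beta>\<in>one_forms M.
        extends_near N p \<alpha> a \<and> extends_near N p \<beta> b \<longrightarrow> bS a b p = koszul M \<pi> \<alpha> \<beta> p)"
proof -
  have ext: "\<forall>p\<in>pts N. \<exists>\<alpha>. \<alpha> \<in> one_forms M \<and> (\<forall>\<^sub>F q in nbN p. \<alpha> q = a q)" if "a \<in> L" for a
    using section_extend[OF that] by metis
  obtain A where "\<forall>p\<in>pts N. A p \<in> one_forms M \<and> (\<forall>\<^sub>F q in nbN p. A p q = a q)"
    using bchoice[OF ext[OF a]] by blast
  then have A: "\<And>p. p \<in> pts N \<Longrightarrow> A p \<in> one_forms M" "\<And>p. p \<in> pts N \<Longrightarrow> \<forall>\<^sub>F q in nbN p. A p q = a q"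
    by auto
  obtain B where "\<forall>p\<in>pts N. B p \<in> one_forms M \<and> (\<forall>\<^sub>F q in nbN p. B p q = b q)"
    using bchoice[OF ext[OF b]] by blast
  then have B: "\<And>p. p \<in> pts N \<Longrightarrow> B p \<in> one_forms M" "\<And>p. p \<in> pts N \<Longrightarrow> \<forall>\<^sub>F q in nbN p. B p q = b q"
    by auto
  define c where "c p = (if p \<in> pts N then koszul M \<pi> (A p) (B p) p else 0)" for p
  have c: "c p = koszul M \<pi> \<alpha> \<beta> p"
    if p: "p \<in> pts N" and "\<alpha> \<in> one_forms M" "\<beta> \<in> one_forms M"
      "\<forall>\<^sub>F q in nbN p. \<alpha> q = a q" "\<forall>\<^sub>F q in nbN p. \<beta> q = b q" for p \<alpha> \<beta>
  proof -
    have "\<forall>\<^sub>F q in nbN p. A p q = \<alpha> q" using A(2)[OF p] that(4) by eventually_elim simp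
    moreover have "\<forall>\<^sub>F q in nbN p. B p q = \<beta> q" using B(2)[OF p] that(5) by eventually_elim simp
    ultimately show ?thesis using koszul_ext2[OF A(1)[OF p] that(2) B(1)[OF p] that(3) p] p by (simp add: c_def)
  qed
  have "c \<in> L"
  proof (rule N.cosections_local)
    fix p assume p: "p \<in> pts N"
    let ?k = "restr_sec (koszul M \<pi> (A p) (B p))"
    have "\<forall>\<^sub>F q in nbN p. c q = ?k q"
      using eventually_nb_nb[OF A(2)[OF p]] eventually_nb_nb[OF B(2)[OF p]] eventually_nb_in
      by eventually_elim (use c A(1)[OF p] B(1)[OF p] in \<open>simp add: restr_sec_def\<close>)
    then show "\<exists>k\<in>L. \<forall>\<^sub>F q in nbN p. c q = k q"
      using restr_sec_cosection[OF M.koszul_one_form[OF A(1)[OF p] B(1)[OF p]]] by blast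
  qed (simp add: c_def)
  then have ex: "c \<in> L \<and> (\<forall>p\<in>pts N. \<forall>\<alpha>\<in>one_forms M. \<forall>\<beta>\<in>one_forms M.
        extends_near N p \<alpha> a \<and> extends_near N p \<beta> b \<longrightarrow> c p = koszul M \<pi> \<alpha> \<beta> p)"
    using c by (simp add: extends_near_iff)
  have ex1: "\<exists>!c. c \<in> L \<and> (\<forall>p\<in>pts N. \<forall>\<alpha>\<in>one_forms M. \<forall>\<beta>\<in>one_forms M.
        extends_near N p \<alpha> a \<and> extends_near N p \<beta> b \<longrightarrow> c p = koszul M \<pi> \<alpha> \<beta> p)"
  proof (rule ex1I[where a = c], rule ex)
    fix c' assume c': "c' \<in> L \<and> (\<forall>p\<in>pts N. \<forall>\<alpha>\<in>one_forms M. \<forall>\<beta>\<in>one_forms M.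
        extends_near N p \<alpha> a \<and> extends_near N p \<beta> b \<longrightarrow> c' p = koszul M \<pi> \<alpha> \<beta> p)"
    show "c' = c"
    proof
      fix p
      show "c' p = c p"
      proof (cases "p \<in> pts N")
        case True
        then show ?thesis using c' A B by (simp add: c_def extends_near_iff)
      next
        case False
        then show ?thesis using c' N.cosections_outside[of c' M p] by (simp add: c_def)
      qed
    qed
  qed
  show ?thesis unfolding bracketS_def by (rule theI'[OF ex1])
qed

lemma bS_L: "a \<in> L \<Longrightarrow> b \<in> L \<Longrightarrow> bS a b \<in> L"
  using bracketS_spec by blast

lemma bS_eq:
  assumes "a \<in> L" "b \<in> L" "p \<in> pts N" "\<alpha> \<in> one_forms M" "\<beta> \<in> one_forms M"
    "\<forall>\<^sub>F q in nbN p. \<alpha> q = a q" "\<forall>\<^sub>F q in nbN p. \<beta> q = b q"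
  shows "bS a b p = koszul M \<pi> \<alpha> \<beta> p"
  using bracketS_spec[OF assms(1,2)] assms by (simp add: extends_near_iff)

text \<open>Brackets of extensions extend the bracket in a whole neighbourhood, not just at p;
  iterated brackets, as in the Jacobi identity, require this.\<close>

lemma bS_near:
  assumes "a \<in> L" "b \<in> L" "\<alpha> \<in> one_forms M" "\<beta> \<in> one_forms M"
    "\<forall>\<^sub>F q in nbN p. \<alpha> q = a q" "\<forall>\<^sub>F q in nbN p. \<beta> q = b q"
  shows "\<forall>\<^sub>F q in nbN p. koszul M \<pi> \<alpha> \<beta> q = bS a b q"
  using eventually_nb_nb[OF assms(5)] eventually_nb_nb[OF assms(6)] eventually_nb_in
  by eventually_elim (simp add: bS_eq[OF assms(1,2) _ assms(3,4)])

lemma L_ext: "a \<in> L \<Longrightarrow> b \<in> L \<Longrightarrow> (\<And>p. p \<in> pts N \<Longrightarrow> a p = b p) \<Longrightarrow> a = b"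
  using N.cosections_outside by (metis ext)

lemma bS_skew:
  assumes a: "a \<in> L" and b: "b \<in> L" shows "bS a b = - bS b a"
proof (rule L_ext[OF bS_L[OF a b] N.cosections_uminus[OF bS_L[OF b a]]])
  fix p assume p: "p \<in> pts N"
  obtain \<alpha> where \<alpha>: "\<alpha> \<in> one_forms M" "\<forall>\<^sub>F q in nbN p. \<alpha> q = a q" using section_extend[OF a p] .
  obtain \<beta> where \<beta>: "\<beta> \<in> one_forms M" "\<forall>\<^sub>F q in nbN p. \<beta> q = b q" using section_extend[OF b p] .
  show "bS a b p = (- bS b a) p"
    using bS_eq[OF a b p \<alpha>(1) \<beta>(1) \<alpha>(2) \<beta>(2)] bS_eq[OF b a p \<beta>(1) \<alpha>(1) \<beta>(2) \<alpha>(2)]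
      M.koszul_skew[OF \<alpha>(1) \<beta>(1)] by simp
qed

lemma bS_add:
  assumes a: "a \<in> L" and b: "b \<in> L" and c: "c \<in> L" shows "bS a (b + c) = bS a b + bS a c"
proof (rule L_ext[OF bS_L[OF a N.cosections_add[OF b c]] N.cosections_add[OF bS_L[OF a b] bS_L[OF a c]]])
  fix p assume p: "p \<in> pts N"
  obtain \<alpha> where \<alpha>: "\<alpha> \<in> one_forms M" "\<forall>\<^sub>F q in nbN p. \<alpha> q = a q" using section_extend[OF a p] .
  obtain \<beta> where \<beta>: "\<beta> \<in> one_forms M" "\<forall>\<^sub>F q in nbN p. \<beta> q = b q" using section_extend[OF b p] .
  obtain \<gamma> where \<gamma>: "\<gamma> \<in> one_forms M" "\<forall>\<^sub>F q in nbN p. \<gamma> q = c q" using section_extend[OF c p] .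
  have "\<forall>\<^sub>F q in nbN p. (\<beta> + \<gamma>) q = (b + c) q" using \<beta>(2) \<gamma>(2) by eventually_elim simp
  then show "bS a (b + c) p = (bS a b + bS a c) p"
    using bS_eq[OF a N.cosections_add[OF b c] p \<alpha>(1) M.one_forms_add[OF \<beta>(1) \<gamma>(1)] \<alpha>(2)]
      bS_eq[OF a b p \<alpha>(1) \<beta>(1) \<alpha>(2) \<beta>(2)] bS_eq[OF a c p \<alpha>(1) \<gamma>(1) \<alpha>(2) \<gamma>(2)]
      M.koszul_add[OF \<alpha>(1) \<beta>(1) \<gamma>(1)] by simp
qed

lemma bS_leibniz:
  assumes a: "a \<in> L" and b: "b \<in> L" and f: "f \<in> Cinf N"
  shows "bS a (fscale f b) = fscale f (bS a b) + fscale (rho a f) b"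
proof (rule L_ext[OF bS_L[OF a N.cosections_fscale[OF f b]]])
  have rf: "rho a f \<in> Cinf N" by (rule N.vf_act[OF N.sharp_vf[OF restr_form_one_form[OF a]] f])
  show "fscale f (bS a b) + fscale (rho a f) b \<in> L"
    by (intro N.cosections_add N.cosections_fscale f rf bS_L a b)
  fix p assume p: "p \<in> pts N"
  obtain \<alpha> where \<alpha>: "\<alpha> \<in> one_forms M" "\<forall>\<^sub>F q in nbN p. \<alpha> q = a q" using section_extend[OF a p] .
  obtain \<beta> where \<beta>: "\<beta> \<in> one_forms M" "\<forall>\<^sub>F q in nbN p. \<beta> q = b q" using section_extend[OF b p] .
  obtain F where F: "F \<in> Cinf M" "\<forall>\<^sub>F q in nbN p. F q = f q" using Cinf_extend[OF f p] .
  have "\<forall>\<^sub>F q in nbN p. fscale F \<beta> q = fscale f b q"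
    using \<beta>(2) F(2)
  proof eventually_elim
    case (elim q)
    then show ?case by (simp add: fun_eq_iff)
  qed
  then have 1: "bS a (fscale f b) p = koszul M \<pi> \<alpha> (fscale F \<beta>) p"
    using bS_eq[OF a N.cosections_fscale[OF f b] p \<alpha>(1) M.one_forms_fscale[OF F(1) \<beta>(1)] \<alpha>(2)] by simp
  \<comment> \<open>The extension F is differentiated in a direction tangent to N, so the choice of
    F drops out and the anchor over N appears.\<close>
  have "sharp M \<pi> \<alpha> p F = sharp N \<psi> (restr_form M N \<alpha>) p (restr N F)"
    using sharp_restr[OF \<alpha>(1) F(1) p] .
  also have "\<dots> = sharp N \<psi> (restr_form M N \<alpha>) p f"
  proof (rule N.tangent_local[OF N.vf_tangent'[OF N.sharp_vf[OF restr_form_one_form'[OF \<alpha>(1)]]] p restr_Cinf[OF F(1)] f])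
    show "\<forall>\<^sub>F q in nbN p. restr N F q = f q" using F(2) eventually_nb_in by eventually_elim simp
  qed
  also have "\<dots> = rho a f p"
    using restr_form_pt[of \<alpha> p a] eventually_nb_self[OF \<alpha>(2) p] f by (simp add: N.sharp_apply act_def)
  finally have "act (sharp M \<pi> \<alpha>) F p = rho a f p" by (simp add: act_def)
  then show "bS a (fscale f b) p = (fscale f (bS a b) + fscale (rho a f) b) p"
    unfolding 1 M.koszul_leibniz[OF \<alpha>(1) \<beta>(1) F(1)]
    using bS_eq[OF a b p \<alpha>(1) \<beta>(1) \<alpha>(2) \<beta>(2)] eventually_nb_self[OF \<beta>(2) p] eventually_nb_self[OF F(2) p]
    by (simp add: fun_eq_iff)
qed

lemma bS_jacobi:
  assumes a: "a \<in> L" and b: "b \<in> L" and c: "c \<in> L"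
  shows "bS a (bS b c) = bS (bS a b) c + bS b (bS a c)"
proof (rule L_ext)
  fix p assume p: "p \<in> pts N"
  obtain \<alpha> where \<alpha>: "\<alpha> \<in> one_forms M" "\<forall>\<^sub>F q in nbN p. \<alpha> q = a q" using section_extend[OF a p] .
  obtain \<beta> where \<beta>: "\<beta> \<in> one_forms M" "\<forall>\<^sub>F q in nbN p. \<beta> q = b q" using section_extend[OF b p] .
  obtain \<gamma> where \<gamma>: "\<gamma> \<in> one_forms M" "\<forall>\<^sub>F q in nbN p. \<gamma> q = c q" using section_extend[OF c p] .
  note ab = bS_near[OF a b \<alpha>(1) \<beta>(1) \<alpha>(2) \<beta>(2)] and bc = bS_near[OF b c \<beta>(1) \<gamma>(1) \<beta>(2) \<gamma>(2)]
    and ac = bS_near[OF a c \<alpha>(1) \<gamma>(1) \<alpha>(2) \<gamma>(2)]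
  note k = M.koszul_one_form
  show "bS a (bS b c) p = (bS (bS a b) c + bS b (bS a c)) p"
    using bS_eq[OF a bS_L[OF b c] p \<alpha>(1) k[OF \<beta>(1) \<gamma>(1)] \<alpha>(2) bc]
      bS_eq[OF bS_L[OF a b] c p k[OF \<alpha>(1) \<beta>(1)] \<gamma>(1) ab \<gamma>(2)]
      bS_eq[OF b bS_L[OF a c] p \<beta>(1) k[OF \<alpha>(1) \<gamma>(1)] \<beta>(2) ac]
      M.koszul_jacobi[OF \<alpha>(1) \<beta>(1) \<gamma>(1)] by simp
qed (intro bS_L N.cosections_add a b c)+

text \<open>The defect is tensorial, since the two anchors agree by \<open>sharp_restr\<close>, and
  skew; on differentials it vanishes because the inclusion is a Poisson map.\<close>

lemma koszul_restr:
  assumes a: "\<alpha> \<in> one_forms M" and b: "\<beta> \<in> one_forms M" and p: "p \<in> pts N"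
  shows "restr_form M N (koszul M \<pi> \<alpha> \<beta>) p = koszul N \<psi> (restr_form M N \<alpha>) (restr_form M N \<beta>) p"
proof
  fix w
  let ?r = "restr_form M N"
  have pM: "p \<in> pts M" using p pts_sub by auto
  define T where "T \<alpha> \<beta> = ?r (koszul M \<pi> \<alpha> \<beta>) p w - koszul N \<psi> (?r \<alpha>) (?r \<beta>) p w" for \<alpha> \<beta>
  note r = restr_form_one_form'
  have add: "T \<alpha> (\<beta> + \<beta>') = T \<alpha> \<beta> + T \<alpha> \<beta>'"
    if "\<alpha> \<in> one_forms M" "\<beta> \<in> one_forms M" "\<beta>' \<in> one_forms M" for \<alpha> \<beta> \<beta>'
    using that by (simp add: T_def M.koszul_add N.koszul_add r restr_form_add)
  have scale: "T \<alpha> (fscale f \<beta>) = f p * T \<alpha> \<beta>"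
    if f: "f \<in> Cinf M" and \<alpha>: "\<alpha> \<in> one_forms M" and \<beta>: "\<beta> \<in> one_forms M" for \<alpha> \<beta> f
  proof -
    have "?r (fscale f \<beta>) = fscale (restr N f) (?r \<beta>)"
    proof
      fix q
      show "?r (fscale f \<beta>) q = fscale (restr N f) (?r \<beta>) q"
        using restr_form_off[where a = \<beta> and p = q, OF _ M.one_forms_cotangent[OF \<beta>]]
        by (cases "q \<in> pts N") (simp_all add: fun_eq_iff restr_form_fscale)
    qed
    then show ?thesis
      using sharp_restr[OF \<alpha> f p] p
      by (simp add: T_def M.koszul_leibniz[OF \<alpha> \<beta> f] N.koszul_leibniz[OF r[OF \<alpha>] r[OF \<beta>] restr_Cinf[OF f]]
          restr_form_add restr_form_fscale act_def algebra_simps)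
  qed
  have skew: "T \<alpha> \<beta> = - T \<beta> \<alpha>" if "\<alpha> \<in> one_forms M" "\<beta> \<in> one_forms M" for \<alpha> \<beta>
  proof -
    have "?r (- \<gamma>) p w = - ?r \<gamma> p w" for \<gamma> by (simp add: restr_form_def)
    then show ?thesis
      using M.koszul_skew[OF that] N.koszul_skew[OF r[OF that(1)] r[OF that(2)]] by (simp add: T_def)
  qed
  have exact: "T (dff M f) (dff M g) = 0" if f: "f \<in> Cinf M" and g: "g \<in> Cinf M" for f g
  proof -
    have 1: "?r (dff M h) = dff N (restr N h)" if h: "h \<in> Cinf M" for h
    proof
      fix q
      show "?r (dff M h) q = dff N (restr N h) q"
        using restr_form_dff[OF _ h, of q] dff_outside[of q N]
          restr_form_off[where a = "dff M h" and p = q, OF _ M.dff_cotangent]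
        by (cases "q \<in> pts N") auto
    qed
    show ?thesis
      using f g by (simp add: T_def M.koszul_dff 1 N.koszul_dff restr_Cinf M.pbracket_Cinf pbracket_restr)
  qed
  have "T \<alpha> \<beta> = 0"
    by (rule M.tensor_zero_skew[where T = T, OF pM add scale skew exact a b])
  then show "?r (koszul M \<pi> \<alpha> \<beta>) p w = koszul N \<psi> (?r \<alpha>) (?r \<beta>) p w" by (simp add: T_def)
qed

text \<open>Restriction of covectors is a morphism to the cotangent algebroid of N; its kernel, the
  conormal sections, is therefore an ideal.\<close>

lemma bS_restr:
  assumes a: "a \<in> L" and b: "b \<in> L"
  shows "restr_form M N (bS a b) = koszul N \<psi> (restr_form M N a) (restr_form M N b)"
proof
  fix p
  let ?r = "restr_form M N"
  note r = restr_form_one_form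
  show "?r (bS a b) p = koszul N \<psi> (?r a) (?r b) p"
  proof (cases "p \<in> pts N")
    case p: True
    obtain \<alpha> where \<alpha>: "\<alpha> \<in> one_forms M" "\<forall>\<^sub>F q in nbN p. \<alpha> q = a q" using section_extend[OF a p] .
    obtain \<beta> where \<beta>: "\<beta> \<in> one_forms M" "\<forall>\<^sub>F q in nbN p. \<beta> q = b q" using section_extend[OF b p] .
    have ev: "\<forall>\<^sub>F q in nbN p. ?r \<alpha> q = ?r a q" "\<forall>\<^sub>F q in nbN p. ?r \<beta> q = ?r b q"
      by (rule eventually_mono[OF \<alpha>(2)], rule restr_form_pt, assumption)
         (rule eventually_mono[OF \<beta>(2)], rule restr_form_pt, assumption)
    have "?r (bS a b) p = ?r (koszul M \<pi> \<alpha> \<beta>) p"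
      by (rule restr_form_pt) (rule bS_eq[OF a b p \<alpha>(1) \<beta>(1) \<alpha>(2) \<beta>(2)])
    also have "\<dots> = koszul N \<psi> (?r \<alpha>) (?r \<beta>) p" using koszul_restr[OF \<alpha>(1) \<beta>(1) p] .
    also have "\<dots> = koszul N \<psi> (?r a) (?r b) p"
      using N.koszul_local2[OF _ _ _ _ p ev] restr_form_one_form'[OF \<alpha>(1)] restr_form_one_form'[OF \<beta>(1)]
        r[OF a] r[OF b] by blast
    finally show ?thesis .
  next
    case False
    then show ?thesis
      using N.one_forms_outside[OF r[OF bS_L[OF a b]]] N.one_forms_outside[OF N.koszul_one_form[OF r[OF a] r[OF b]]]
      by simp
  qed
qed

end

text \<open>The Lie derivative of the bivector is skew and tensorial in the two forms, and on
  differentials it vanishes by the derivation rule. This brings a condition on functions into the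
  form demanded by \<open>Poiss_S\<close>.\<close>

lemma (in poisson) lie_bivector_zero:
  assumes V: "V \<in> vector_fields M"
    and der: "\<And>f g. f \<in> Cinf M \<Longrightarrow> g \<in> Cinf M \<Longrightarrow>
      act V (pbracket M \<pi> f g) = pbracket M \<pi> (act V f) g + pbracket M \<pi> f (act V g)"
    and a: "\<alpha> \<in> one_forms M" and b: "\<beta> \<in> one_forms M"
  shows "lie_bivector M V \<pi> \<alpha> \<beta> = 0"
proof
  fix p
  let ?l = "lie_form M V"
  note lf = lie_form_one_form[OF V]
  define T where "T \<alpha> \<beta> = V p (ev2 \<pi> \<alpha> \<beta>) - ev2 \<pi> (?l \<alpha>) \<beta> p - ev2 \<pi> \<alpha> (?l \<beta>) p" for \<alpha> \<beta>
  have "T \<alpha> \<beta> = 0" if p: "p \<in> pts M"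
  proof -
    note t = vf_tangent'[OF V, of p]
    have add: "T \<alpha> (\<beta> + \<beta>') = T \<alpha> \<beta> + T \<alpha> \<beta>'"
      if "\<alpha> \<in> one_forms M" "\<beta> \<in> one_forms M" "\<beta>' \<in> one_forms M" for \<alpha> \<beta> \<beta>'
      using that by (simp add: T_def ev2_add lf lie_form_add[OF V] tangent_add[OF t ev2_Cinf ev2_Cinf])
    have scale: "T \<alpha> (fscale f \<beta>) = f p * T \<alpha> \<beta>"
      if f: "f \<in> Cinf M" and that: "\<alpha> \<in> one_forms M" "\<beta> \<in> one_forms M" for \<alpha> \<beta> f
    proof -
      have "act V f p = V p f" by (simp add: act_def)
      then show ?thesis using that f
        by (simp add: T_def ev2_add ev2_fscale lf lie_form_fscale[OF V] one_forms_fscale vf_act[OF V]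
            tangent_mult[OF t f ev2_Cinf] algebra_simps)
    qed
    have skew: "T \<alpha> \<beta> = - T \<beta> \<alpha>" if "\<alpha> \<in> one_forms M" "\<beta> \<in> one_forms M" for \<alpha> \<beta>
      using ev2_skew[OF that] ev2_skew[OF lf[OF that(1)] that(2)] ev2_skew[OF that(1) lf[OF that(2)]]
        tangent_uminus[OF t ev2_Cinf[OF that(2,1)]] by (simp add: T_def)
    have exact: "T (dff M f) (dff M g) = 0" if "f \<in> Cinf M" "g \<in> Cinf M" for f g
      using fun_cong[OF der[OF that], of p] that
      by (simp add: T_def lie_form_dff[OF V] pbracket_def) (simp add: act_def)
    show ?thesis by (rule tensor_zero_skew[where T = T, OF p add scale skew exact a b])
  qed
  then show "lie_bivector M V \<pi> \<alpha> \<beta> p = 0 p"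
    using vf_outside[OF V, of p] by (cases "p \<in> pts M") (auto simp: lie_bivector_def T_def act_def ev2_def pi_outside)
qed

section \<open>The infinitesimal Poisson algebra\<close>

locale infinitesimal = psub M N \<pi> \<psi> + tubular M N e
  for M N :: "('m::{t2_space,second_countable_topology}, 'e::euclidean_space) mfd"
    and \<pi> \<psi> :: "'m bivec" and e :: "'m \<times> 'm tvec set \<Rightarrow> 'm"
begin

text \<open>The condition in \<open>hlift\<close> at a single point, isolated so that pointwise
  uniqueness can glue smooth local lifts.\<close>

definition lifts :: "'m \<Rightarrow> 'm covec \<Rightarrow> 'm covec \<Rightarrow> bool" where
  "lifts q b a \<longleftrightarrow> a \<in> cotangent M q \<and> (\<forall>w\<in>tangent N q. a (push M N w) = b w) \<and>
     (\<forall>c\<in>normal_space M N q. a (tub_velocity M N e q c) = 0)"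

text \<open>The velocity attached to the class of v differs from v by some w tangent to N; vanishing
  on the velocity and restricting to b leave a(v) = - b(w) as the only possibility.\<close>

lemma lifts_unique:
  assumes q: "q \<in> pts N" and a: "lifts q b a" "lifts q b a'"
  shows "a = a'"
proof (rule cotangent_ext)
  show "a \<in> cotangent M q" "a' \<in> cotangent M q" using a by (auto simp: lifts_def)
  fix v assume v: "v \<in> tangent M q"
  let ?c = "coset q v"
  have c: "?c \<in> normal_space M N q" using v by (simp add: normal_space_coset)
  obtain w where w: "w \<in> tangent N q" "tub_velocity M N e q ?c = v + push M N w"
    using tub_velocity_mem[OF q v] by (auto simp: coset_mem)
  have "x v = - b w" if x: "lifts q b x" for x
  proof -
    have "x (v + push M N w) = x v + x (push M N w)"
      using cotangent_add[of x M q] x v push_tangent[OF w(1) q] by (auto simp: lifts_def)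
    moreover have "x (v + push M N w) = 0" using x c w(2) by (auto simp: lifts_def)
    moreover have "x (push M N w) = b w" using x w(1) by (simp add: lifts_def)
    ultimately show ?thesis by simp
  qed
  from this[OF a(1)] this[OF a(2)] show "a v = a' v" by simp
qed

text \<open>Write the form as a sum of f_b dx_b and replace each x_b by an extension constant along
  the fibres of e: its differential restricts to dx_b and kills the fibre directions.\<close>

lemma lifts_near:
  assumes \<alpha>: "\<alpha> \<in> one_forms N" and p: "p \<in> pts N"
  obtains s where "s \<in> L" "\<forall>\<^sub>F q in nbN p. lifts q (\<alpha> q) (s q)"
proof -
  obtain B f x where fr: "finite (B::'e set)" "\<And>b. b \<in> B \<Longrightarrow> f b \<in> Cinf N" "\<And>b. b \<in> B \<Longrightarrow> x b \<in> Cinf N"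
    "\<forall>\<^sub>F q in nbN p. \<alpha> q = (\<Sum>b\<in>B. fscale (f b) (dff N (x b))) q"
    using N.local_presentation[OF p \<alpha>] by blast
  have exG: "\<forall>b\<in>B. \<exists>G. G \<in> Cinf M \<and> (\<forall>\<^sub>F q in nbN p. G q = x b q) \<and>
      (\<forall>\<^sub>F q in nbN p. \<forall>c\<in>normal_space M N q. tub_velocity M N e q c G = 0)"
  proof
    fix b assume b: "b \<in> B"
    obtain G where "G \<in> Cinf M" "\<forall>\<^sub>F q in nbN p. G q = x b q"
      "\<forall>\<^sub>F q in nbN p. \<forall>c\<in>normal_space M N q. tub_velocity M N e q c G = 0"
      using fibre_constant_extension[OF fr(3)[OF b] p] .
    then show "\<exists>G. G \<in> Cinf M \<and> (\<forall>\<^sub>F q in nbN p. G q = x b q) \<and>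
      (\<forall>\<^sub>F q in nbN p. \<forall>c\<in>normal_space M N q. tub_velocity M N e q c G = 0)" by (intro exI[of _ G] conjI)
  qed
  obtain G where "\<forall>b\<in>B. G b \<in> Cinf M \<and> (\<forall>\<^sub>F q in nbN p. G b q = x b q) \<and>
      (\<forall>\<^sub>F q in nbN p. \<forall>c\<in>normal_space M N q. tub_velocity M N e q c (G b) = 0)"
    using bchoice[OF exG] by (elim exE)
  then have G: "\<And>b. b \<in> B \<Longrightarrow> G b \<in> Cinf M" "\<And>b. b \<in> B \<Longrightarrow> \<forall>\<^sub>F q in nbN p. G b q = x b q"
    "\<And>b. b \<in> B \<Longrightarrow> \<forall>\<^sub>F q in nbN p. \<forall>c\<in>normal_space M N q. tub_velocity M N e q c (G b) = 0"
    by auto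
  let ?s = "\<Sum>b\<in>B. fscale (f b) (restr_sec (dff M (G b)))"
  have s: "?s \<in> L"
    by (intro N.cosections_sum N.cosections_fscale restr_sec_cosection M.dff_one_form fr G)
  have e1: "\<forall>\<^sub>F q in nbN p. \<forall>b\<in>B. \<forall>\<^sub>F q' in nbN q. G b q' = x b q'"
    using eventually_nb_nb[OF G(2)] fr(1) by (simp add: eventually_ball_finite_distrib)
  have e2: "\<forall>\<^sub>F q in nbN p. \<forall>b\<in>B. \<forall>c\<in>normal_space M N q. tub_velocity M N e q c (G b) = 0"
    using G(3) fr(1) by (simp add: eventually_ball_finite_distrib)
  have "\<forall>\<^sub>F q in nbN p. lifts q (\<alpha> q) (?s q)"
    using fr(4) e1 e2 eventually_nb_in
  proof eventually_elim
    case (elim q)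
    have q: "q \<in> pts N" "q \<in> pts M" using elim pts_sub by auto
    have sv: "?s q v = (\<Sum>b\<in>B. f b q * dff M (G b) q v)" for v
      using q by (simp add: sum_fun_apply restr_sec_def)
    show ?case unfolding lifts_def
    proof (intro conjI ballI)
      show "?s q \<in> cotangent M q" by (rule N.cosections_cotangent'[OF s])
      fix w assume w: "w \<in> tangent N q"
      have "push M N w (G b) = w (x b)" if b: "b \<in> B" for b
      proof -
        have "\<forall>\<^sub>F q' in nbN q. restr N (G b) q' = x b q'"
          using elim(2)[rule_format, OF b] eventually_nb_in by eventually_elim simp
        then show ?thesis
          using N.tangent_local[OF w q(1) restr_Cinf[OF G(1)[OF b]] fr(3)[OF b]] G(1)[OF b] by (simp add: push_apply)
      qed
      then show "?s q (push M N w) = \<alpha> q w"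
        unfolding sv elim(1) using q w push_tangent[OF w q(1)]
        by (simp add: sum_fun_apply dff_apply)
    next
      fix c assume c: "c \<in> normal_space M N q"
      then obtain v where v: "v \<in> tangent M q" "c = coset q v" by (auto simp: normal_space_coset)
      obtain w where w: "w \<in> tangent N q" "tub_velocity M N e q c = v + push M N w"
        using tub_velocity_mem[OF q(1) v(1)] v(2) by (auto simp: coset_mem)
      have "tub_velocity M N e q c \<in> tangent M q"
        unfolding w(2) by (intro M.tangent_plus v push_tangent w q)
      then show "?s q (tub_velocity M N e q c) = 0"
        unfolding sv using elim(3) c q by (simp add: dff_apply)
    qed
  qed
  then show ?thesis using that s by blast
qed

abbreviation hl :: "'m cofield \<Rightarrow> 'm cofield" where "hl \<equiv> hlift M N e"

lemma hlift_iff: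
  assumes a: "a \<in> L" and \<alpha>: "\<alpha> \<in> one_forms N"
  shows "(a \<in> cosections M N \<and> restr_form M N a = \<alpha> \<and>
     (\<forall>(p, c)\<in>normal_bundle M N. a p (tub_velocity M N e p c) = 0)) \<longleftrightarrow>
     (\<forall>p\<in>pts N. lifts p (\<alpha> p) (a p))" (is "?l \<longleftrightarrow> ?r")
proof
  assume l: ?l
  show ?r
  proof
    fix p assume p: "p \<in> pts N"
    have "a p (push M N w) = \<alpha> p w" if "w \<in> tangent N p" for w
      using l restr_form_apply[OF that, of a] by auto
    then show "lifts p (\<alpha> p) (a p)"
      using l N.cosections_cotangent'[OF a, of p] p by (auto simp: lifts_def normal_bundle_def)
  qed
next
  assume r: ?r
  have "restr_form M N a = \<alpha>"
  proof
    fix p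
    show "restr_form M N a p = \<alpha> p"
    proof (cases "p \<in> pts N")
      case True
      show ?thesis
      proof (rule cotangent_ext)
        show "restr_form M N a p \<in> cotangent N p" "\<alpha> p \<in> cotangent N p"
          using N.one_forms_cotangent restr_form_one_form[OF a] \<alpha> by auto
      qed (use r True in \<open>auto simp: lifts_def restr_form_apply\<close>)
    qed (use N.one_forms_outside restr_form_one_form[OF a] \<alpha> in simp)
  qed
  then show ?l using r a by (auto simp: lifts_def normal_bundle_def)
qed

text \<open>Gluing takes no partition of unity: by uniqueness the pointwise lifts agree with a
  smooth local lift near every point.\<close>

lemma hlift_ex: assumes \<alpha>: "\<alpha> \<in> one_forms N" shows "\<exists>a\<in>L. \<forall>p\<in>pts N. lifts p (\<alpha> p) (a p)"
proof -
  have "\<exists>a. lifts p (\<alpha> p) a" if p: "p \<in> pts N" for p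
  proof -
    obtain s where "s \<in> L" "\<forall>\<^sub>F q in nbN p. lifts q (\<alpha> q) (s q)" using lifts_near[OF \<alpha> p] .
    then show ?thesis using eventually_nb_self p by blast
  qed
  then obtain A where A: "\<And>p. p \<in> pts N \<Longrightarrow> lifts p (\<alpha> p) (A p)" by metis
  define a where "a p = (if p \<in> pts N then A p else 0)" for p
  have "a \<in> L"
  proof (rule N.cosections_local)
    fix p assume p: "p \<in> pts N"
    obtain s where s: "s \<in> L" "\<forall>\<^sub>F q in nbN p. lifts q (\<alpha> q) (s q)" using lifts_near[OF \<alpha> p] .
    have "\<forall>\<^sub>F q in nbN p. a q = s q"
      using s(2) eventually_nb_in
    proof eventually_elim
      case (elim q)
      then show ?case using lifts_unique[OF elim(2) A[OF elim(2)] elim(1)] by (simp add: a_def)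
    qed
    then show "\<exists>b\<in>L. \<forall>\<^sub>F q in nbN p. a q = b q" using s(1) by blast
  qed (simp add: a_def)
  moreover have "\<forall>p\<in>pts N. lifts p (\<alpha> p) (a p)" using A by (simp add: a_def)
  ultimately show ?thesis by blast
qed

lemma hliftI:
  assumes a: "a \<in> L" and \<alpha>: "\<alpha> \<in> one_forms N" and l: "\<And>p. p \<in> pts N \<Longrightarrow> lifts p (\<alpha> p) (a p)"
  shows "hl \<alpha> = a"
  unfolding hlift_def
proof (rule the_equality)
  show "a \<in> cosections M N \<and> restr_form M N a = \<alpha> \<and>
     (\<forall>(p, c)\<in>normal_bundle M N. a p (tub_velocity M N e p c) = 0)"
    using hlift_iff[OF a \<alpha>] l by blast
  fix a' assume a': "a' \<in> cosections M N \<and> restr_form M N a' = \<alpha> \<and>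
     (\<forall>(p, c)\<in>normal_bundle M N. a' p (tub_velocity M N e p c) = 0)"
  then have la': "\<forall>p\<in>pts N. lifts p (\<alpha> p) (a' p)" using hlift_iff[of a', OF _ \<alpha>] by blast
  show "a' = a"
  proof (rule L_ext[OF _ a])
    show "a' \<in> L" using a' by blast
    fix p assume p: "p \<in> pts N"
    show "a' p = a p" using lifts_unique[OF p bspec[OF la' p] l[OF p]] .
  qed
qed

lemma hl_lifts: "\<alpha> \<in> one_forms N \<Longrightarrow> p \<in> pts N \<Longrightarrow> lifts p (\<alpha> p) (hl \<alpha> p)"
  and hl_L: "\<alpha> \<in> one_forms N \<Longrightarrow> hl \<alpha> \<in> L"
  using hlift_ex hliftI by metis+

lemma hl_restr: "\<alpha> \<in> one_forms N \<Longrightarrow> restr_form M N (hl \<alpha>) = \<alpha>"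
  using hlift_iff[OF hl_L] hl_lifts by blast

lemma hl_add: "\<alpha> \<in> one_forms N \<Longrightarrow> \<beta> \<in> one_forms N \<Longrightarrow> hl (\<alpha> + \<beta>) = hl \<alpha> + hl \<beta>"
  using hl_lifts[of \<alpha>] hl_lifts[of \<beta>]
  by (intro hliftI N.cosections_add hl_L N.one_forms_add) (auto simp: lifts_def cotangent_plus)

lemma hl_fscale:
  assumes "f \<in> Cinf N" "\<alpha> \<in> one_forms N" shows "hl (fscale f \<alpha>) = fscale f (hl \<alpha>)"
proof (intro hliftI N.cosections_fscale hl_L N.one_forms_fscale assms)
  fix p assume "p \<in> pts N"
  then have "lifts p (\<alpha> p) (hl \<alpha> p)" using hl_lifts assms by blast
  moreover have "fscale f (hl \<alpha>) p = (\<lambda>v. f p * hl \<alpha> p v)" by (simp add: fun_eq_iff)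
  ultimately show "lifts p (fscale f \<alpha> p) (fscale f (hl \<alpha>) p)"
    by (auto simp: lifts_def cotangent_smult)
qed

section \<open>The ideal of conormal sections and the curvature on functions\<close>

abbreviation C :: "'m cofield set" where "C \<equiv> conormal_sections M N"

lemma C_iff: "\<xi> \<in> C \<longleftrightarrow> \<xi> \<in> L \<and> restr_form M N \<xi> = 0"
proof
  assume x: "\<xi> \<in> C"
  have "restr_form M N \<xi> p w = 0" for p w
  proof (cases "p \<in> pts N")
    case True then show ?thesis using x by (auto simp: conormal_sections_def restr_form_def)
  next
    case False
    then show ?thesis
      using x restr_form_off[where a = \<xi> and p = p, OF False] N.cosections_cotangent'[of \<xi> M p]
      by (simp add: conormal_sections_def)
  qed
  then show "\<xi> \<in> L \<and> restr_form M N \<xi> = 0" using x by (auto simp: conormal_sections_def fun_eq_iff)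
next
  assume x: "\<xi> \<in> L \<and> restr_form M N \<xi> = 0"
  have "\<xi> p (push M N w) = 0" if "w \<in> tangent N p" for p w
    using x restr_form_apply[OF that, of \<xi>] by simp
  then show "\<xi> \<in> C" using x by (auto simp: conormal_sections_def)
qed

lemma C_L: "\<xi> \<in> C \<Longrightarrow> \<xi> \<in> L" by (simp add: C_iff)

lemma restr_form_zero: "restr_form M N 0 = 0" by (auto simp: restr_form_def fun_eq_iff)

lemma C_add: "\<xi> \<in> C \<Longrightarrow> \<eta> \<in> C \<Longrightarrow> \<xi> + \<eta> \<in> C"
  and C_diff: "\<xi> \<in> C \<Longrightarrow> \<eta> \<in> C \<Longrightarrow> \<xi> - \<eta> \<in> C"
  and C_fscale: "f \<in> Cinf N \<Longrightarrow> \<xi> \<in> C \<Longrightarrow> fscale f \<xi> \<in> C"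
  and C_zero: "0 \<in> C"
  by (auto simp: C_iff restr_form_add restr_form_diff restr_form_fscale restr_form_zero
      N.cosections_add N.cosections_diff N.cosections_fscale N.cosections_zero)

lemma bS_zero: "a \<in> L \<Longrightarrow> bS a 0 = 0" "a \<in> L \<Longrightarrow> bS 0 a = 0"
proof -
  show 1: "bS a 0 = 0" if "a \<in> L" for a using bS_add[OF that N.cosections_zero N.cosections_zero] by simp
  show "a \<in> L \<Longrightarrow> bS 0 a = 0" using bS_skew[OF N.cosections_zero] 1 by simp
qed

lemma bS_add_left: "a \<in> L \<Longrightarrow> b \<in> L \<Longrightarrow> c \<in> L \<Longrightarrow> bS (a + b) c = bS a c + bS b c"
  using bS_skew[of "a + b" c] bS_skew[of a c] bS_skew[of b c] bS_add[of c a b] by (simp add: N.cosections_add)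

lemma bS_diff: "a \<in> L \<Longrightarrow> b \<in> L \<Longrightarrow> c \<in> L \<Longrightarrow> bS a (b - c) = bS a b - bS a c"
  using bS_add[of a "b - c" c] by (simp add: N.cosections_diff)

lemma bS_diff_left: "a \<in> L \<Longrightarrow> b \<in> L \<Longrightarrow> c \<in> L \<Longrightarrow> bS (a - b) c = bS a c - bS b c"
  using bS_add_left[of "a - b" b c] by (simp add: N.cosections_diff)

text \<open>The anchor factors through restriction to N, which kills conormal sections; brackets
  with them are therefore function-linear.\<close>

lemma rho_C:
  assumes "c \<in> C" "f \<in> Cinf N" shows "rho c f = 0"
proof
  fix p
  have r: "restr_form M N c = 0" using assms(1) by (simp only: C_iff)
  show "rho c f p = 0 p"
    unfolding r using assms(2) by (simp add: act_def N.sharp_apply N.pi_zero[OF N.dff_cotangent])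
qed

lemma bS_C: "a \<in> L \<Longrightarrow> c \<in> C \<Longrightarrow> bS a c \<in> C"
  by (simp add: C_iff bS_L bS_restr N.koszul_zero restr_form_one_form)

lemma bS_fscale_C: "c \<in> C \<Longrightarrow> b \<in> L \<Longrightarrow> f \<in> Cinf N \<Longrightarrow> bS c (fscale f b) = fscale f (bS c b)"
  by (simp add: bS_leibniz C_L rho_C)

lemma bS_fscale_C_left: "c \<in> C \<Longrightarrow> b \<in> L \<Longrightarrow> f \<in> Cinf N \<Longrightarrow> bS (fscale f b) c = fscale f (bS b c)"
  using bS_skew[of "fscale f b" c] bS_skew[of b c] bS_fscale_C[of c b f]
  by (simp add: C_L N.cosections_fscale fscale_distrib)

abbreviation hd' :: "('m \<Rightarrow> real) \<Rightarrow> 'm cofield" where "hd' f \<equiv> hl (dff N f)"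
abbreviation pb :: "('m \<Rightarrow> real) \<Rightarrow> ('m \<Rightarrow> real) \<Rightarrow> 'm \<Rightarrow> real" where "pb \<equiv> pbracket N \<psi>"
text \<open>The curvature \<open>Kcurv\<close> on differentials, where the Koszul bracket of df and
  dg is the differential of {f, g}.\<close>

definition K :: "('m \<Rightarrow> real) \<Rightarrow> ('m \<Rightarrow> real) \<Rightarrow> 'm cofield" where
  "K f g = bS (hd' f) (hd' g) - hd' (pb f g)"

lemma hd_L: "f \<in> Cinf N \<Longrightarrow> hd' f \<in> L" by (simp add: hl_L N.dff_one_form)

lemma hd_add: "f \<in> Cinf N \<Longrightarrow> g \<in> Cinf N \<Longrightarrow> hd' (f + g) = hd' f + hd' g"
  by (simp add: N.dff_add hl_add N.dff_one_form)

lemma hd_zero: "hd' 0 = 0" using hd_add[of 0 0] N.Cinf_zero by simp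

lemma hd_mult: "f \<in> Cinf N \<Longrightarrow> g \<in> Cinf N \<Longrightarrow> hd' (f * g) = fscale f (hd' g) + fscale g (hd' f)"
  by (simp add: N.dff_mult hl_add hl_fscale N.dff_one_form N.one_forms_fscale)

lemma rho_hd: "f \<in> Cinf N \<Longrightarrow> g \<in> Cinf N \<Longrightarrow> rho (hd' f) g = pb f g"
  by (simp add: hl_restr N.dff_one_form N.act_sharp_dff)

lemma K_C: "f \<in> Cinf N \<Longrightarrow> g \<in> Cinf N \<Longrightarrow> K f g \<in> C"
  by (simp add: K_def C_iff hd_L bS_L N.cosections_diff N.pbracket_Cinf restr_form_diff bS_restr
      hl_restr N.dff_one_form N.koszul_dff)

lemma pb_add: "f \<in> Cinf N \<Longrightarrow> g \<in> Cinf N \<Longrightarrow> h \<in> Cinf N \<Longrightarrow> pb f (g + h) = pb f g + pb f h"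
  and pb_add_left: "f \<in> Cinf N \<Longrightarrow> g \<in> Cinf N \<Longrightarrow> h \<in> Cinf N \<Longrightarrow> pb (f + g) h = pb f h + pb g h"
  by (simp_all add: N.act_sharp_dff[symmetric] N.Cinf_add N.act_add[OF N.sharp_vf[OF N.dff_one_form]]
      N.dff_add N.sharp_add N.dff_one_form) (simp add: act_def fun_eq_iff)

lemma pb_mult: "f \<in> Cinf N \<Longrightarrow> g \<in> Cinf N \<Longrightarrow> h \<in> Cinf N \<Longrightarrow> pb f (g * h) = g * pb f h + h * pb f g"
  using N.act_mult[OF N.sharp_vf[OF N.dff_one_form], of f g h] by (simp add: N.act_sharp_dff N.Cinf_mult)

lemma pb_zero: "f \<in> Cinf N \<Longrightarrow> pb f 0 = 0" "f \<in> Cinf N \<Longrightarrow> pb 0 f = 0"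
  using pb_add[of f 0 0] pb_add_left[of 0 0 f] N.Cinf_zero by simp_all

lemma K_zero: "f \<in> Cinf N \<Longrightarrow> K f 0 = 0" "f \<in> Cinf N \<Longrightarrow> K 0 f = 0"
  by (simp_all add: K_def hd_zero pb_zero bS_zero hd_L)

lemma K_add_left: "f \<in> Cinf N \<Longrightarrow> g \<in> Cinf N \<Longrightarrow> h \<in> Cinf N \<Longrightarrow> K (f + g) h = K f h + K g h"
  by (simp add: K_def hd_add pb_add_left bS_add_left hd_L N.pbracket_Cinf)

text \<open>The bracket and the lift of d{h, f g} both produce the terms in {h, f} and {h, g}; these
  cancel in the difference, leaving a derivation in the second argument.\<close>

lemma K_mult: "h \<in> Cinf N \<Longrightarrow> f \<in> Cinf N \<Longrightarrow> g \<in> Cinf N \<Longrightarrow> K h (f * g) = fscale f (K h g) + fscale g (K h f)"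
  by (simp add: K_def hd_mult hd_add pb_mult bS_add bS_leibniz hd_L N.pbracket_Cinf N.cosections_fscale
      N.Cinf_mult rho_hd) (auto simp: fun_eq_iff algebra_simps)

lemma Dconn_eq: "Dconn M \<pi> N e (dff N f) \<xi> = bS (hd' f) \<xi>"
  by (simp add: Dconn_def)

lemma aff_bracket_eq:
  assumes "f \<in> Cinf N" "g \<in> Cinf N"
  shows "aff_bracket M \<pi> N \<psi> e (f, \<eta>) (g, \<xi>) =
    (pb f g, bS (hd' f) \<xi> - bS (hd' g) \<eta> + bS \<eta> \<xi> + K f g)"
  using assms by (simp add: aff_bracket_def Dconn_def Kcurv_def K_def N.koszul_dff)
     (simp add: pbracket_def)

section \<open>Multivector fields with values in the centre\<close>

lemma center_mem: "z \<in> center_G M \<pi> N \<longleftrightarrow> z \<in> C \<and> (\<forall>\<eta>\<in>C. bS z \<eta> = 0)"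
  by (auto simp: center_G_def)

lemma k_vectorsD:
  assumes "Q \<in> k_vectors N Z k"
  shows "\<not> (length as = k \<and> set as \<subseteq> one_forms N) \<Longrightarrow> Q as = 0"
    and "length as = k \<Longrightarrow> set as \<subseteq> one_forms N \<Longrightarrow> Q as \<in> Z"
    and "length as = k \<Longrightarrow> set as \<subseteq> one_forms N \<Longrightarrow> i < k \<Longrightarrow> f \<in> Cinf N \<Longrightarrow> \<alpha> \<in> one_forms N \<Longrightarrow>
      \<beta> \<in> one_forms N \<Longrightarrow> Q (as[i := fscale f \<alpha> + \<beta>]) = fscale f (Q (as[i := \<alpha>])) + Q (as[i := \<beta>])"
proof -
  note h = assms[unfolded k_vectors_def mem_Collect_eq]
  show "\<not> (length as = k \<and> set as \<subseteq> one_forms N) \<Longrightarrow> Q as = 0"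
    by (rule mp[OF spec[OF conjunct1[OF h]]])
  note h2 = mp[OF spec[OF conjunct2[OF h], of as]]
  show "length as = k \<Longrightarrow> set as \<subseteq> one_forms N \<Longrightarrow> Q as \<in> Z"
    using h2 by simp
  show "length as = k \<Longrightarrow> set as \<subseteq> one_forms N \<Longrightarrow> i < k \<Longrightarrow> f \<in> Cinf N \<Longrightarrow> \<alpha> \<in> one_forms N \<Longrightarrow>
      \<beta> \<in> one_forms N \<Longrightarrow> Q (as[i := fscale f \<alpha> + \<beta>]) = fscale f (Q (as[i := \<alpha>])) + Q (as[i := \<beta>])"
    using h2 by simp
qed

text \<open>Follows from \<open>tensor_zero\<close> at each point; it supplies the uniqueness that
  \<open>partialD\<close> needs in degree zero.\<close>

lemma k_vectors_1_eq:
  assumes R: "R \<in> k_vectors N Z 1" and R': "R' \<in> k_vectors N Z 1" and Z: "\<And>z. z \<in> Z \<Longrightarrow> z \<in> L"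
    and eq: "\<And>f. f \<in> Cinf N \<Longrightarrow> R [dff N f] = R' [dff N f]"
  shows "R = R'"
proof
  fix as
  have lin: "S [fscale f \<alpha> + \<beta>] = fscale f (S [\<alpha>]) + S [\<beta>]" "S [\<alpha>] \<in> L"
    if "S \<in> k_vectors N Z 1" "f \<in> Cinf N" "\<alpha> \<in> one_forms N" "\<beta> \<in> one_forms N" for S f \<alpha> \<beta>
    using k_vectorsD(3)[OF that(1), of "[\<alpha>]" 0 f \<alpha> \<beta>] k_vectorsD(2)[OF that(1), of "[\<alpha>]"] that Z by auto
  show "R as = R' as"
  proof (cases "length as = 1 \<and> set as \<subseteq> one_forms N")
    case True
    then obtain \<alpha> where as: "as = [\<alpha>]" "\<alpha> \<in> one_forms N" by (auto simp: length_Suc_conv)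
    have sl: "S [\<alpha> + \<beta>] = S [\<alpha>] + S [\<beta>]" "S [fscale f \<alpha>] = fscale f (S [\<alpha>])"
      if S: "S \<in> k_vectors N Z 1" and f: "f \<in> Cinf N" and a: "\<alpha> \<in> one_forms N" and b: "\<beta> \<in> one_forms N" for S f \<alpha> \<beta>
    proof -
      \<comment> \<open>The definition has one combined linearity clause: additivity is its case f =
        \<open>one\<close>, and homogeneity its case with second form 0, once the value at 0 is
        known to vanish.\<close>
      have 1: "S [\<alpha> + \<beta>] = S [\<alpha>] + S [\<beta>]" if a: "\<alpha> \<in> one_forms N" and b: "\<beta> \<in> one_forms N" for \<alpha> \<beta>
        using lin(1)[OF S N.Cinf_one a b] N.fscale_one_form[OF a] N.fscale_one[OF lin(2)[OF S N.Cinf_one a a]] by simp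
      show "S [\<alpha> + \<beta>] = S [\<alpha>] + S [\<beta>]" using 1 a b .
      have "S [0] = 0" using 1[OF N.one_forms_zero N.one_forms_zero] by simp
      then show "S [fscale f \<alpha>] = fscale f (S [\<alpha>])" using lin(1)[OF S f a N.one_forms_zero] by simp
    qed
    have "R [\<alpha>] p v = R' [\<alpha>] p v" for p v
    proof (cases "p \<in> pts N")
      case p: True
      have "R [\<alpha>] p v - R' [\<alpha>] p v = 0"
        by (rule N.tensor_zero[OF p, of "\<lambda>\<alpha>. R [\<alpha>] p v - R' [\<alpha>] p v"])
           (use as(2) eq sl[OF R] sl[OF R'] N.Cinf_one in \<open>auto simp: algebra_simps\<close>)
      then show ?thesis by simp
    next
      case False
      then show ?thesis
        using lin(2)[OF R N.Cinf_one as(2,2)] lin(2)[OF R' N.Cinf_one as(2,2)] N.cosections_outside by simp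
    qed
    then show ?thesis unfolding as by (intro ext)
  next
    case False
    then show ?thesis using k_vectorsD(1)[OF R False] k_vectorsD(1)[OF R' False] by simp
  qed
qed

text \<open>Supplies the uniqueness for \<open>partialD\<close> in degree one in the case of a
  cocycle, whose differential is to be the zero cochain.\<close>

lemma k_vectors_2_zero:
  assumes R: "R \<in> k_vectors N Z 2" and Z: "\<And>z. z \<in> Z \<Longrightarrow> z \<in> L"
    and eq: "\<And>f g. f \<in> Cinf N \<Longrightarrow> g \<in> Cinf N \<Longrightarrow> R [dff N f, dff N g] = 0"
  shows "R = 0"
proof
  fix as
  have lin: "R [\<alpha>, fscale f \<beta> + \<gamma>] = fscale f (R [\<alpha>, \<beta>]) + R [\<alpha>, \<gamma>]"
    "R [fscale f \<beta> + \<gamma>, \<alpha>] = fscale f (R [\<beta>, \<alpha>]) + R [\<gamma>, \<alpha>]" "R [\<alpha>, \<beta>] \<in> L"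
    if "f \<in> Cinf N" "\<alpha> \<in> one_forms N" "\<beta> \<in> one_forms N" "\<gamma> \<in> one_forms N" for f \<alpha> \<beta> \<gamma>
    using k_vectorsD(3)[OF R, of "[\<alpha>, \<beta>]" 1 f \<beta> \<gamma>] k_vectorsD(3)[OF R, of "[\<beta>, \<alpha>]" 0 f \<beta> \<gamma>]
      k_vectorsD(2)[OF R, of "[\<alpha>, \<beta>]"] that Z by auto
  show "R as = 0 as"
  proof (cases "length as = 2 \<and> set as \<subseteq> one_forms N")
    case True
    then obtain \<alpha> \<beta> where as: "as = [\<alpha>, \<beta>]" "\<alpha> \<in> one_forms N" "\<beta> \<in> one_forms N"
      by (auto simp: length_Suc_conv numeral_2_eq_2)
    have a2: "R [\<alpha>, \<beta> + \<gamma>] = R [\<alpha>, \<beta>] + R [\<alpha>, \<gamma>]" and a1: "R [\<beta> + \<gamma>, \<alpha>] = R [\<beta>, \<alpha>] + R [\<gamma>, \<alpha>]"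
      if "\<alpha> \<in> one_forms N" "\<beta> \<in> one_forms N" "\<gamma> \<in> one_forms N" for \<alpha> \<beta> \<gamma>
      using lin(1,2)[OF N.Cinf_one that] N.fscale_one_form[OF that(2)]
        N.fscale_one[OF lin(3)[OF N.Cinf_one that(1,2,2)]] N.fscale_one[OF lin(3)[OF N.Cinf_one that(2,1,1)]] by auto
    have s2: "R [\<alpha>, fscale f \<beta>] = fscale f (R [\<alpha>, \<beta>])" and s1: "R [fscale f \<beta>, \<alpha>] = fscale f (R [\<beta>, \<alpha>])"
      if "f \<in> Cinf N" "\<alpha> \<in> one_forms N" "\<beta> \<in> one_forms N" for f \<alpha> \<beta>
      using lin(1,2)[OF that N.one_forms_zero] a2[OF that(2) N.one_forms_zero N.one_forms_zero]
        a1[OF that(2) N.one_forms_zero N.one_forms_zero] by simp_all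
    have out: "R [\<alpha>, \<beta>] p v = 0" if "p \<notin> pts N" "\<alpha> \<in> one_forms N" "\<beta> \<in> one_forms N" for p v \<alpha> \<beta>
      using N.cosections_outside[OF lin(3)[OF N.Cinf_one that(2,3,3)] that(1)] by simp
    have "R [\<alpha>, dff N g] p v = 0" if g: "g \<in> Cinf N" and a: "\<alpha> \<in> one_forms N" for g \<alpha> p v
    proof (cases "p \<in> pts N")
      case p: True
      show ?thesis
        by (rule N.tensor_zero[OF p, of "\<lambda>\<alpha>. R [\<alpha>, dff N g] p v"])
           (use g a eq a1 s1 N.dff_one_form in auto)
    qed (use out g a N.dff_one_form in auto)
    then have z: "R [\<alpha>, dff N g] p v = 0" if "g \<in> Cinf N" for g p v using as that by blast
    have "R [\<alpha>, \<beta>] p v = 0" for p v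
    proof (cases "p \<in> pts N")
      case p: True
      show ?thesis
        by (rule N.tensor_zero[OF p, of "\<lambda>\<beta>. R [\<alpha>, \<beta>] p v"])
           (use as z a2 s2 in auto)
    qed (use out as in auto)
    then show ?thesis unfolding as by (intro ext) simp
  next
    case False
    then show ?thesis using k_vectorsD(1)[OF R False] by simp
  qed
qed

lemma k_vectors_1I:
  assumes "\<And>\<alpha>. \<alpha> \<in> one_forms N \<Longrightarrow> q \<alpha> \<in> Z"
    and "\<And>f \<alpha> \<beta>. f \<in> Cinf N \<Longrightarrow> \<alpha> \<in> one_forms N \<Longrightarrow> \<beta> \<in> one_forms N \<Longrightarrow>
      q (fscale f \<alpha> + \<beta>) = fscale f (q \<alpha>) + q \<beta>"
  shows "(\<lambda>as. if length as = 1 \<and> set as \<subseteq> one_forms N then q (hd as) else 0) \<in> k_vectors N Z 1"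
  unfolding k_vectors_def mem_Collect_eq
proof (intro conjI allI impI ballI)
  fix as assume as: "length as = 1 \<and> set as \<subseteq> one_forms N"
  then obtain \<alpha> where a: "as = [\<alpha>]" "\<alpha> \<in> one_forms N" by (auto simp: length_Suc_conv)
  show "(if length as = 1 \<and> set as \<subseteq> one_forms N then q (hd as) else 0) \<in> Z"
    using a assms(1) by simp
  fix i f \<beta> \<gamma> assume "i < (1::nat)" "f \<in> Cinf N" "\<beta> \<in> one_forms N" "\<gamma> \<in> one_forms N"
  then show "(if length (as[i := fscale f \<beta> + \<gamma>]) = 1 \<and> set (as[i := fscale f \<beta> + \<gamma>]) \<subseteq> one_forms N
       then q (hd (as[i := fscale f \<beta> + \<gamma>])) else 0) =
      fscale f (if length (as[i := \<beta>]) = 1 \<and> set (as[i := \<beta>]) \<subseteq> one_forms N then q (hd (as[i := \<beta>])) else 0) +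
      (if length (as[i := \<gamma>]) = 1 \<and> set (as[i := \<gamma>]) \<subseteq> one_forms N then q (hd (as[i := \<gamma>])) else 0)"
    using a assms(2) N.one_forms_add N.one_forms_fscale by simp
qed auto

text \<open>By the Jacobi identity, bracketing with a acts on conormal sections by derivations, and
  a derivation preserves the centre.\<close>

lemma center_bS: "a \<in> L \<Longrightarrow> z \<in> center_G M \<pi> N \<Longrightarrow> bS a z \<in> center_G M \<pi> N"
proof -
  assume a: "a \<in> L" and z: "z \<in> center_G M \<pi> N"
  then have zC: "z \<in> C" by (simp add: center_mem)
  have "bS (bS a z) \<eta> = 0" if e: "\<eta> \<in> C" for \<eta>
    using bS_jacobi[OF a C_L[OF zC] C_L[OF e]] z e bS_C[OF a e] bS_zero(1)[OF a] by (simp add: center_mem)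
  then show ?thesis using bS_C[OF a zC] by (simp add: center_mem)
qed

text \<open>A 0-cochain is a central section z. Bracketing z with the lift of a form is
  function-linear in the form because z is conormal, so it is a cochain, and on differentials it is
  the formula \<open>dD\<close>.\<close>

lemma partialD_0:
  assumes z: "z \<in> Zcochains M \<pi> N 0"
  shows "partialD M \<pi> N \<psi> e 0 z =
    (\<lambda>as. if length as = 1 \<and> set as \<subseteq> one_forms N then bS (hl (hd as)) (z []) else 0)" (is "_ = ?R")
    and "z [] \<in> center_G M \<pi> N"
proof -
  show zc: "z [] \<in> center_G M \<pi> N"
    using k_vectorsD(2)[OF z[unfolded Zcochains_def], of "[]"] by simp
  have R: "?R \<in> k_vectors N (center_G M \<pi> N) 1"
  proof (rule k_vectors_1I)
    show "bS (hl \<alpha>) (z []) \<in> center_G M \<pi> N" if "\<alpha> \<in> one_forms N" for \<alpha>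
      using center_bS[OF hl_L[OF that] zc] .
    show "bS (hl (fscale f \<alpha> + \<beta>)) (z []) = fscale f (bS (hl \<alpha>) (z [])) + bS (hl \<beta>) (z [])"
      if "f \<in> Cinf N" "\<alpha> \<in> one_forms N" "\<beta> \<in> one_forms N" for f \<alpha> \<beta>
      using that zc
      by (simp add: hl_add hl_fscale N.one_forms_fscale bS_add_left hl_L N.cosections_fscale center_mem C_L
          bS_fscale_C_left)
  qed
  have dD0: "dD M \<pi> N \<psi> e 0 z [f] = bS (hd' f) (z [])" for f
  proof -
    have "fscale (\<lambda>_. 1) a = a" for a :: "'m cofield" by (simp add: fun_eq_iff)
    then show ?thesis by (simp add: dD_def Dconn_eq omit_def)
  qed
  show "partialD M \<pi> N \<psi> e 0 z = ?R"
    unfolding partialD_def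
  proof (rule the_equality)
    show "?R \<in> Zcochains M \<pi> N (Suc 0) \<and>
      (\<forall>fs. length fs = Suc 0 \<and> set fs \<subseteq> Cinf N \<longrightarrow> ?R (map (dff N) fs) = dD M \<pi> N \<psi> e 0 z fs)"
      using R dD0 N.dff_one_form by (auto simp: Zcochains_def length_Suc_conv)
    fix R assume r: "R \<in> Zcochains M \<pi> N (Suc 0) \<and>
      (\<forall>fs. length fs = Suc 0 \<and> set fs \<subseteq> Cinf N \<longrightarrow> R (map (dff N) fs) = dD M \<pi> N \<psi> e 0 z fs)"
    have "R [dff N f] = bS (hd' f) (z [])" if "f \<in> Cinf N" for f
      using spec[OF conjunct2[OF r], of "[f]"] that dD0 by simp
    then show "R = ?R"
      using r R N.dff_one_form
      by (intro k_vectors_1_eq[of _ "center_G M \<pi> N"]) (auto simp: Zcochains_def center_mem C_L)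
  qed
qed

section \<open>Quotient spaces and Hamiltonian derivations\<close>

lemma quot_trivialD:
  fixes A B :: "'z::monoid_add set"
  assumes "quot_space A B = {B}" "0 \<in> B" "x \<in> A"
  shows "x \<in> B"
proof -
  have "(\<lambda>b. x + b) ` B \<in> quot_space A B" using assms(3) by (simp add: quot_space_def)
  then have "(\<lambda>b. x + b) ` B = B" using assms(1) by simp
  then have "x + 0 \<in> B" using assms(2) by blast
  then show ?thesis by simp
qed

abbreviation ab :: "'m aff \<Rightarrow> 'm aff \<Rightarrow> 'm aff" where "ab \<equiv> aff_bracket M \<pi> N \<psi> e"

lemma Caff_mem: "(f, \<eta>) \<in> Caff M N \<longleftrightarrow> f \<in> Cinf N \<and> \<eta> \<in> C"
  by (simp add: Caff_def)

lemma Caff_add: "a \<in> Caff M N \<Longrightarrow> b \<in> Caff M N \<Longrightarrow> a + b \<in> Caff M N"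
  and Caff_diff: "a \<in> Caff M N \<Longrightarrow> b \<in> Caff M N \<Longrightarrow> a - b \<in> Caff M N"
  by (auto simp: Caff_def N.Cinf_add C_add N.Cinf_diff C_diff)

lemma Caff_zero: "0 \<in> Caff M N" by (simp add: zero_prod_def Caff_mem N.Cinf_zero C_zero)

lemma ab_add_left:
  assumes "a \<in> Caff M N" "a' \<in> Caff M N" "b \<in> Caff M N"
  shows "ab (a + a') b = ab a b + ab a' b"
proof -
  obtain f \<eta> f' \<eta>' g \<xi> where d: "a = (f, \<eta>)" "a' = (f', \<eta>')" "b = (g, \<xi>)" by (cases a, cases a', cases b) auto
  show ?thesis
    using assms unfolding d
    by (simp add: Caff_mem aff_bracket_eq N.Cinf_add pb_add_left hd_add bS_add_left bS_add hd_L C_L K_add_left)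
qed

definition ham :: "'m aff \<Rightarrow> 'm aff \<Rightarrow> 'm aff" where
  "ham a b = (if b \<in> Caff M N then ab a b else 0)"

lemma Ham_P_eq: "Ham_P M \<pi> N \<psi> e = ham ` Caff M N"
  by (simp add: Ham_P_def ham_def[abs_def])

lemma ham_add: "a \<in> Caff M N \<Longrightarrow> a' \<in> Caff M N \<Longrightarrow> ham (a + a') = ham a + ham a'"
  by (auto simp: ham_def ab_add_left fun_eq_iff)

text \<open>Since \<open>ham\<close> is additive in its first argument, Hamiltonian derivations form
  a group, and translation by a member permutes them.\<close>

lemma Ham_coset:
  assumes "x \<in> Ham_P M \<pi> N \<psi> e"
  shows "(\<lambda>b. x + b) ` Ham_P M \<pi> N \<psi> e = Ham_P M \<pi> N \<psi> e"
proof -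
  obtain a where a: "a \<in> Caff M N" "x = ham a" using assms by (auto simp: Ham_P_eq)
  have 1: "x + ham b = ham (a + b)" if "b \<in> Caff M N" for b using ham_add[OF a(1) that] a by simp
  have 2: "ham b = x + ham (b - a)" if "b \<in> Caff M N" for b
    using ham_add[OF a(1) Caff_diff[OF that a(1)]] a by simp
  show ?thesis
    unfolding Ham_P_eq image_image
  proof (intro subset_antisym image_subsetI)
    show "x + ham b \<in> ham ` Caff M N" if "b \<in> Caff M N" for b
      unfolding 1[OF that] by (rule imageI) (rule Caff_add[OF a(1) that])
    show "ham b \<in> (\<lambda>b. x + ham b) ` Caff M N" if "b \<in> Caff M N" for b
      using 2[OF that] by (rule image_eqI) (rule Caff_diff[OF that a(1)])
  qed
qed

text \<open>Makes the quotient nonempty: an empty set of derivations would give the empty set of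
  cosets instead of the zero space.\<close>

lemma zero_Poiss: "0 \<in> Poiss_P M \<pi> N \<psi> e"
proof -
  have 1: "ab 0 b = 0" "ab b 0 = 0" if "b \<in> Caff M N" for b
    using that
    by (cases b; simp add: zero_prod_def Caff_mem aff_bracket_eq N.Cinf_zero pb_zero hd_zero bS_zero hd_L C_L K_zero)+
  have 2: "aff_mult 0 b = 0" "aff_mult b 0 = 0" "aff_scale c 0 = 0" for b c
    by (cases b; auto simp: aff_mult_def aff_scale_def zero_prod_def fun_eq_iff)+
  show ?thesis by (simp add: Poiss_P_def 1 2 Caff_zero)
qed

end

section \<open>Poisson derivations of the infinitesimal Poisson algebra\<close>

lemma (in manifold) dff_const: "dff M (\<lambda>p. if p \<in> pts M then c else 0) = 0"
proof (intro ext)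
  fix p v
  have "v (\<lambda>p. if p \<in> pts M then c else 0) = 0" if "p \<in> pts M" "v \<in> tangent M p"
  proof (rule tangent_const[OF that(2,1) Cinf_const])
    show "\<forall>\<^sub>F q in nbM p. (if q \<in> pts M then c else 0) = c"
      using eventually_nb_in by (rule eventually_mono) simp
  qed
  then show "dff M (\<lambda>p. if p \<in> pts M then c else 0) p v = 0 p v" by (simp add: dff_def)
qed

context infinitesimal
begin

context
  fixes X
  assumes X: "X \<in> Poiss_P M \<pi> N \<psi> e"
begin

lemma X_out: "a \<notin> Caff M N \<Longrightarrow> X a = 0"
  and X_Caff: "a \<in> Caff M N \<Longrightarrow> X a \<in> Caff M N"
  and X_add: "a \<in> Caff M N \<Longrightarrow> b \<in> Caff M N \<Longrightarrow> X (a + b) = X a + X b"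
  and X_scale: "a \<in> Caff M N \<Longrightarrow> X (aff_scale c a) = aff_scale c (X a)"
  and X_mult: "a \<in> Caff M N \<Longrightarrow> b \<in> Caff M N \<Longrightarrow> X (aff_mult a b) = aff_mult (X a) b + aff_mult a (X b)"
  and X_ab: "a \<in> Caff M N \<Longrightarrow> b \<in> Caff M N \<Longrightarrow> X (ab a b) = ab (X a) b + ab a (X b)"
  using X unfolding Poiss_P_def mem_Collect_eq by (elim conjE, blast)+

definition v :: "('m \<Rightarrow> real) \<Rightarrow> 'm \<Rightarrow> real" where "v f = fst (X (f, 0))"
definition Q :: "('m \<Rightarrow> real) \<Rightarrow> 'm cofield" where "Q f = snd (X (f, 0))"
definition u :: "'m cofield \<Rightarrow> 'm \<Rightarrow> real" where "u \<eta> = fst (X (0, \<eta>))"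
definition T :: "'m cofield \<Rightarrow> 'm cofield" where "T \<eta> = snd (X (0, \<eta>))"

lemma f0: "f \<in> Cinf N \<Longrightarrow> (f, 0) \<in> Caff M N" and n0: "\<eta> \<in> C \<Longrightarrow> (0, \<eta>) \<in> Caff M N"
  by (simp_all add: Caff_mem C_zero N.Cinf_zero)

lemma X_f0: "X (f, 0) = (v f, Q f)" and X_0n: "X (0, \<eta>) = (u \<eta>, T \<eta>)"
  by (simp_all add: v_def Q_def u_def T_def)

lemma v_Cinf: "f \<in> Cinf N \<Longrightarrow> v f \<in> Cinf N" and Q_C: "f \<in> Cinf N \<Longrightarrow> Q f \<in> C"
  using X_Caff[OF f0, of f] by (simp_all add: X_f0 Caff_mem)

lemma u_Cinf: "\<eta> \<in> C \<Longrightarrow> u \<eta> \<in> Cinf N" and T_C: "\<eta> \<in> C \<Longrightarrow> T \<eta> \<in> C"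
  using X_Caff[OF n0, of \<eta>] by (simp_all add: X_0n Caff_mem)

lemma X_split: "f \<in> Cinf N \<Longrightarrow> \<eta> \<in> C \<Longrightarrow> X (f, \<eta>) = (v f + u \<eta>, Q f + T \<eta>)"
  using X_add[OF f0 n0, of f \<eta>] by (simp add: X_f0 X_0n)

lemma X_zero: "u 0 = 0" "T 0 = 0" "v 0 = 0" "Q 0 = 0"
  using X_add[OF Caff_zero Caff_zero] by (simp_all add: u_def T_def v_def Q_def zero_prod_def)

lemma v_add: "f \<in> Cinf N \<Longrightarrow> g \<in> Cinf N \<Longrightarrow> v (f + g) = v f + v g"
  and Q_add: "f \<in> Cinf N \<Longrightarrow> g \<in> Cinf N \<Longrightarrow> Q (f + g) = Q f + Q g"
  using X_add[OF f0 f0, of f g] by (simp_all add: X_f0)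

lemma T_add: "\<eta> \<in> C \<Longrightarrow> \<xi> \<in> C \<Longrightarrow> T (\<eta> + \<xi>) = T \<eta> + T \<xi>"
  using X_add[OF n0 n0, of \<eta> \<xi>] by (simp_all add: X_0n)

lemma v_scale: "f \<in> Cinf N \<Longrightarrow> v (\<lambda>p. c * f p) = (\<lambda>p. c * v f p)"
  and Q_scale: "f \<in> Cinf N \<Longrightarrow> Q (\<lambda>p. c * f p) = fscale (\<lambda>_. c) (Q f)"
  using X_scale[OF f0, of f c] by (simp_all add: X_f0 aff_scale_def)

lemma v_mult: "f \<in> Cinf N \<Longrightarrow> g \<in> Cinf N \<Longrightarrow> v (f * g) = f * v g + g * v f"
  and Q_mult: "f \<in> Cinf N \<Longrightarrow> g \<in> Cinf N \<Longrightarrow> Q (f * g) = fscale f (Q g) + fscale g (Q f)"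
  using X_mult[OF f0 f0, of f g] by (simp_all add: X_f0 aff_mult_def algebra_simps)

lemma u_fscale: "f \<in> Cinf N \<Longrightarrow> \<eta> \<in> C \<Longrightarrow> u (fscale f \<eta>) = f * u \<eta>"
  and T_fscale: "f \<in> Cinf N \<Longrightarrow> \<eta> \<in> C \<Longrightarrow> T (fscale f \<eta>) = fscale (v f) \<eta> + fscale f (T \<eta>)"
  using X_mult[OF f0 n0, of f \<eta>] by (simp_all add: X_f0 X_0n aff_mult_def)

lemma u_relation: "\<eta> \<in> C \<Longrightarrow> \<xi> \<in> C \<Longrightarrow> fscale (u \<eta>) \<xi> + fscale (u \<xi>) \<eta> = 0"
  using X_mult[OF n0 n0, of \<eta> \<xi>] X_0n[of 0] by (simp add: X_0n X_zero aff_mult_def)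

text \<open>With \<xi> = \<eta> the relation shows that \<eta> vanishes wherever u \<eta> does not,
  and then every conormal section vanishes at that point. In positive codimension this is absurd; in
  codimension zero \<eta> vanishes as a germ, and function-linearity of u kills u \<eta>.\<close>

lemma u_zero:
  assumes n: "\<eta> \<in> C" shows "u \<eta> = 0"
proof
  fix p
  show "u \<eta> p = 0 p"
  proof (cases "p \<in> pts N")
    case p: True
    have "u \<eta> p = 0"
    proof (rule ccontr)
      assume ne: "u \<eta> p \<noteq> 0"
      have rel: "u \<eta> p * \<xi> p w + u \<xi> p * \<eta> p w = 0" if "\<xi> \<in> C" for \<xi> w
        using fun_cong[OF fun_cong[OF u_relation[OF n that], of p], of w] by simp
      have "\<eta> p w = 0" for w using rel[OF n, of w] ne by simp
      then have van: "\<xi> p w = 0" if "\<xi> \<in> C" for \<xi> w using rel[OF that, of w] ne by simp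
      have pM: "p \<in> pts M" using p pts_sub by auto
      from codim_cases[OF p] show False
      proof
        assume "\<forall>\<^sub>F q in nbN p. \<forall>v\<in>tangent M q. \<exists>w\<in>tangent N q. v = push M N w"
        then have ev: "\<forall>\<^sub>F q in nbN p. \<eta> q = 0"
          using eventually_nb_in
        proof eventually_elim
          case (elim q)
          show ?case
          proof (rule cotangent_ext[OF N.cosections_cotangent'[OF C_L[OF n]] zero_cotangent])
            fix v assume "v \<in> tangent M q"
            then obtain w where "w \<in> tangent N q" "v = push M N w" using elim by blast
            then show "\<eta> q v = 0 v" using n elim(2) by (simp add: conormal_sections_def)
          qed
        qed
        obtain \<theta> where th: "\<theta> \<in> Cinf N" "\<theta> p = 1" "\<forall>q. \<theta> q = 0 \<or> \<eta> q = 0"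
          using N.bump_point[OF p ev] by blast
        have "\<theta> q * \<eta> q v = 0" for q v using spec[OF th(3), of q] by auto
        then have "fscale \<theta> \<eta> = 0" by (simp add: fun_eq_iff)
        then have "\<theta> * u \<eta> = 0" using u_fscale[OF th(1) n] X_zero by simp
        then have "\<theta> p * u \<eta> p = 0" by (metis times_fun_apply zero_fun_apply)
        then show False using ne th(2) by simp
      next
        assume "\<exists>x\<in>Cinf M. restr N x = 0 \<and> (\<exists>v\<in>tangent M p. v x \<noteq> 0)"
        then obtain x v where x: "x \<in> Cinf M" "restr N x = 0" "v \<in> tangent M p" "v x \<noteq> 0" by blast
        \<comment> \<open>The differential of a function vanishing on N is conormal, and by the
          choice of x it is not zero at p.\<close>
        let ?\<xi> = "restr_sec (dff M x)"
        have "?\<xi> q (push M N w) = 0" if "q \<in> pts N" "w \<in> tangent N q" for q w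
          using x that push_tangent[OF that(2,1)] pts_sub N.tangent_zero[OF that(2)]
          by (auto simp: restr_sec_def dff_apply push_apply)
        then have "?\<xi> \<in> C"
          using restr_sec_cosection[OF M.dff_one_form[OF x(1)]] by (simp add: conormal_sections_def)
        moreover have "?\<xi> p v = v x" using p pM x(3) by (simp add: restr_sec_def dff_apply)
        ultimately show False using van x(4) by metis
      qed
    qed
    then show ?thesis by simp
  qed (use N.Cinf_outside[OF u_Cinf[OF n]] in simp)
qed

lemma X_eq: "f \<in> Cinf N \<Longrightarrow> \<eta> \<in> C \<Longrightarrow> X (f, \<eta>) = (v f, Q f + T \<eta>)"
  by (simp add: X_split u_zero)

lemma bS_zero_zero: "bS 0 0 = 0" by (rule bS_zero(1)[OF N.cosections_zero])

lemma ab_f0: "f \<in> Cinf N \<Longrightarrow> g \<in> Cinf N \<Longrightarrow> ab (f, 0) (g, 0) = (pb f g, K f g)"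
  by (simp add: aff_bracket_eq bS_zero hd_L N.cosections_zero)

text \<open>The two components of the bracket rule for (f, 0) and (g, 0): the first makes v a
  Poisson derivation, the second expresses through T and K how far Q is from being a
  cocycle.\<close>

lemma v_pb: "f \<in> Cinf N \<Longrightarrow> g \<in> Cinf N \<Longrightarrow> v (pb f g) = pb (v f) g + pb f (v g)"
  and Q_pb: "f \<in> Cinf N \<Longrightarrow> g \<in> Cinf N \<Longrightarrow>
    Q (pb f g) + T (K f g) = K (v f) g - bS (hd' g) (Q f) + (bS (hd' f) (Q g) + K f (v g))"
  using X_ab[OF f0 f0, of f g]
  by (simp_all add: X_f0 ab_f0 aff_bracket_eq X_eq N.pbracket_Cinf K_C v_Cinf bS_zero bS_zero_zero hd_L Q_C C_L
      algebra_simps)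

text \<open>The bracket rule for (f, 0) and (0, \<eta>). It is what later forces the remainder of Q
  to be central.\<close>

lemma T_D:
  assumes f: "f \<in> Cinf N" and n: "\<eta> \<in> C"
  shows "T (bS (hd' f) \<eta>) = bS (hd' (v f)) \<eta> + bS (Q f) \<eta> + bS (hd' f) (T \<eta>)"
  using X_ab[OF f0[OF f] n0[OF n]] f n
  by (simp add: X_f0 X_0n u_zero aff_bracket_eq N.Cinf_zero v_Cinf pb_zero hd_zero bS_zero bS_zero_zero C_L Q_C
      T_C K_zero hd_L bS_C)

lemma T_bS:
  assumes n: "\<eta> \<in> C" and x: "\<xi> \<in> C"
  shows "T (bS \<eta> \<xi>) = bS (T \<eta>) \<xi> + bS \<eta> (T \<xi>)"
  using X_ab[OF n0[OF n] n0[OF x]] n x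
  by (simp add: X_0n u_zero aff_bracket_eq N.Cinf_zero pb_zero hd_zero bS_zero C_L T_C K_zero)

lemma v_hamiltonian:
  assumes "H1_S N \<psi> = {Ham_S N \<psi>}"
  obtains h where "h \<in> Cinf N" "\<And>f. f \<in> Cinf N \<Longrightarrow> v f = pb h f"
proof -
  \<comment> \<open>The derivation v as a vector field; the value 0 off \<open>Cinf N\<close> is the
    convention of \<open>tangent\<close>.\<close>
  define V where "V p f = (if f \<in> Cinf N then v f p else 0)" for p f
  have actV: "act V f = v f" if "f \<in> Cinf N" for f using that by (simp add: act_def V_def)
  have "V p \<in> tangent N p" for p
    by (auto simp: tangent_def V_def N.Cinf_add N.Cinf_mult N.Cinf_scale v_add v_mult v_scale)
  moreover have "V p = 0" if "p \<notin> pts N" for p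
    using N.Cinf_outside[OF v_Cinf that] by (simp add: V_def fun_eq_iff)
  ultimately have Vf: "V \<in> vector_fields N"
    by (simp add: vector_fields_def actV v_Cinf)
  have "lie_bivector N V \<psi> \<alpha> \<beta> = 0" if "\<alpha> \<in> one_forms N" "\<beta> \<in> one_forms N" for \<alpha> \<beta>
    by (rule N.lie_bivector_zero[OF Vf _ that]) (simp add: actV N.pbracket_Cinf v_pb)
  then have VP: "V \<in> Poiss_S N \<psi>" using Vf by (simp add: Poiss_S_def)
  have z: "0 \<in> Ham_S N \<psi>"
  proof -
    have "sharp N \<psi> (dff N 0) = 0"
      by (simp add: N.dff_zero sharp_def N.pi_zero[OF N.dff_cotangent] fun_eq_iff)
    then show ?thesis unfolding Ham_S_def using N.Cinf_zero by (metis imageI)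
  qed
  have "V \<in> Ham_S N \<psi>" by (rule quot_trivialD[OF assms[unfolded H1_S_def] z VP])
  then obtain h where h: "h \<in> Cinf N" "V = sharp N \<psi> (dff N h)" by (auto simp: Ham_S_def)
  have "v f = pb h f" if "f \<in> Cinf N" for f
    using actV[OF that] N.act_sharp_dff[OF that, of h] h(2) by simp
  then show ?thesis using that h by blast
qed

text \<open>T and the bracket with \<open>hd' h\<close> obey Leibniz rules with the same scalar part
  {h, -}, so their difference is function-linear; the Jacobi identity makes it a derivation of the
  bracket, and (b) applies.\<close>

lemma T_inner:
  assumes "H1_G M \<pi> N = {Inn_G M \<pi> N}" and h: "h \<in> Cinf N" and vh: "\<And>f. f \<in> Cinf N \<Longrightarrow> v f = pb h f"
  obtains \<xi>0 where "\<xi>0 \<in> C" "\<And>\<eta>. \<eta> \<in> C \<Longrightarrow> T \<eta> = bS (hd' h) \<eta> + bS \<xi>0 \<eta>"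
proof -
  note H = hd_L[OF h]
  define \<Delta> where "\<Delta> \<eta> = (if \<eta> \<in> C then T \<eta> - bS (hd' h) \<eta> else 0)" for \<eta>
  have D: "\<Delta> \<in> Der_G M \<pi> N"
    unfolding Der_G_def mem_Collect_eq
  proof (intro conjI allI impI ballI)
    show "\<Delta> \<xi> \<in> C" if "\<xi> \<in> C" for \<xi> using that H by (simp add: \<Delta>_def C_diff T_C bS_C)
    show "\<Delta> (\<xi> + \<eta>) = \<Delta> \<xi> + \<Delta> \<eta>" if "\<xi> \<in> C" "\<eta> \<in> C" for \<xi> \<eta>
      using that H by (simp add: \<Delta>_def C_add T_add bS_add C_L)
    show "\<Delta> (fscale f \<xi>) = fscale f (\<Delta> \<xi>)" if "f \<in> Cinf N" "\<xi> \<in> C" for f \<xi>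
      using that H by (simp add: \<Delta>_def C_fscale T_fscale bS_leibniz C_L rho_hd h vh fscale_distrib)
    show "\<Delta> (bS \<xi> \<eta>) = bS (\<Delta> \<xi>) \<eta> + bS \<xi> (\<Delta> \<eta>)" if "\<xi> \<in> C" "\<eta> \<in> C" for \<xi> \<eta>
      using that H bS_jacobi[OF H C_L[OF that(1)] C_L[OF that(2)]]
      by (simp add: \<Delta>_def bS_C C_L T_bS T_C bS_diff bS_diff_left bS_L)
  qed (simp add: \<Delta>_def)
  have z: "0 \<in> Inn_G M \<pi> N"
    unfolding Inn_G_def by (rule image_eqI[OF _ C_zero]) (auto simp: fun_eq_iff bS_zero C_L)
  have "\<Delta> \<in> Inn_G M \<pi> N" by (rule quot_trivialD[OF assms(1)[unfolded H1_G_def] z D])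
  then obtain \<xi>0 where x: "\<xi>0 \<in> C" "\<Delta> = (\<lambda>\<eta>. if \<eta> \<in> C then bS \<xi>0 \<eta> else 0)" by (auto simp: Inn_G_def)
  have "T \<eta> = bS (hd' h) \<eta> + bS \<xi>0 \<eta>" if "\<eta> \<in> C" for \<eta>
    using fun_cong[OF x(2), of \<eta>] that by (simp add: \<Delta>_def algebra_simps)
  then show ?thesis using that x by blast
qed

text \<open>For fixed p and x the map f |-> (q f)(p)(x) is a derivation at p, that is a tangent
  vector of N, and a 1-form can be evaluated on it; on df this returns q f. No local presentation
  enters, and linearity in the form is built in.\<close>

lemma cochain_extension:
  assumes Z: "\<And>f. f \<in> Cinf N \<Longrightarrow> q f \<in> center_G M \<pi> N"
    and add: "\<And>f g. f \<in> Cinf N \<Longrightarrow> g \<in> Cinf N \<Longrightarrow> q (f + g) = q f + q g"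
    and scale: "\<And>f c. f \<in> Cinf N \<Longrightarrow> q (\<lambda>p. c * f p) = fscale (\<lambda>_. c) (q f)"
    and mult: "\<And>f g. f \<in> Cinf N \<Longrightarrow> g \<in> Cinf N \<Longrightarrow> q (f * g) = fscale f (q g) + fscale g (q f)"
  obtains R where "R \<in> Zcochains M \<pi> N 1" "\<And>f. f \<in> Cinf N \<Longrightarrow> R [dff N f] = q f"
proof -
  define w where "w p x f = (if f \<in> Cinf N then q f p x else 0)" for p x f
  define r where "r \<alpha> p x = \<alpha> p (w p x)" for \<alpha> :: "'m cofield" and p x
  have qC: "q f \<in> C" if "f \<in> Cinf N" for f using Z[OF that] by (simp add: center_mem)
  have qL: "q f \<in> L" if "f \<in> Cinf N" for f using C_L[OF qC[OF that]] .
  note qc = N.cosections_cotangent'[OF qL]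
  have wt: "w p x \<in> tangent N p" for p x
    by (auto simp: tangent_def w_def N.Cinf_add N.Cinf_mult N.Cinf_scale add mult scale)
  have w0: "w p x = 0" if "p \<notin> pts N" for p x
    using N.cosections_outside[OF qL that] by (auto simp: w_def fun_eq_iff)
  have rc: "r \<alpha> p \<in> cotangent M p" if a: "\<alpha> \<in> one_forms N" for \<alpha> p
    unfolding cotangent_def mem_Collect_eq
  proof (intro conjI allI impI ballI)
    note ac = N.one_forms_cotangent[OF a]
    fix x assume "x \<notin> tangent M p"
    then have "w p x = 0" using cotangent_outside[OF qc] by (auto simp: w_def fun_eq_iff)
    then show "r \<alpha> p x = 0" using N.cotangent_zero[OF ac] by (simp add: r_def)
  next
    note ac = N.one_forms_cotangent[OF a]
    fix x y assume "x \<in> tangent M p" "y \<in> tangent M p"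
    then have "w p (x + y) = w p x + w p y" using cotangent_add[OF qc] by (auto simp: w_def fun_eq_iff)
    then show "r \<alpha> p (x + y) = r \<alpha> p x + r \<alpha> p y" using cotangent_add[OF ac wt wt] by (simp add: r_def)
  next
    note ac = N.one_forms_cotangent[OF a]
    fix c x assume "x \<in> tangent M p"
    then have "w p (\<lambda>f. c * x f) = (\<lambda>f. c * w p x f)" using cotangent_scale[OF qc] by (auto simp: w_def fun_eq_iff)
    then show "r \<alpha> p (\<lambda>f. c * x f) = c * r \<alpha> p x" using cotangent_scale[OF ac wt] by (simp add: r_def)
  qed
  have rL: "r \<alpha> \<in> L" if a: "\<alpha> \<in> one_forms N" for \<alpha>
    unfolding cosections_def mem_Collect_eq
  proof (intro conjI allI impI ballI)
    fix p assume "p \<notin> pts N"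
    then show "r \<alpha> p = 0" using N.one_forms_outside[OF a] by (simp add: r_def fun_eq_iff)
  next
    fix Y assume Y: "Y \<in> vector_fields M"
    \<comment> \<open>Contracting with a vector field Y of M turns the family of tangent vectors
      into a smooth vector field on N, which gives the smoothness of
      \<open>r \<alpha>\<close>.\<close>
    define W where "W p = w p (Y p)" for p
    have "act W f = ev (q f) Y" if "f \<in> Cinf N" for f using that by (simp add: act_def W_def w_def ev_def)
    then have "W \<in> vector_fields N"
      using N.cosections_ev[OF qL Y] by (simp add: vector_fields_def) (simp add: W_def wt w0)
    moreover have "ev (r \<alpha>) Y = ev \<alpha> W" by (simp add: ev_def r_def W_def)
    ultimately show "ev (r \<alpha>) Y \<in> Cinf N" using N.one_forms_ev[OF a] by simp
  qed (rule rc[OF a])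
  have rC: "r \<alpha> \<in> C" if a: "\<alpha> \<in> one_forms N" for \<alpha>
  proof -
    have "r \<alpha> p (push M N y) = 0" if p: "p \<in> pts N" and y: "y \<in> tangent N p" for p y
    proof -
      have "w p (push M N y) = 0" using qC p y by (auto simp: w_def conormal_sections_def fun_eq_iff)
      then show ?thesis using N.cotangent_zero[OF N.one_forms_cotangent[OF a]] by (simp add: r_def)
    qed
    then show ?thesis using rL[OF a] by (simp add: conormal_sections_def)
  qed
  have rd: "r (dff N f) = q f" if f: "f \<in> Cinf N" for f
  proof (rule L_ext[OF rL[OF N.dff_one_form[OF f]] qL[OF f]])
    fix p assume "p \<in> pts N"
    then show "r (dff N f) p = q f p" using wt f by (simp add: r_def dff_apply fun_eq_iff) (simp add: w_def)
  qed
  have r_lin: "r (fscale f \<alpha> + \<beta>) = fscale f (r \<alpha>) + r \<beta>" for f \<alpha> \<beta>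
    by (simp add: r_def fun_eq_iff)
  have r_add: "r (\<alpha> + \<beta>) = r \<alpha> + r \<beta>" "r (fscale f \<alpha>) = fscale f (r \<alpha>)" for f \<alpha> \<beta>
    by (simp_all add: r_def fun_eq_iff)
  \<comment> \<open>Centrality is known on differentials; the bracket with a fixed conormal section
    is function-linear in the form, so it spreads to all forms.\<close>
  have rZ: "r \<alpha> \<in> center_G M \<pi> N" if a: "\<alpha> \<in> one_forms N" for \<alpha>
  proof -
    have "bS (r \<alpha>) \<eta> = 0" if n: "\<eta> \<in> C" for \<eta>
    proof (rule L_ext[OF bS_L[OF rL[OF a] C_L[OF n]] N.cosections_zero], rule ext)
      fix p x assume p: "p \<in> pts N"
      show "bS (r \<alpha>) \<eta> p x = 0 p x"
        unfolding zero_fun_apply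
      proof (rule N.tensor_zero[OF p, of "\<lambda>\<alpha>. bS (r \<alpha>) \<eta> p x"])
        show "bS (r (dff N g)) \<eta> p x = 0" if "g \<in> Cinf N" for g
          using Z[OF that] n by (simp add: rd that center_mem)
      qed (use a n in \<open>simp_all add: r_add bS_add_left rL C_L bS_fscale_C_left\<close>)
    qed
    then show ?thesis using rC[OF a] by (simp add: center_mem)
  qed
  show ?thesis
  proof (rule that)
    show "(\<lambda>as. if length as = 1 \<and> set as \<subseteq> one_forms N then r (hd as) else 0) \<in> Zcochains M \<pi> N 1"
      unfolding Zcochains_def by (rule k_vectors_1I, erule rZ, rule r_lin)
  qed (simp add: rd N.dff_one_form)
qed

lemma Poiss_Ham:
  assumes HS: "H1_S N \<psi> = {Ham_S N \<psi>}" and HG: "H1_G M \<pi> N = {Inn_G M \<pi> N}"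
    and HD: "H1_D M \<pi> N \<psi> e = {B1_D M \<pi> N \<psi> e}"
  shows "X \<in> Ham_P M \<pi> N \<psi> e"
proof -
  obtain h where h: "h \<in> Cinf N" and vh: "\<And>f. f \<in> Cinf N \<Longrightarrow> v f = pb h f"
    using v_hamiltonian[OF HS] by blast
  obtain \<xi>0 where x0: "\<xi>0 \<in> C" and Th: "\<And>\<eta>. \<eta> \<in> C \<Longrightarrow> T \<eta> = bS (hd' h) \<eta> + bS \<xi>0 \<eta>"
    using T_inner[OF HG h vh] by blast
  \<comment> \<open>What remains of Q after subtracting the contribution of the Hamiltonian
    derivation of (h, \<xi>0).\<close>
  define q where "q f = Q f - K h f + bS (hd' f) \<xi>0" for f
  note H = hd_L[OF h] and x0L = C_L[OF x0]
  have qC: "q f \<in> C" if "f \<in> Cinf N" for f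
    unfolding q_def by (intro C_add C_diff Q_C K_C bS_C hd_L that h x0)
  have qZ: "q f \<in> center_G M \<pi> N" if f: "f \<in> Cinf N" for f
  proof -
    note F = hd_L[OF f] and hf = hd_L[OF N.pbracket_Cinf[OF h f]]
    have "bS (q f) \<eta> = 0" if n: "\<eta> \<in> C" for \<eta>
    proof (intro ext)
      fix p x
      note nL = C_L[OF n] and Qf = C_L[OF Q_C[OF f]]
      \<comment> \<open>The rule \<open>T_D\<close> with T and v replaced by their known forms.
        Together with the Jacobi identities for (h, f, \<eta>) and (f, \<xi>0, \<eta>) all terms of
        the bracket of q f with \<eta> cancel.\<close>
      have 1: "bS (hd' h) (bS (hd' f) \<eta>) + bS \<xi>0 (bS (hd' f) \<eta>) =
          bS (hd' (pb h f)) \<eta> + bS (Q f) \<eta> + (bS (hd' f) (bS (hd' h) \<eta>) + bS (hd' f) (bS \<xi>0 \<eta>))"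
        using T_D[OF f n] Th[OF n] Th[OF bS_C[OF F n]] vh[OF f]
        by (simp add: bS_add[OF F bS_L[OF H nL] bS_L[OF x0L nL]])
      note 2 = bS_jacobi[OF H F nL] and 3 = bS_jacobi[OF F x0L nL]
      have 4: "bS (q f) \<eta> = bS (Q f) \<eta> - (bS (bS (hd' h) (hd' f)) \<eta> - bS (hd' (pb h f)) \<eta>) + bS (bS (hd' f) \<xi>0) \<eta>"
        unfolding q_def K_def
        by (simp add: bS_add_left bS_diff_left N.cosections_diff N.cosections_add bS_L H F hf nL Qf x0L)
      show "bS (q f) \<eta> p x = 0 p x"
        unfolding 4 using fun_cong[OF fun_cong[OF 1, of p], of x] fun_cong[OF fun_cong[OF 2, of p], of x]
          fun_cong[OF fun_cong[OF 3, of p], of x] by simp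
    qed
    then show ?thesis using qC[OF f] by (simp add: center_mem)
  qed
  have q_add: "q (f + g) = q f + q g" if "f \<in> Cinf N" "g \<in> Cinf N" for f g
    using that h H x0L
    by (simp add: q_def Q_add K_def hd_add bS_add bS_add_left hd_L N.pbracket_Cinf pb_add algebra_simps)
  have q_mult: "q (f * g) = fscale f (q g) + fscale g (q f)" if f: "f \<in> Cinf N" and g: "g \<in> Cinf N" for f g
  proof -
    have "bS (hd' (f * g)) \<xi>0 = fscale f (bS (hd' g) \<xi>0) + fscale g (bS (hd' f) \<xi>0)"
      using that x0 x0L by (simp add: hd_mult bS_add_left bS_fscale_C_left N.cosections_fscale hd_L)
    then show ?thesis unfolding q_def Q_mult[OF f g] K_mult[OF h f g]
      by (simp add: fscale_distrib)
  qed
  have q_scale: "q (\<lambda>p. c * f p) = fscale (\<lambda>_. c) (q f)" if f: "f \<in> Cinf N" for f c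
  proof -
    \<comment> \<open>A real constant is treated as a function on N so that the product rule for q
      applies; q kills it because Q kills the unit by its Leibniz rule and the differential is
      zero.\<close>
    let ?c = "\<lambda>p. if p \<in> pts N then c else 0"
    have c: "?c \<in> Cinf N" by (rule N.Cinf_const)
    have *: "fscale ?c a = fscale (\<lambda>_. c) a" if "a \<in> L" for a
      using N.cosections_outside[OF that] by (auto simp: fun_eq_iff)
    have cf: "(\<lambda>p. c * f p) = ?c * f" using N.Cinf_outside[OF f] by (auto simp: fun_eq_iff)
    have "N.one * N.one = N.one" by (auto simp: fun_eq_iff N.one_def)
    then have "Q N.one = Q N.one + Q N.one"
      using Q_mult[OF N.Cinf_one N.Cinf_one] N.fscale_one[OF C_L[OF Q_C[OF N.Cinf_one]]] by simp
    moreover have "?c = (\<lambda>p. c * N.one p)" by (auto simp: fun_eq_iff N.one_def)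
    ultimately have Qc: "Q ?c = 0" using Q_scale[OF N.Cinf_one] by simp
    have dc: "dff N ?c = 0" by (rule N.dff_const)
    have hz: "hl 0 = 0" using hd_zero N.dff_zero by simp
    have pz: "pb h ?c = 0"
      using pb_zero(1)[OF h] by (simp add: pbracket_def dc N.dff_zero)
    have qc: "q ?c = 0"
      unfolding q_def K_def Qc pz hd_zero dc hz by (simp add: bS_zero H x0L)
    show ?thesis
      unfolding cf q_mult[OF c f] qc using *[OF C_L[OF qC[OF f]]] by simp
  qed
  obtain R where R: "R \<in> Zcochains M \<pi> N 1" and Rq: "\<And>f. f \<in> Cinf N \<Longrightarrow> R [dff N f] = q f"
    using cochain_extension[OF qZ q_add q_scale q_mult] by blast
  \<comment> \<open>Everything is expanded into brackets of lifts and of \<xi>0. The cancellation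
    comes from \<open>Q_pb\<close> with T and v replaced (\<open>a4\<close>), the Jacobi identity of
    \<psi> (\<open>a5\<close>), those for (h, f, g) and (f, g, \<xi>0), and skew-symmetry.\<close>
  have cocycle: "bS (hd' f) (q g) - bS (hd' g) (q f) - q (pb f g) = 0" if f: "f \<in> Cinf N" and g: "g \<in> Cinf N" for f g
  proof (intro ext)
    fix p :: 'm and x
    note F = hd_L[OF f] and G = hd_L[OF g] and Qf = C_L[OF Q_C[OF f]] and Qg = C_L[OF Q_C[OF g]]
    note hf = N.pbracket_Cinf[OF h f] and hg = N.pbracket_Cinf[OF h g] and fg = N.pbracket_Cinf[OF f g]
    note HF = hd_L[OF hf] and HG = hd_L[OF hg] and FG = hd_L[OF fg]

    \<comment> \<open>Evaluation at p and x turns identities of sections into linear equations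
      between reals, with the bracket values as atoms.\<close>
    have pt: "a p x = b p x" if "a = b" for a b :: "'m cofield" using that by simp
    have a1: "bS (hd' f) (q g) = bS (hd' f) (Q g) - (bS (hd' f) (bS (hd' h) (hd' g)) - bS (hd' f) (hd' (pb h g)))
        + bS (hd' f) (bS (hd' g) \<xi>0)"
      unfolding q_def K_def
      by (simp add: bS_add bS_diff N.cosections_diff N.cosections_add bS_L H F G HG Qg x0L)
    have a2: "bS (hd' g) (q f) = bS (hd' g) (Q f) - (bS (hd' g) (bS (hd' h) (hd' f)) - bS (hd' g) (hd' (pb h f)))
        + bS (hd' g) (bS (hd' f) \<xi>0)"
      unfolding q_def K_def
      by (simp add: bS_add bS_diff N.cosections_diff N.cosections_add bS_L H F G HF Qf x0L)
    have a3: "q (pb f g) = Q (pb f g) - (bS (hd' h) (hd' (pb f g)) - hd' (pb h (pb f g))) + bS (hd' (pb f g)) \<xi>0"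
      by (simp add: q_def K_def)
    have a4: "Q (pb f g) + (bS (hd' h) (bS (hd' f) (hd' g)) - bS (hd' h) (hd' (pb f g)) +
        (bS \<xi>0 (bS (hd' f) (hd' g)) - bS \<xi>0 (hd' (pb f g)))) =
      bS (hd' (pb h f)) (hd' g) - hd' (pb (pb h f) g) - bS (hd' g) (Q f) +
        (bS (hd' f) (Q g) + (bS (hd' f) (hd' (pb h g)) - hd' (pb f (pb h g))))"
      using Q_pb[OF f g] Th[OF K_C[OF f g]] vh[OF f] vh[OF g]
      by (simp add: K_def bS_diff H F G FG bS_L x0L)
    have a5: "hd' (pb h (pb f g)) = hd' (pb (pb h f) g) + hd' (pb f (pb h g))"
      using N.jacobi[OF h f g] hd_add N.pbracket_Cinf f g h by simp
    note j1 = bS_jacobi[OF H F G] and j2 = bS_jacobi[OF F G x0L]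
    note s1 = bS_skew[OF G bS_L[OF H F]] and s2 = bS_skew[OF G HF] and s3 = bS_skew[OF x0L bS_L[OF F G]]
      and s4 = bS_skew[OF x0L FG]
    show "(bS (hd' f) (q g) - bS (hd' g) (q f) - q (pb f g)) p x = 0 p x"
      using pt[OF a1] pt[OF a2] pt[OF a3] pt[OF a4] pt[OF a5] pt[OF j1] pt[OF j2] pt[OF s1] pt[OF s2] pt[OF s3] pt[OF s4]
      unfolding plus_fun_apply minus_apply uminus_apply zero_fun_apply by linarith
  qed
  have one: "fscale (\<lambda>_. 1) a = a" "fscale (\<lambda>_. - 1) a = - a" for a :: "'m cofield" by (simp_all add: fun_eq_iff)
  have dD1: "dD M \<pi> N \<psi> e 1 R [f, g] = 0" if f: "f \<in> Cinf N" and g: "g \<in> Cinf N" for f g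
  proof -
    \<comment> \<open>In degree one the second sum of \<open>dD\<close> has the single pair i = 0, j
      = 1, with sign -1.\<close>
    have s: "{..1::nat} = {0, 1}" "{..<1::nat} = {0}" by auto
    show ?thesis
      using cocycle[OF f g] Rq[OF f] Rq[OF g] Rq[OF N.pbracket_Cinf[OF f g]]
      by (simp add: dD_def s omit_def one Dconn_eq algebra_simps)
  qed
  have Z0: "0 \<in> center_G M \<pi> N" using C_zero bS_zero C_L by (simp add: center_mem)
  have "partialD M \<pi> N \<psi> e 1 R = 0"
    unfolding partialD_def
  proof (rule the_equality)
    have "0 \<in> Zcochains M \<pi> N (Suc 1)" using Z0 by (simp add: Zcochains_def k_vectors_def)
    moreover have "\<exists>f g. fs = [f, g] \<and> f \<in> Cinf N \<and> g \<in> Cinf N" if "length fs = Suc 1 \<and> set fs \<subseteq> Cinf N" for fs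
      using that by (auto simp: length_Suc_conv)
    ultimately show "0 \<in> Zcochains M \<pi> N (Suc 1) \<and>
      (\<forall>fs. length fs = Suc 1 \<and> set fs \<subseteq> Cinf N \<longrightarrow> 0 (map (dff N) fs) = dD M \<pi> N \<psi> e 1 R fs)"
      using dD1 by fastforce
    fix S assume S: "S \<in> Zcochains M \<pi> N (Suc 1) \<and>
      (\<forall>fs. length fs = Suc 1 \<and> set fs \<subseteq> Cinf N \<longrightarrow> S (map (dff N) fs) = dD M \<pi> N \<psi> e 1 R fs)"
    show "S = 0"
    proof (rule k_vectors_2_zero)
      show "S \<in> k_vectors N (center_G M \<pi> N) 2" using S by (simp add: Zcochains_def numeral_2_eq_2)
      show "S [dff N f, dff N g] = 0" if "f \<in> Cinf N" "g \<in> Cinf N" for f g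
        using spec[OF conjunct2[OF S], of "[f, g]"] dD1[OF that] that by simp
    qed (simp add: center_mem C_L)
  qed
  then have RZ: "R \<in> Z1_D M \<pi> N \<psi> e" using R by (simp add: Z1_D_def)
  have B0: "0 \<in> B1_D M \<pi> N \<psi> e"
  proof -
    have z: "0 \<in> Zcochains M \<pi> N 0" using Z0 by (simp add: Zcochains_def k_vectors_def)
    have "partialD M \<pi> N \<psi> e 0 0 = 0"
      unfolding partialD_0(1)[OF z] by (auto simp: fun_eq_iff length_Suc_conv bS_zero hl_L)
    then show ?thesis unfolding B1_D_def using z by (metis imageI)
  qed
  have "R \<in> B1_D M \<pi> N \<psi> e" by (rule quot_trivialD[OF HD[unfolded H1_D_def] B0 RZ])
  then obtain z' where z': "z' \<in> Zcochains M \<pi> N 0" "R = partialD M \<pi> N \<psi> e 0 z'" by (auto simp: B1_D_def)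
  define z where "z = z' []"
  have z: "z \<in> center_G M \<pi> N" unfolding z_def by (rule partialD_0(2)[OF z'(1)])
  have zC: "z \<in> C" using z by (simp add: center_mem)
  have qz: "q f = bS (hd' f) z" if "f \<in> Cinf N" for f
    using Rq[OF that] N.dff_one_form[OF that] unfolding z'(2) partialD_0(1)[OF z'(1)] by (simp add: z_def)
  \<comment> \<open>Passing from \<xi>0 to \<xi>0 - z leaves brackets with conormal sections
    unchanged, z being central, and adds to the part depending on f the bracket of
    \<open>hd' f\<close> with z, which is exactly q f.\<close>
  have "X = ham (h, \<xi>0 - z)"
  proof
    fix b
    show "X b = ham (h, \<xi>0 - z) b"
    proof (cases "b \<in> Caff M N")
      case True
      then obtain f \<eta> where b: "b = (f, \<eta>)" "f \<in> Cinf N" "\<eta> \<in> C" by (cases b) (auto simp: Caff_mem)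
      have "bS (\<xi>0 - z) \<eta> = bS \<xi>0 \<eta>"
        using z b by (simp add: bS_diff_left x0L C_L zC) (simp add: center_mem)
      moreover have "bS (hd' f) (\<xi>0 - z) = bS (hd' f) \<xi>0 - bS (hd' f) z"
        using b by (simp add: bS_diff hd_L x0L C_L zC)
      moreover have "Q f = K h f - bS (hd' f) \<xi>0 + bS (hd' f) z"
        using qz[OF b(2)] by (simp add: q_def algebra_simps)
      ultimately have "Q f + T \<eta> =
          bS (hd' h) \<eta> - bS (hd' f) (\<xi>0 - z) + bS (\<xi>0 - z) \<eta> + K h f"
        using Th[OF b(3)] by simp
      then show ?thesis
        using True b vh[OF b(2)] X_eq[OF b(2,3)] by (simp add: ham_def aff_bracket_eq h)
    qed (simp add: ham_def X_out)
  qed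
  moreover have "(h, \<xi>0 - z) \<in> Caff M N" using h C_diff[OF x0 zC] by (simp add: Caff_mem)
  ultimately show ?thesis unfolding Ham_P_eq by blast
qed

end

end

theorem theorem3p4:
  fixes M N :: "('m::{t2_space,second_countable_topology}, 'e::euclidean_space) mfd"
    and \<pi> \<psi> :: "'m bivec"
    and e :: "'m \<times> 'm tvec set \<Rightarrow> 'm"
  assumes "poisson_submanifold N \<psi> M \<pi>"
    and "tubular_map M N e"
    and "H1_S N \<psi> = {Ham_S N \<psi>}"
    and "H1_G M \<pi> N = {Inn_G M \<pi> N}"
    and "H1_D M \<pi> N \<psi> e = {B1_D M \<pi> N \<psi> e}"
  shows "H1_P M \<pi> N \<psi> e = {Ham_P M \<pi> N \<psi> e}"
proof -
  have p: "poisson_manifold M \<pi>" "poisson_manifold N \<psi>" "embedded_submanifold N M"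
    using assms(1) by (auto simp: poisson_submanifold_def)
  then have "smooth_manifold M" "smooth_manifold N" by (auto simp: poisson_manifold_def)
  then interpret infinitesimal M N \<pi> \<psi> e
    using p assms(1,2) by unfold_locales
  have "(\<lambda>b. X + b) ` Ham_P M \<pi> N \<psi> e = Ham_P M \<pi> N \<psi> e" if "X \<in> Poiss_P M \<pi> N \<psi> e" for X
    using Ham_coset[OF Poiss_Ham[OF that assms(3-5)]] .
  then show ?thesis
    unfolding H1_P_def quot_space_def using zero_Poiss by (auto simp: image_iff)
qed

end
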